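(* Let $p\in\{1,2,3\}$, let $(\mathbb S,\mathcal B(\mathbb S),\mathcal P)$ be the probability space of conductivities associated with the push-forward prior $\mathcal P=\mathrm{Law}(F_p(X))$, $X\sim\mathcal N(0,\mathcal C)$, and let $\Phi$ be the negative log-likelihood built with the $L^1(\Omega)$ norm, $$\Phi(y;\sigma)=\sum_{i,j=1}^d \frac{\|h_{i,j}(\sigma)-y_{i,j}\|_{L^1(\Omega)}}{\tau_{i,j}},\qquad y=(y_{i,j})_{i,j=1}^d\in L^1(\Omega)^{d\times d},$$ with likelihood $L(y;\sigma)\propto\exp(-\Phi(y;\sigma))$. Assume that $0<\sigma_{\min}<\sigma<\sigma_{\max}<\infty$ for the conductivities $\sigma\in\mathbb S$ and that the boundary data satisfy $g_i\in H^{1/2}(\partial\Omega)$ for $i=1,\dots,d$. Then: 1. For any fixed measurement $y=(y_{i,j})$ with $y_{i,j}\in L^1(\Omega)$, the map $\sigma\mapsto L(y;\sigma)$ is Borel measurable. 2. For any fixed measurement $y=(y_{i,j})$ with $\|y_{i,j}\|_{L^1(\Omega)}<\infty$, the map $\sigma\mapsto\Phi(y;\sigma)$ is $\mathcal N(0,\mathcal C)$-almost surely continuous; that is, for $\sigma=F_p(X)$ with $X\sim\mathcal N(0,\mathcal C)$, with probability one $\Phi(y;\cdot)$ is continuous at $\sigma$ with respect to the $L^\infty(\Omega)$ norm. 3. For any fixed $\sigma$ with $\sigma<\sigma_{\max}$, $\sigma_{\max}\in\mathbb R^+$, and any measurements $y^1=(y^1_{i,j})$, $y^2=(y^2_{i,j})$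 with $\max\{\|y^1_{i,j}\|_{L^1(\Omega)},\|y^2_{i,j}\|_{L^1(\Omega)}\}<r$ for all $i,j$, where $r\in\mathbb R^+$, there is a constant $C=C(r,\sigma_{\max})$ such that $$|\Phi(y^1;\sigma)-\Phi(y^2;\sigma)|\le C(r,\sigma_{\max})\sum_{i,j=1}^d\|y^1_{i,j}-y^2_{i,j}\|_{L^1(\Omega)}.$$
   Context: Setting. $\Omega\subset\mathbb R^2$ is open and bounded with Lipschitz boundary, and $d\ge1$ is an integer. For a conductivity $\sigma$ on $\Omega$, $u_i=u_i(\sigma)\in H^1(\Omega)$, $i=1,\dots,d$, is the weak solution of $\nabla\cdot(\sigma\nabla u_i)=0$ in $\Omega$, $u_i=g_i$ on $\partial\Omega$. (In the limited-view problem $g_i$ equals a prescribed voltage $f_i$ on a part $\Gamma_1$ of the boundary and $0$ on the rest $\Gamma_2$.) The power densities are $h_{i,j}(\sigma)=\sigma\,\nabla u_i\cdot\nabla u_j$, $1\le i,j\le d$. Prior. $X\sim\mathcal N(0,\mathcal C)$ is a centred Gaussian random function on $\Omega$, with values in a Hilbert function space, whose covariance operator $\mathcal C$ is symmetric, non-negative and trace-class. The conductivity is the random field $\sigma=F_p(X)$ (applied pointwise), where - $F_1(X)=\exp(X)$; - $F_2(X)=\sigma^-+(\sigma^+-\sigma^-)\mathbf 1_{[0,\infty)}(X)$; - $F_3(X)=\sigma^-+(\sigma^+-\sigma^-)\frac{1}{1+\exp(-aX)}$, with fixed constants $\sigma^+,\sigma^->0$ and $a>0$. The conductivity space $\mathbb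 S$ consists of measurable functions on $\Omega$ satisfying the bounds $\sigma_{\min}<\sigma<\sigma_{\max}$, is equipped with the $L^\infty(\Omega)$ norm topology and its Borel $\sigma$-algebra $\mathcal B(\mathbb S)$, and $\mathcal P$ is the law of $F_p(X)$, regarded as a probability measure on $\mathbb S$. The noise scales $\tau_{i,j}>0$, the domain $\Omega$, the integer $d$, the boundary data $g_i$ and the lower bound $\sigma_{\min}$ are fixed throughout; the dependence of constants on them is not displayed. *)

theory Defs
  imports "HOL-Probability.Probability"
begin

type_synonym R2 = "real^2"

text \<open>
  Functions on \<open>\<Omega>\<close> are total functions on the plane whose values off \<open>\<Omega>\<close> are irrelevant; elements
  of \<open>L\<^sup>1\<close>, \<open>L\<^sup>2\<close>, \<open>L\<^sup>\<infinity>\<close>, \<open>H\<^sup>1\<close> are represented by functions rather than by classes modulo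
  almost-everywhere equality.
\<close>

section \<open>Domains\<close>

text \<open>Near each boundary point, in suitable orthonormal coordinates \<open>(x \<bullet> e, x \<bullet> n)\<close>, the set is the
  region strictly above the graph of a Lipschitz function.\<close>
definition lipschitz_boundary :: "R2 set \<Rightarrow> bool" where
  "lipschitz_boundary \<Omega> \<longleftrightarrow>
     (\<forall>p \<in> frontier \<Omega>. \<exists>r>0. \<exists>e n. \<exists>\<gamma> :: real \<Rightarrow> real. \<exists>K.
        norm e = 1 \<and> norm n = 1 \<and> e \<bullet> n = 0 \<and> K-lipschitz_on UNIV \<gamma> \<and>
        \<Omega> \<inter> ball p r = {x \<in> ball p r. \<gamma> (x \<bullet> e) < x \<bullet> n})"

text \<open>One-dimensional Hausdorff measure. Covering sets are required to be bounded because the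
  library's \<^const>\<open>diameter\<close> is 0 on unbounded sets.\<close>
definition hausdorff1_pre :: "real \<Rightarrow> R2 set \<Rightarrow> ennreal" where
  "hausdorff1_pre \<delta> A =
     (INF U \<in> {U :: nat \<Rightarrow> R2 set. A \<subseteq> (\<Union>n. U n) \<and> (\<forall>n. bounded (U n) \<and> diameter (U n) \<le> \<delta>)}.
        (\<Sum>n. ennreal (diameter (U n))))"

definition hausdorff1_outer :: "R2 set \<Rightarrow> ennreal" where
  "hausdorff1_outer A = (SUP \<delta> \<in> {0<..}. hausdorff1_pre \<delta> A)"

definition hausdorff1 :: "R2 measure" where
  "hausdorff1 = measure_of UNIV (sets borel) hausdorff1_outer"

definition boundary_measure :: "R2 set \<Rightarrow> R2 measure" where
  "boundary_measure \<Omega> = completion (restrict_space hausdorff1 (frontier \<Omega>))"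

section \<open>Sobolev spaces\<close>

definition grad_classical :: "(R2 \<Rightarrow> real) \<Rightarrow> R2 \<Rightarrow> R2" where
  "grad_classical f x = (\<chi> k. frechet_derivative f (at x) (axis k 1))"

primrec Ck :: "nat \<Rightarrow> (R2 \<Rightarrow> real) \<Rightarrow> bool" where
  "Ck 0 f \<longleftrightarrow> continuous_on UNIV f"
| "Ck (Suc m) f \<longleftrightarrow> f differentiable_on UNIV \<and> (\<forall>k. Ck m (\<lambda>x. grad_classical f x $ k))"

definition smooth :: "(R2 \<Rightarrow> real) \<Rightarrow> bool" where
  "smooth f \<longleftrightarrow> (\<forall>m. Ck m f)"

definition test_function :: "R2 set \<Rightarrow> (R2 \<Rightarrow> real) \<Rightarrow> bool" where
  "test_function \<Omega> f \<longleftrightarrow>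
     smooth f \<and> compact (closure {x. f x \<noteq> 0}) \<and> closure {x. f x \<noteq> 0} \<subseteq> \<Omega>"

definition L2 :: "'a measure \<Rightarrow> ('a \<Rightarrow> 'b::euclidean_space) \<Rightarrow> bool" where
  "L2 M f \<longleftrightarrow> f \<in> borel_measurable M \<and> integrable M (\<lambda>x. (norm (f x))\<^sup>2)"

definition weak_gradient :: "R2 set \<Rightarrow> (R2 \<Rightarrow> real) \<Rightarrow> (R2 \<Rightarrow> R2) \<Rightarrow> bool" where
  "weak_gradient \<Omega> u v \<longleftrightarrow>
     (\<forall>f k. test_function \<Omega> f \<longrightarrow>
        (LINT x|lebesgue_on \<Omega>. u x * grad_classical f x $ k)
        = - (LINT x|lebesgue_on \<Omega>. v x $ k * f x))"

definition H1 :: "R2 set \<Rightarrow> (R2 \<Rightarrow> real) \<Rightarrow> bool" where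
  "H1 \<Omega> u \<longleftrightarrow> L2 (lebesgue_on \<Omega>) u \<and> (\<exists>v. L2 (lebesgue_on \<Omega>) v \<and> weak_gradient \<Omega> u v)"

text \<open>A representative of the weak gradient, which is unique up to null sets.\<close>
definition grad :: "R2 set \<Rightarrow> (R2 \<Rightarrow> real) \<Rightarrow> R2 \<Rightarrow> R2" where
  "grad \<Omega> u = (SOME v. L2 (lebesgue_on \<Omega>) v \<and> weak_gradient \<Omega> u v)"

text \<open>The graph of the trace operator \<open>H\<^sup>1(\<Omega>) \<rightarrow> L\<^sup>2(\<partial>\<Omega>)\<close>: the continuous extension of restriction to the
  boundary from \<open>C\<^sup>\<infinity>\<close> functions up to the boundary, which are dense in \<open>H\<^sup>1(\<Omega>)\<close> for Lipschitz \<open>\<Omega>\<close>.\<close>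
definition has_trace :: "R2 set \<Rightarrow> (R2 \<Rightarrow> real) \<Rightarrow> (R2 \<Rightarrow> real) \<Rightarrow> bool" where
  "has_trace \<Omega> u g \<longleftrightarrow> H1 \<Omega> u \<and> L2 (boundary_measure \<Omega>) g \<and>
     (\<exists>f :: nat \<Rightarrow> R2 \<Rightarrow> real. (\<forall>n. smooth (f n)) \<and>
        (\<lambda>n. (LINT x|lebesgue_on \<Omega>. (f n x - u x)\<^sup>2)
             + (LINT x|lebesgue_on \<Omega>. (norm (grad_classical (f n) x - grad \<Omega> u x))\<^sup>2))
          \<longlonglongrightarrow> 0 \<and>
        (\<lambda>n. LINT x|boundary_measure \<Omega>. (f n x - g x)\<^sup>2) \<longlonglongrightarrow> 0)"

text \<open>\<open>H\<^sup>1\<^sup>/\<^sup>2(\<partial>\<Omega>)\<close> is the trace space of \<open>H\<^sup>1(\<Omega>)\<close>.\<close>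
definition H_half :: "R2 set \<Rightarrow> (R2 \<Rightarrow> real) \<Rightarrow> bool" where
  "H_half \<Omega> g \<longleftrightarrow> (\<exists>u. has_trace \<Omega> u g)"

definition H1_0 :: "R2 set \<Rightarrow> (R2 \<Rightarrow> real) \<Rightarrow> bool" where
  "H1_0 \<Omega> v \<longleftrightarrow> has_trace \<Omega> v (\<lambda>_. 0)"

section \<open>The forward problem\<close>

definition weak_solution ::
  "R2 set \<Rightarrow> (R2 \<Rightarrow> real) \<Rightarrow> (R2 \<Rightarrow> real) \<Rightarrow> (R2 \<Rightarrow> real) \<Rightarrow> bool" where
  "weak_solution \<Omega> \<sigma> g u \<longleftrightarrow> has_trace \<Omega> u g \<and>
     (\<forall>v. H1_0 \<Omega> v \<longrightarrow> (LINT x|lebesgue_on \<Omega>. \<sigma> x * (grad \<Omega> u x \<bullet> grad \<Omega> v x)) = 0)"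

text \<open>A representative of the weak solution, which is unique only up to null sets.\<close>
definition potential :: "R2 set \<Rightarrow> (R2 \<Rightarrow> real) \<Rightarrow> (R2 \<Rightarrow> real) \<Rightarrow> R2 \<Rightarrow> real" where
  "potential \<Omega> \<sigma> g = (SOME u. weak_solution \<Omega> \<sigma> g u)"

definition power_density ::
  "R2 set \<Rightarrow> (nat \<Rightarrow> R2 \<Rightarrow> real) \<Rightarrow> (R2 \<Rightarrow> real) \<Rightarrow> nat \<Rightarrow> nat \<Rightarrow> R2 \<Rightarrow> real" where
  "power_density \<Omega> g \<sigma> i j x =
     \<sigma> x * (grad \<Omega> (potential \<Omega> \<sigma> (g i)) x \<bullet> grad \<Omega> (potential \<Omega> \<sigma> (g j)) x)"

definition L1_norm :: "R2 set \<Rightarrow> (R2 \<Rightarrow> real) \<Rightarrow> real" where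
  "L1_norm \<Omega> f = (LINT x|lebesgue_on \<Omega>. \<bar>f x\<bar>)"

definition L1_data :: "R2 set \<Rightarrow> nat \<Rightarrow> (nat \<Rightarrow> nat \<Rightarrow> R2 \<Rightarrow> real) \<Rightarrow> bool" where
  "L1_data \<Omega> d y \<longleftrightarrow> (\<forall>i\<in>{1..d}. \<forall>j\<in>{1..d}. integrable (lebesgue_on \<Omega>) (y i j))"

definition neg_log_likelihood ::
  "R2 set \<Rightarrow> nat \<Rightarrow> (nat \<Rightarrow> R2 \<Rightarrow> real) \<Rightarrow> (nat \<Rightarrow> nat \<Rightarrow> real)
    \<Rightarrow> (nat \<Rightarrow> nat \<Rightarrow> R2 \<Rightarrow> real) \<Rightarrow> (R2 \<Rightarrow> real) \<Rightarrow> real" where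
  "neg_log_likelihood \<Omega> d g \<tau> y \<sigma> =
     (\<Sum>i=1..d. \<Sum>j=1..d. L1_norm \<Omega> (\<lambda>x. power_density \<Omega> g \<sigma> i j x - y i j x) / \<tau> i j)"

section \<open>The space of conductivities\<close>

definition conductivities :: "R2 set \<Rightarrow> real \<Rightarrow> real \<Rightarrow> (R2 \<Rightarrow> real) set" where
  "conductivities \<Omega> \<sigma>min \<sigma>max =
     {\<sigma>. \<sigma> \<in> borel_measurable (lebesgue_on \<Omega>) \<and>
          (AE x in lebesgue_on \<Omega>. \<sigma>min < \<sigma> x \<and> \<sigma> x < \<sigma>max)}"

definition Linf_norm :: "R2 set \<Rightarrow> (R2 \<Rightarrow> real) \<Rightarrow> ereal" where
  "Linf_norm \<Omega> f = esssup (lebesgue_on \<Omega>) (\<lambda>x. ereal \<bar>f x\<bar>)"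

definition Linf_open_in :: "R2 set \<Rightarrow> (R2 \<Rightarrow> real) set \<Rightarrow> (R2 \<Rightarrow> real) set \<Rightarrow> bool" where
  "Linf_open_in \<Omega> S U \<longleftrightarrow> U \<subseteq> S \<and>
     (\<forall>\<sigma>\<in>U. \<exists>\<epsilon>>0. \<forall>\<rho>\<in>S. Linf_norm \<Omega> (\<lambda>x. \<rho> x - \<sigma> x) < ereal \<epsilon> \<longrightarrow> \<rho> \<in> U)"

text \<open>The Borel sigma-algebra of the \<open>L\<^sup>\<infinity>\<close> topology on the set \<open>S\<close> of functions; all its members are
  closed under almost-everywhere equality.\<close>
definition Linf_borel :: "R2 set \<Rightarrow> (R2 \<Rightarrow> real) set \<Rightarrow> (R2 \<Rightarrow> real) measure" where
  "Linf_borel \<Omega> S = sigma S {U. Linf_open_in \<Omega> S U}"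

definition Linf_continuous_at ::
  "R2 set \<Rightarrow> (R2 \<Rightarrow> real) set \<Rightarrow> ((R2 \<Rightarrow> real) \<Rightarrow> real) \<Rightarrow> (R2 \<Rightarrow> real) \<Rightarrow> bool" where
  "Linf_continuous_at \<Omega> S G \<sigma> \<longleftrightarrow>
     (\<forall>\<epsilon>>0. \<exists>\<delta>>0. \<forall>\<rho>\<in>S. Linf_norm \<Omega> (\<lambda>x. \<rho> x - \<sigma> x) < ereal \<delta> \<longrightarrow> \<bar>G \<rho> - G \<sigma>\<bar> < \<epsilon>)"

section \<open>The prior\<close>

definition orthonormal_basis :: "'h::real_inner set \<Rightarrow> bool" where
  "orthonormal_basis E \<longleftrightarrow>
     (\<forall>e\<in>E. norm e = 1) \<and> pairwise orthogonal E \<and> closure (span E) = UNIV"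

text \<open>For a symmetric non-negative operator, trace class means a finite trace.\<close>
definition covariance_operator :: "('h::real_inner \<Rightarrow> 'h) \<Rightarrow> bool" where
  "covariance_operator C \<longleftrightarrow> bounded_linear C \<and>
     (\<forall>h k. C h \<bullet> k = h \<bullet> C k) \<and> (\<forall>h. 0 \<le> C h \<bullet> h) \<and>
     (\<exists>E. orthonormal_basis E \<and> (\<lambda>e. C e \<bullet> e) summable_on E)"

definition centred_normal :: "real \<Rightarrow> real measure" where
  "centred_normal v =
     (if v = 0 then return borel 0
      else density lborel (\<lambda>x. ennreal (normal_density 0 (sqrt v) x)))"

definition centred_gaussian ::
  "'w measure \<Rightarrow> ('w \<Rightarrow> 'h::{real_inner,banach}) \<Rightarrow> ('h \<Rightarrow> 'h) \<Rightarrow> bool" where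
  "centred_gaussian M X C \<longleftrightarrow> X \<in> borel_measurable M \<and>
     (\<forall>h. \<exists>v\<ge>0. distr M borel (\<lambda>\<omega>. X \<omega> \<bullet> h) = centred_normal v) \<and>
     (\<forall>h k. (LINT \<omega>|M. (X \<omega> \<bullet> h) * (X \<omega> \<bullet> k)) = C h \<bullet> k)"

text \<open>The abstract Hilbert space \<open>'h\<close> is a space of measurable functions (modulo null sets) on \<open>\<Omega>\<close>:
  \<open>emb h\<close> is a representative of \<open>h\<close>, hence linear and injective up to null sets.\<close>
definition function_space_on :: "R2 set \<Rightarrow> ('h::{real_inner,banach} \<Rightarrow> R2 \<Rightarrow> real) \<Rightarrow> bool" where
  "function_space_on \<Omega> emb \<longleftrightarrow>
     (\<forall>h. emb h \<in> borel_measurable (lebesgue_on \<Omega>)) \<and>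
     (\<forall>h k. AE x in lebesgue_on \<Omega>. emb (h + k) x = emb h x + emb k x) \<and>
     (\<forall>c h. AE x in lebesgue_on \<Omega>. emb (c *\<^sub>R h) x = c * emb h x) \<and>
     (\<forall>h. (AE x in lebesgue_on \<Omega>. emb h x = 0) \<longrightarrow> h = 0)"

text \<open>The maps \<open>F\<^sub>1\<close>, \<open>F\<^sub>2\<close>, \<open>F\<^sub>3\<close>; only the indices 1, 2, 3 are meaningful.\<close>
definition link :: "real \<Rightarrow> real \<Rightarrow> real \<Rightarrow> nat \<Rightarrow> real \<Rightarrow> real" where
  "link s_minus s_plus a p t =
     (if p = 1 then exp t
      else if p = 2 then s_minus + (s_plus - s_minus) * indicator {0..} t
      else s_minus + (s_plus - s_minus) * (1 / (1 + exp (- a * t))))"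

text \<open>The law of a random conductivity \<open>\<Sigma>\<close> on \<open>(S, B(S))\<close>. Since \<open>L\<^sup>\<infinity>\<close> is not separable, a \<open>\<Sigma>\<close> that takes
  values in \<open>S\<close> need not be measurable into \<open>B(S)\<close>; it is then not a random element of \<open>S\<close>, and
  \<^const>\<open>distr\<close> is only meaningful as a law when it is.\<close>
definition prior_law ::
  "R2 set \<Rightarrow> (R2 \<Rightarrow> real) set \<Rightarrow> 'w measure \<Rightarrow> ('w \<Rightarrow> R2 \<Rightarrow> real) \<Rightarrow> (R2 \<Rightarrow> real) measure" where
  "prior_law \<Omega> S M \<Sigma> = distr M (Linf_borel \<Omega> S) \<Sigma>"

end

theory Submission
  imports Defs
begin

text \<open>
  All three claims follow from one analytic fact: each power density \<open>h\<^sub>i\<^sub>j(\<sigma>)\<close> lies in \<open>L\<^sup>1(\<Omega>)\<close> and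
  depends continuously on \<open>\<sigma>\<close> in the \<open>L\<^sup>\<infinity>\<close> norm. Then \<open>\<Phi>(y;\<cdot>)\<close> is continuous at every point of \<open>S\<close>, hence
  almost everywhere for the law of \<open>\<sigma>\<close>; a continuous function is Borel measurable, and so is its
  exponential; and the dependence on \<open>y\<close> is controlled by the triangle inequality in \<open>L\<^sup>1\<close>, with the
  constant \<open>\<Sum> 1/\<tau>\<^sub>i\<^sub>j\<close>.

  Continuity comes from testing both equations with the difference of their solutions. If \<open>u\<close> and \<open>w\<close>
  solve the problems for \<open>\<sigma>\<close> and \<open>\<rho>\<close> with the same boundary data, then \<open>w - u\<close> lies in \<open>H\<^sup>1\<^sub>0\<close> and
  \<open>\<integral> \<rho> |\<nabla>(w - u)|\<^sup>2 = \<integral> (\<sigma> - \<rho>) \<nabla>u \<bullet> \<nabla>(w - u)\<close>, so that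
  \<open>\<sigma>min \<parallel>\<nabla>(w - u)\<parallel> \<le> \<parallel>\<rho> - \<sigma>\<parallel> \<parallel>\<nabla>u\<parallel>\<close> (\<open>weak_solution_stability\<close>).

  The potentials are chosen by a choice operator, so this argument says something about them only
  if a weak solution exists for every conductivity (\<open>weak_solution_exists\<close>). A solution minimises
  \<open>\<integral> \<sigma> |\<nabla>u|\<^sup>2\<close> among the functions with the given trace; in other words, \<open>\<surd>\<sigma> \<nabla>u\<close> is the element of
  least norm of an affine set in \<open>L\<^sup>2\<close> (\<open>L2_affine_projection\<close>). That this set is closed is the place
  where the geometry enters: convergence of gradients has to imply convergence of the functions
  themselves, which is the Friedrichs inequality on \<open>H\<^sup>1\<^sub>0\<close>.

  The Friedrichs inequality is proved for smooth functions with a boundary term (\<open>friedrichs_smooth\<close>),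
  by following the horizontal line through a point of \<open>\<Omega>\<close> to its first exit from \<open>\<Omega>\<close>. The points that
  exit through a set \<open>A\<close> of boundary points lie in the horizontal strip over the projection of \<open>A\<close> to
  the vertical axis, and the length of this projection is at most the Hausdorff measure of \<open>A\<close>
  (\<open>emeasure_strip_le_hausdorff1\<close>). This uses that \<^const>\<open>hausdorff1\<close> really takes the values of the
  outer measure on Borel sets, which is Caratheodory's criterion (\<open>metric_outer_measure_borel\<close>). The
  Lipschitz condition makes the length of the boundary finite, so that smooth functions are square
  integrable on it and the trace relation is linear.

  Finally, \<^const>\<open>grad\<close> is a chosen representative of the weak gradient. By the fundamental lemma of
  the calculus of variations it is unique up to null sets, which makes it linear and closed under
  \<open>L\<^sup>2\<close> limits.
\<close>

section \<open>Square integrable functions\<close>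

text \<open>A seminorm: functions that agree almost everywhere are not identified, so elements found as limits
  or minimisers are determined up to null sets.\<close>
definition L2_norm :: "'a measure \<Rightarrow> ('a \<Rightarrow> 'b::euclidean_space) \<Rightarrow> real" where
  "L2_norm M f = sqrt (LINT x|M. (norm (f x))\<^sup>2)"

lemma L2_borel [measurable_dest]: "L2 M f \<Longrightarrow> f \<in> borel_measurable M"
  and L2_integrable: "L2 M f \<Longrightarrow> integrable M (\<lambda>x. (norm (f x))\<^sup>2)"
  by (simp_all add: L2_def)

lemma L2_norm_nonneg [simp]: "0 \<le> L2_norm M f"
  by (simp add: L2_norm_def)

lemma L2_norm_power2: "(L2_norm M f)\<^sup>2 = (LINT x|M. (norm (f x))\<^sup>2)"
  by (simp add: L2_norm_def)

lemma L2_norm_cong_AE: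
  assumes "f \<in> borel_measurable M" "g \<in> borel_measurable M" "AE x in M. f x = g x"
  shows "L2_norm M f = L2_norm M g"
  unfolding L2_norm_def using assms
  by (intro arg_cong[where f=sqrt] integral_cong_AE) auto

lemma L2_bound:
  fixes f :: "'a \<Rightarrow> 'b::euclidean_space" and h :: "'a \<Rightarrow> real"
  assumes "f \<in> borel_measurable M" "integrable M h" "AE x in M. (norm (f x))\<^sup>2 \<le> h x"
  shows "L2 M f"
  unfolding L2_def using assms
  by (intro conjI Bochner_Integration.integrable_bound[OF assms(2)]) (auto elim: eventually_mono)

lemma L2_norm_mult_integrable:
  assumes "L2 M f" "L2 M g"
  shows "integrable M (\<lambda>x. norm (f x) * norm (g x))"
proof (rule Bochner_Integration.integrable_bound)
  show "integrable M (\<lambda>x. (norm (f x))\<^sup>2 + (norm (g x))\<^sup>2)"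
    using assms by (intro Bochner_Integration.integrable_add L2_integrable)
  show "AE x in M. norm (norm (f x) * norm (g x)) \<le> norm ((norm (f x))\<^sup>2 + (norm (g x))\<^sup>2)"
  proof (intro AE_I2)
    fix x
    have "norm (f x) * norm (g x) \<le> 2 * norm (f x) * norm (g x)"
      by simp
    also have "\<dots> \<le> (norm (f x))\<^sup>2 + (norm (g x))\<^sup>2"
      by (rule sum_squares_bound)
    finally show "norm (norm (f x) * norm (g x)) \<le> norm ((norm (f x))\<^sup>2 + (norm (g x))\<^sup>2)"
      by simp
  qed
qed (use assms in measurable)

lemma L2_inner_integrable:
  assumes "L2 M f" "L2 M g"
  shows "integrable M (\<lambda>x. f x \<bullet> g x)"
  by (rule Bochner_Integration.integrable_bound[OF L2_norm_mult_integrable[OF assms]])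
    (use assms in \<open>auto simp: Cauchy_Schwarz_ineq2 intro!: borel_measurable_inner L2_borel\<close>)

lemma L2_scaleR: "L2 M f \<Longrightarrow> L2 M (\<lambda>x. c *\<^sub>R f x)"
  by (auto simp: L2_def power_mult_distrib)

lemma L2_add:
  assumes "L2 M f" "L2 M g" shows "L2 M (\<lambda>x. f x + g x)"
proof (rule L2_bound)
  show "integrable M (\<lambda>x. (norm (f x))\<^sup>2 + 2 * (norm (f x) * norm (g x)) + (norm (g x))\<^sup>2)"
    using assms
    by (intro Bochner_Integration.integrable_add integrable_mult_right L2_integrable L2_norm_mult_integrable)
  show "AE x in M. (norm (f x + g x))\<^sup>2 \<le> (norm (f x))\<^sup>2 + 2 * (norm (f x) * norm (g x)) + (norm (g x))\<^sup>2"
  proof (intro AE_I2)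
    fix x
    have "(norm (f x + g x))\<^sup>2 \<le> (norm (f x) + norm (g x))\<^sup>2"
      by (intro power_mono norm_triangle_ineq) auto
    then show "(norm (f x + g x))\<^sup>2 \<le> (norm (f x))\<^sup>2 + 2 * (norm (f x) * norm (g x)) + (norm (g x))\<^sup>2"
      by (simp add: power2_eq_square algebra_simps)
  qed
qed (use assms in measurable)

lemma L2_diff:
  assumes "L2 M f" "L2 M g" shows "L2 M (\<lambda>x. f x - g x)"
  using L2_add[OF assms(1) L2_scaleR[OF assms(2), of "-1"]] by simp

text \<open>Used twice: for the Cauchy-Schwarz inequality, and with \<open>b = 0\<close> to see that the first variation at a
  minimiser vanishes.\<close>
lemma quadratic_nonneg_imp_discriminant:
  fixes a b c :: real
  assumes "0 \<le> a" and nonneg: "\<And>t. 0 \<le> a * t\<^sup>2 - 2 * c * t + b"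
  shows "c\<^sup>2 \<le> a * b"
proof (cases "a = 0")
  case True
  show ?thesis
  proof (cases "c = 0")
    case False
    have "0 \<le> a * ((b + 1) / (2 * c))\<^sup>2 - 2 * c * ((b + 1) / (2 * c)) + b" by (rule nonneg)
    then show ?thesis using True False by simp
  qed (simp add: True)
next
  case False
  then have "0 < a" using \<open>0 \<le> a\<close> by simp
  have "0 \<le> a * (c / a)\<^sup>2 - 2 * c * (c / a) + b" by (rule nonneg)
  then show ?thesis using \<open>0 < a\<close> by (simp add: field_simps power2_eq_square)
qed

lemma L2_Cauchy_Schwarz:
  assumes "L2 M f" "L2 M g"
  shows "(LINT x|M. norm (f x) * norm (g x)) \<le> L2_norm M f * L2_norm M g"
proof -
  let ?A = "LINT x|M. (norm (f x))\<^sup>2" and ?B = "LINT x|M. (norm (g x))\<^sup>2"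
  let ?C = "LINT x|M. norm (f x) * norm (g x)"
  note int = L2_integrable[OF assms(1)] L2_integrable[OF assms(2)] L2_norm_mult_integrable[OF assms]
  have "0 \<le> ?A * t\<^sup>2 - 2 * ?C * t + ?B" for t
  proof -
    have "0 \<le> (LINT x|M. (t * norm (f x) - norm (g x))\<^sup>2)" by simp
    also have "\<dots> = (LINT x|M. t\<^sup>2 * (norm (f x))\<^sup>2 - 2 * t * (norm (f x) * norm (g x)) + (norm (g x))\<^sup>2)"
      by (intro Bochner_Integration.integral_cong) (auto simp: power2_eq_square algebra_simps)
    also have "\<dots> = t\<^sup>2 * ?A - 2 * t * ?C + ?B"
      using int by simp
    finally show ?thesis by (simp add: algebra_simps)
  qed
  then have "?C\<^sup>2 \<le> ?A * ?B" by (rule quadratic_nonneg_imp_discriminant[rotated]) simp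
  then have "sqrt (?C\<^sup>2) \<le> sqrt (?A * ?B)" by (rule real_sqrt_le_mono)
  then show ?thesis by (simp add: L2_norm_def real_sqrt_mult)
qed

lemma L2_norm_triangle:
  assumes "L2 M f" "L2 M g"
  shows "L2_norm M (\<lambda>x. f x + g x) \<le> L2_norm M f + L2_norm M g"
proof (rule power2_le_imp_le)
  note int = L2_integrable[OF assms(1)] L2_integrable[OF assms(2)] L2_norm_mult_integrable[OF assms]
  have "(L2_norm M (\<lambda>x. f x + g x))\<^sup>2
      \<le> (LINT x|M. (norm (f x))\<^sup>2 + 2 * (norm (f x) * norm (g x)) + (norm (g x))\<^sup>2)"
    unfolding L2_norm_power2
  proof (rule integral_mono)
    fix x
    have "(norm (f x + g x))\<^sup>2 \<le> (norm (f x) + norm (g x))\<^sup>2"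
      by (intro power_mono norm_triangle_ineq) auto
    then show "(norm (f x + g x))\<^sup>2 \<le> (norm (f x))\<^sup>2 + 2 * (norm (f x) * norm (g x)) + (norm (g x))\<^sup>2"
      by (simp add: power2_eq_square algebra_simps)
  qed (use int L2_integrable[OF L2_add[OF assms]] in auto)
  also have "\<dots> = (L2_norm M f)\<^sup>2 + 2 * (LINT x|M. norm (f x) * norm (g x)) + (L2_norm M g)\<^sup>2"
    using int by (simp add: L2_norm_power2)
  also have "\<dots> \<le> (L2_norm M f + L2_norm M g)\<^sup>2"
    using L2_Cauchy_Schwarz[OF assms] by (simp add: power2_sum)
  finally show "(L2_norm M (\<lambda>x. f x + g x))\<^sup>2 \<le> (L2_norm M f + L2_norm M g)\<^sup>2" .
qed simp

lemma L2_norm_scaleR: "L2_norm M (\<lambda>x. c *\<^sub>R f x) = \<bar>c\<bar> * L2_norm M f"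
  by (simp add: L2_norm_def power_mult_distrib real_sqrt_mult)

lemma L2_norm_minus_commute: "L2_norm M (\<lambda>x. f x - g x) = L2_norm M (\<lambda>x. g x - f x)"
  by (simp add: L2_norm_def norm_minus_commute)

lemma L2_norm_triangle_diff:
  assumes "L2 M f" "L2 M g" "L2 M h"
  shows "L2_norm M (\<lambda>x. f x - h x) \<le> L2_norm M (\<lambda>x. f x - g x) + L2_norm M (\<lambda>x. g x - h x)"
  using L2_norm_triangle[OF L2_diff[OF assms(1,2)] L2_diff[OF assms(2,3)]] by simp

lemma L2_norm_triangle_le:
  assumes "L2 M f" "L2 M g"
  shows "L2_norm M f \<le> L2_norm M g + L2_norm M (\<lambda>x. f x - g x)"
  using L2_norm_triangle[OF assms(2) L2_diff[OF assms]] by simp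

lemma L2_norm_tendsto:
  assumes "\<And>n. L2 M (f n)" "L2 M g" "(\<lambda>n. L2_norm M (\<lambda>x. f n x - g x)) \<longlonglongrightarrow> 0"
  shows "(\<lambda>n. L2_norm M (f n)) \<longlonglongrightarrow> L2_norm M g"
proof (rule LIM_zero_cancel, rule Lim_null_comparison[OF _ assms(3)])
  show "\<forall>\<^sub>F n in sequentially. norm (L2_norm M (f n) - L2_norm M g) \<le> L2_norm M (\<lambda>x. f n x - g x)"
  proof (intro always_eventually allI)
    fix n
    show "norm (L2_norm M (f n) - L2_norm M g) \<le> L2_norm M (\<lambda>x. f n x - g x)"
      using L2_norm_triangle_le[OF assms(1)[of n] assms(2)] L2_norm_triangle_le[OF assms(2) assms(1)[of n]]
      by (auto simp: L2_norm_minus_commute[of M g])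
  qed
qed

lemma nn_integral_L2:
  "L2 M f \<Longrightarrow> (\<integral>\<^sup>+x. ennreal ((norm (f x))\<^sup>2) \<partial>M) = ennreal ((L2_norm M f)\<^sup>2)"
  unfolding L2_norm_power2 by (intro nn_integral_eq_integral L2_integrable) auto

lemma L2_I_nn_integral:
  assumes [measurable]: "f \<in> borel_measurable M"
    and le: "(\<integral>\<^sup>+x. ennreal ((norm (f x))\<^sup>2) \<partial>M) \<le> ennreal (c\<^sup>2)" and "0 \<le> c"
  shows "L2 M f" "L2_norm M f \<le> c"
proof -
  have "integrable M (\<lambda>x. (norm (f x))\<^sup>2)"
    using le by (intro integrableI_nonneg) (auto intro: le_less_trans)
  then show *: "L2 M f" by (simp add: L2_def)
  show "L2_norm M f \<le> c"
    using le \<open>0 \<le> c\<close> unfolding nn_integral_L2[OF *]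
    by (intro power2_le_imp_le[of "L2_norm M f" c]) auto
qed

lemma L2_sum: "finite I \<Longrightarrow> (\<And>i. i \<in> I \<Longrightarrow> L2 M (f i)) \<Longrightarrow> L2 M (\<lambda>x. \<Sum>i\<in>I. f i x)"
proof (induction I rule: finite_induct)
  case empty then show ?case by (simp add: L2_def)
qed (auto intro: L2_add)

lemma L2_norm_sum:
  "finite I \<Longrightarrow> (\<And>i. i \<in> I \<Longrightarrow> L2 M (f i)) \<Longrightarrow> L2_norm M (\<lambda>x. \<Sum>i\<in>I. f i x) \<le> (\<Sum>i\<in>I. L2_norm M (f i))"
proof (induction I rule: finite_induct)
  case empty then show ?case by (simp add: L2_norm_def)
next
  case (insert i I)
  then show ?case
    using L2_norm_triangle[of M "f i" "\<lambda>x. \<Sum>i\<in>I. f i x"] L2_sum[of I M f] by fastforce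
qed

lemma L2_norm_of_norm: "L2_norm M (\<lambda>x. norm (f x)) = L2_norm M f"
  and L2_of_norm: "L2 M f \<Longrightarrow> L2 M (\<lambda>x. norm (f x))"
  by (auto simp: L2_def L2_norm_def)

lemma L2_bounded:
  assumes "finite_measure M" "f \<in> borel_measurable M" "\<And>x. x \<in> space M \<Longrightarrow> norm (f x) \<le> B"
  shows "L2 M f"
proof (rule L2_bound[OF assms(2)])
  show "integrable M (\<lambda>x. B\<^sup>2)" using assms(1) by (simp add: finite_measure.integrable_const)
  show "AE x in M. (norm (f x))\<^sup>2 \<le> B\<^sup>2" using assms(3) by (intro AE_I2 power_mono) auto
qed

lemma L2_norm_le_AE:
  assumes "f \<in> borel_measurable M" "L2 M g" "0 \<le> c" "AE x in M. norm (f x) \<le> c * norm (g x)"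
  shows "L2 M f" "L2_norm M f \<le> c * L2_norm M g"
proof -
  have le: "AE x in M. (norm (f x))\<^sup>2 \<le> c\<^sup>2 * (norm (g x))\<^sup>2"
    using assms(4) by eventually_elim (metis norm_ge_zero power_mono power_mult_distrib)
  show f: "L2 M f"
    by (rule L2_bound[OF assms(1) integrable_mult_right[OF L2_integrable[OF assms(2)]] le])
  have "(L2_norm M f)\<^sup>2 \<le> (LINT x|M. c\<^sup>2 * (norm (g x))\<^sup>2)"
    unfolding L2_norm_power2
    by (intro integral_mono_AE L2_integrable[OF f] integrable_mult_right L2_integrable[OF assms(2)] le)
  also have "\<dots> = (c * L2_norm M g)\<^sup>2" by (simp add: L2_norm_power2 power_mult_distrib)
  finally show "L2_norm M f \<le> c * L2_norm M g"
    using assms(3) by (rule power2_le_imp_le[OF _ mult_nonneg_nonneg]) simp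
qed

lemma L2_component:
  fixes f :: "'a \<Rightarrow> real^'n"
  assumes "L2 M f" shows "L2 M (\<lambda>x. f x $ k)" "L2_norm M (\<lambda>x. f x $ k) \<le> L2_norm M f"
proof -
  have m: "(\<lambda>x. f x $ k) \<in> borel_measurable M"
    using borel_measurable_inner[OF L2_borel[OF assms] borel_measurable_const[of "axis k 1"]]
    by (simp add: inner_axis)
  note le = L2_norm_le_AE[OF m assms, of 1, OF _ AE_I2]
  show "L2 M (\<lambda>x. f x $ k)" "L2_norm M (\<lambda>x. f x $ k) \<le> L2_norm M f"
    using le component_le_norm_cart[of "f _" k] by auto
qed

lemma L2_mult_integrable:
  fixes f g :: "'a \<Rightarrow> real"
  shows "L2 M f \<Longrightarrow> L2 M g \<Longrightarrow> integrable M (\<lambda>x. f x * g x)"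
  using L2_inner_integrable[of M f g] by simp

lemma L2_inner_integral_le:
  assumes "L2 M f" "L2 M g"
  shows "\<bar>LINT x|M. f x \<bullet> g x\<bar> \<le> L2_norm M f * L2_norm M g"
proof -
  have "\<bar>LINT x|M. f x \<bullet> g x\<bar> \<le> (LINT x|M. \<bar>f x \<bullet> g x\<bar>)"
    using integral_abs_bound .
  also have "\<dots> \<le> (LINT x|M. norm (f x) * norm (g x))"
    by (intro integral_mono integrable_abs L2_inner_integrable L2_norm_mult_integrable assms Cauchy_Schwarz_ineq2)
  finally show ?thesis using L2_Cauchy_Schwarz[OF assms] by linarith
qed

lemma L2_inner_tendsto:
  assumes "\<And>n. L2 M (f n)" "L2 M g" "L2 M h" "(\<lambda>n. L2_norm M (\<lambda>x. f n x - g x)) \<longlonglongrightarrow> 0"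
  shows "(\<lambda>n. LINT x|M. f n x \<bullet> h x) \<longlonglongrightarrow> (LINT x|M. g x \<bullet> h x)"
proof (rule LIM_zero_cancel, rule Lim_null_comparison)
  show "\<forall>\<^sub>F n in sequentially. norm ((LINT x|M. f n x \<bullet> h x) - (LINT x|M. g x \<bullet> h x))
      \<le> L2_norm M (\<lambda>x. f n x - g x) * L2_norm M h"
  proof (intro always_eventually allI)
    fix n
    have "(LINT x|M. f n x \<bullet> h x) - (LINT x|M. g x \<bullet> h x) = (LINT x|M. (f n x - g x) \<bullet> h x)"
      using L2_inner_integrable[OF assms(1)[of n] assms(3)] L2_inner_integrable[OF assms(2,3)]
      by (simp add: inner_diff_left)
    then show "norm ((LINT x|M. f n x \<bullet> h x) - (LINT x|M. g x \<bullet> h x))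
      \<le> L2_norm M (\<lambda>x. f n x - g x) * L2_norm M h"
      using L2_inner_integral_le[OF L2_diff[OF assms(1)[of n] assms(2)] assms(3)] by simp
  qed
  show "(\<lambda>n. L2_norm M (\<lambda>x. f n x - g x) * L2_norm M h) \<longlonglongrightarrow> 0"
    using tendsto_mult_right[OF assms(4), of "L2_norm M h"] by simp
qed

lemma (in finite_measure) L2_imp_integrable:
  fixes f :: "'a \<Rightarrow> real"
  assumes "L2 M f" shows "integrable M f"
proof -
  have "L2 M (\<lambda>_. 1 :: real)" by (auto simp: L2_def)
  from L2_mult_integrable[OF assms this] show ?thesis by simp
qed

lemma L2_norm_combination_tendsto:
  assumes "\<And>n. L2 M (f n)" "L2 M u" "(\<lambda>n. L2_norm M (\<lambda>x. f n x - u x)) \<longlonglongrightarrow> 0"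
    and "\<And>n. L2 M (h n)" "L2 M w" "(\<lambda>n. L2_norm M (\<lambda>x. h n x - w x)) \<longlonglongrightarrow> 0"
  shows "(\<lambda>n. L2_norm M (\<lambda>x. (s *\<^sub>R f n x + t *\<^sub>R h n x) - (s *\<^sub>R u x + t *\<^sub>R w x))) \<longlonglongrightarrow> 0"
proof (rule tendsto_sandwich[OF _ _ tendsto_const])
  show "\<forall>\<^sub>F n in sequentially. L2_norm M (\<lambda>x. (s *\<^sub>R f n x + t *\<^sub>R h n x) - (s *\<^sub>R u x + t *\<^sub>R w x))
      \<le> \<bar>s\<bar> * L2_norm M (\<lambda>x. f n x - u x) + \<bar>t\<bar> * L2_norm M (\<lambda>x. h n x - w x)"
  proof (intro always_eventually allI)
    fix n
    have "L2_norm M (\<lambda>x. s *\<^sub>R (f n x - u x) + t *\<^sub>R (h n x - w x))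
      \<le> L2_norm M (\<lambda>x. s *\<^sub>R (f n x - u x)) + L2_norm M (\<lambda>x. t *\<^sub>R (h n x - w x))"
      by (intro L2_norm_triangle L2_scaleR L2_diff assms)
    from this[unfolded L2_norm_scaleR]
    show "L2_norm M (\<lambda>x. (s *\<^sub>R f n x + t *\<^sub>R h n x) - (s *\<^sub>R u x + t *\<^sub>R w x))
      \<le> \<bar>s\<bar> * L2_norm M (\<lambda>x. f n x - u x) + \<bar>t\<bar> * L2_norm M (\<lambda>x. h n x - w x)"
      by (simp add: algebra_simps)
  qed
  show "(\<lambda>n. \<bar>s\<bar> * L2_norm M (\<lambda>x. f n x - u x) + \<bar>t\<bar> * L2_norm M (\<lambda>x. h n x - w x)) \<longlonglongrightarrow> 0"
    using tendsto_add[OF tendsto_mult_left[OF assms(3), of "\<bar>s\<bar>"] tendsto_mult_left[OF assms(6), of "\<bar>t\<bar>"]] by simp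
qed simp

text \<open>An essentially bounded weight maps \<open>L\<^sup>2\<close> to itself with norm at most its bound, so all three claims
  are the Cauchy-Schwarz inequality for \<open>s F\<close> and \<open>G\<close>.\<close>
lemma L2_weighted:
  fixes F G :: "'a \<Rightarrow> 'b::euclidean_space"
  assumes s: "s \<in> borel_measurable M" "AE x in M. \<bar>s x\<bar> \<le> C" "0 \<le> C" and F: "L2 M F" and G: "L2 M G"
  shows "integrable M (\<lambda>x. s x * (F x \<bullet> G x))"
    "\<bar>LINT x|M. s x * (F x \<bullet> G x)\<bar> \<le> C * L2_norm M F * L2_norm M G"
    "(LINT x|M. \<bar>s x * (F x \<bullet> G x)\<bar>) \<le> C * L2_norm M F * L2_norm M G"
proof -
  have m: "(\<lambda>x. s x *\<^sub>R F x) \<in> borel_measurable M"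
    using s(1) L2_borel[OF F] by measurable
  have b: "AE x in M. norm (s x *\<^sub>R F x) \<le> C * norm (F x)"
    using s(2) by eventually_elim (simp add: mult_right_mono)
  note sF = L2_norm_le_AE[OF m F s(3) b]
  have eq: "s x * (F x \<bullet> G x) = (s x *\<^sub>R F x) \<bullet> G x" for x by simp
  show int: "integrable M (\<lambda>x. s x * (F x \<bullet> G x))"
    unfolding eq by (rule L2_inner_integrable[OF sF(1) G])
  have "(LINT x|M. \<bar>s x * (F x \<bullet> G x)\<bar>) \<le> (LINT x|M. norm (s x *\<^sub>R F x) * norm (G x))"
    unfolding eq by (intro integral_mono integrable_abs L2_inner_integrable L2_norm_mult_integrable sF(1) G Cauchy_Schwarz_ineq2)
  also have "\<dots> \<le> L2_norm M (\<lambda>x. s x *\<^sub>R F x) * L2_norm M G"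
    by (rule L2_Cauchy_Schwarz[OF sF(1) G])
  also have "\<dots> \<le> C * L2_norm M F * L2_norm M G"
    by (intro mult_right_mono sF(2)) simp
  finally show le: "(LINT x|M. \<bar>s x * (F x \<bullet> G x)\<bar>) \<le> C * L2_norm M F * L2_norm M G" .
  show "\<bar>LINT x|M. s x * (F x \<bullet> G x)\<bar> \<le> C * L2_norm M F * L2_norm M G"
    using integral_abs_bound[of M "\<lambda>x. s x * (F x \<bullet> G x)"] le by linarith
qed

text \<open>Riesz and Fischer: along a subsequence whose increments have norm at most \<open>2\<^sup>-\<^sup>k\<close>, monotone convergence
  makes the sum of the increments absolutely convergent almost everywhere; Fatou's lemma then turns
  the pointwise limit of the subsequence into an \<open>L\<^sup>2\<close> limit of the whole sequence.\<close>
theorem L2_complete: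
  fixes f :: "nat \<Rightarrow> 'a \<Rightarrow> 'b::euclidean_space"
  assumes f: "\<And>n. L2 M (f n)"
    and cauchy: "\<And>e. 0 < e \<Longrightarrow> \<exists>N. \<forall>m\<ge>N. \<forall>n\<ge>N. L2_norm M (\<lambda>x. f m x - f n x) < e"
  obtains g where "L2 M g" "(\<lambda>n. L2_norm M (\<lambda>x. f n x - g x)) \<longlonglongrightarrow> 0"
proof -
  note [measurable] = L2_borel[OF f]
  obtain N where N: "\<And>e m n. 0 < e \<Longrightarrow> N e \<le> m \<Longrightarrow> N e \<le> n \<Longrightarrow> L2_norm M (\<lambda>x. f m x - f n x) < e"
    using cauchy by metis
  \<comment> \<open>Summing the thresholds makes the subsequence monotone and still beyond each of them.\<close>
  define r where "r k = (\<Sum>j\<le>k. N ((1/2) ^ j))" for k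
  have rN: "N ((1/2) ^ k) \<le> r k" for k unfolding r_def by (rule member_le_sum) auto
  have r_mono: "r k \<le> r (Suc k)" for k by (simp add: r_def)
  define d where "d k x = f (r (Suc k)) x - f (r k) x" for k x
  have d: "L2 M (d k)" for k unfolding d_def by (intro L2_diff f)
  note [measurable] = L2_borel[OF d]
  have dn: "L2_norm M (d k) \<le> (1/2) ^ k" for k
    unfolding d_def using N[of "(1/2)^k" "r (Suc k)" "r k"] rN[of k] r_mono[of k] by simp
  define S where "S K x = (\<Sum>k<K. norm (d k x))" for K x
  have S: "L2 M (S K)" for K unfolding S_def by (intro L2_sum L2_of_norm d) auto
  note [measurable] = L2_borel[OF S]
  have Sn: "L2_norm M (S K) \<le> 2" for K
  proof -
    have "L2_norm M (S K) \<le> (\<Sum>k<K. L2_norm M (\<lambda>x. norm (d k x)))"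
      unfolding S_def by (intro L2_norm_sum L2_of_norm d) auto
    also have "\<dots> \<le> (\<Sum>k<K. (1/2) ^ k)" by (intro sum_mono) (simp add: L2_norm_of_norm dn)
    also have "\<dots> \<le> 2" by (simp add: sum_gp_strict)
    finally show ?thesis .
  qed
  have "(\<integral>\<^sup>+x. (SUP K. ennreal ((norm (S K x))\<^sup>2)) \<partial>M) = (SUP K. \<integral>\<^sup>+x. ennreal ((norm (S K x))\<^sup>2) \<partial>M)"
  proof (rule nn_integral_monotone_convergence_SUP)
    show "incseq (\<lambda>K x. ennreal ((norm (S K x))\<^sup>2))"
      by (intro incseq_SucI le_funI ennreal_leI power_mono) (auto simp: S_def sum_nonneg)
  qed measurable
  also have "\<dots> \<le> ennreal 4"
  proof (intro SUP_least)
    fix K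
    show "(\<integral>\<^sup>+x. ennreal ((norm (S K x))\<^sup>2) \<partial>M) \<le> ennreal 4"
      unfolding nn_integral_L2[OF S] using power_mono[OF Sn[of K], of 2] by (intro ennreal_leI) simp
  qed
  finally have "(\<integral>\<^sup>+x. (SUP K. ennreal ((norm (S K x))\<^sup>2)) \<partial>M) \<noteq> \<infinity>"
    by (auto simp: top_unique)
  then have "AE x in M. (SUP K. ennreal ((norm (S K x))\<^sup>2)) \<noteq> \<infinity>"
    by (intro nn_integral_PInf_AE) auto
  then have conv: "AE x in M. convergent (\<lambda>k. f (r k) x)"
  proof eventually_elim
    case (elim x)
    then obtain c where c: "0 \<le> c" "(SUP K. ennreal ((norm (S K x))\<^sup>2)) = ennreal c"
      by (cases "SUP K. ennreal ((norm (S K x))\<^sup>2)") auto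
    have "S K x \<le> sqrt c" for K
    proof -
      have "ennreal ((norm (S K x))\<^sup>2) \<le> ennreal c" unfolding c(2)[symmetric] by (rule SUP_upper) simp
      then have "(S K x)\<^sup>2 \<le> c" using c by simp
      then show ?thesis by (rule real_le_rsqrt)
    qed
    then have "summable (\<lambda>k. norm (d k x))"
      by (intro summableI_nonneg_bounded) (auto simp: S_def)
    then have "summable (\<lambda>k. d k x)" by (rule summable_norm_cancel)
    then have "(\<lambda>K. \<Sum>k<K. d k x) \<longlonglongrightarrow> (\<Sum>k. d k x)" by (rule summable_LIMSEQ)
    moreover have "(\<Sum>k<K. d k x) = f (r K) x - f (r 0) x" for K
      unfolding d_def by (rule sum_lessThan_telescope)
    ultimately have "(\<lambda>K. f (r K) x - f (r 0) x + f (r 0) x) \<longlonglongrightarrow> (\<Sum>k. d k x) + f (r 0) x"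
      by (intro tendsto_add) auto
    then show ?case by (auto simp: convergent_def)
  qed
  define g where "g x = lim (\<lambda>k. f (r k) x)" for x
  have [measurable]: "g \<in> borel_measurable M"
    unfolding g_def by (intro borel_measurable_lim_metric) auto
  have lim: "AE x in M. (\<lambda>k. f (r k) x) \<longlonglongrightarrow> g x"
    using conv by eventually_elim (simp add: g_def convergent_LIMSEQ_iff)
  have close: "L2 M (\<lambda>x. f n x - g x) \<and> L2_norm M (\<lambda>x. f n x - g x) \<le> e" if e: "0 < e" and n: "N e \<le> n" for e n
  proof -
    have "(\<integral>\<^sup>+x. ennreal ((norm (f n x - g x))\<^sup>2) \<partial>M)
        = (\<integral>\<^sup>+x. liminf (\<lambda>k. ennreal ((norm (f n x - f (r k) x))\<^sup>2)) \<partial>M)"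
    proof (rule nn_integral_cong_AE, use lim in eventually_elim)
      case (elim x)
      have "(\<lambda>k. ennreal ((norm (f n x - f (r k) x))\<^sup>2)) \<longlonglongrightarrow> ennreal ((norm (f n x - g x))\<^sup>2)"
        by (intro tendsto_intros elim)
      then show ?case by (metis lim_imp_Liminf trivial_limit_sequentially)
    qed
    also have "\<dots> \<le> liminf (\<lambda>k. \<integral>\<^sup>+x. ennreal ((norm (f n x - f (r k) x))\<^sup>2) \<partial>M)"
      by (rule nn_integral_liminf) measurable
    also have "\<dots> \<le> liminf (\<lambda>k. ennreal ((e + (1/2)^k)\<^sup>2))"
    proof (intro Liminf_mono always_eventually allI)
      fix k
      define m where "m = max (N e) (r k)"
      have m: "N e \<le> m" "r k \<le> m" by (simp_all add: m_def)
      have "L2_norm M (\<lambda>x. f n x - f (r k) x)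
          \<le> L2_norm M (\<lambda>x. f n x - f m x) + L2_norm M (\<lambda>x. f m x - f (r k) x)"
        by (rule L2_norm_triangle_diff) (auto intro: f)
      also have "\<dots> \<le> e + (1/2)^k"
        using N[of e n m] N[of "(1/2)^k" m "r k"] e n m rN[of k] by auto
      finally show "(\<integral>\<^sup>+x. ennreal ((norm (f n x - f (r k) x))\<^sup>2) \<partial>M) \<le> ennreal ((e + (1/2)^k)\<^sup>2)"
        by (subst nn_integral_L2) (auto intro!: L2_diff f ennreal_leI power_mono)
    qed
    also have "\<dots> = ennreal (e\<^sup>2)"
    proof (intro lim_imp_Liminf)
      have "(\<lambda>k. ennreal ((e + (1/2)^k)\<^sup>2)) \<longlonglongrightarrow> ennreal ((e + 0)\<^sup>2)"
        by (intro tendsto_intros LIMSEQ_power_zero) auto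
      then show "(\<lambda>k. ennreal ((e + (1/2)^k)\<^sup>2)) \<longlonglongrightarrow> ennreal (e\<^sup>2)" by simp
    qed simp
    finally have le: "(\<integral>\<^sup>+x. ennreal ((norm (f n x - g x))\<^sup>2) \<partial>M) \<le> ennreal (e\<^sup>2)" .
    then show ?thesis using L2_I_nn_integral[OF _ le] e by auto
  qed
  show ?thesis
  proof
    have "L2 M (\<lambda>x. f (N 1) x - g x)" using close[of 1 "N 1"] by simp
    from L2_diff[OF f[of "N 1"] this] show "L2 M g" by simp
    show "(\<lambda>n. L2_norm M (\<lambda>x. f n x - g x)) \<longlonglongrightarrow> 0"
    proof (rule LIMSEQ_I)
      fix e :: real assume "0 < e"
      then have "L2_norm M (\<lambda>x. f n x - g x) < e" if "N (e / 2) \<le> n" for n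
        using conjunct2[OF close[of "e / 2" n]] that by simp
      then show "\<exists>no. \<forall>n\<ge>no. norm (L2_norm M (\<lambda>x. f n x - g x) - 0) < e" by auto
    qed
  qed
qed

text \<open>By the parallelogram identity a minimising sequence is Cauchy; its limit lies in the set by
  closedness, and the first variation vanishes at a minimiser. Closedness is required for every
  representative of a limit, which replaces the passage to classes of functions.\<close>
theorem L2_affine_projection:
  fixes K :: "('a \<Rightarrow> 'b::euclidean_space) set"
  assumes ne: "K \<noteq> {}" and L2: "\<And>f. f \<in> K \<Longrightarrow> L2 M f"
    and affine: "\<And>f g t. f \<in> K \<Longrightarrow> g \<in> K \<Longrightarrow> (\<lambda>x. f x + t *\<^sub>R (g x - f x)) \<in> K"
    and closed: "\<And>fs f. (\<And>n. fs n \<in> K) \<Longrightarrow> L2 M f \<Longrightarrow> (\<lambda>n. L2_norm M (\<lambda>x. fs n x - f x)) \<longlonglongrightarrow> 0 \<Longrightarrow> f \<in> K"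
  obtains f where "f \<in> K" "\<And>g. g \<in> K \<Longrightarrow> (LINT x|M. f x \<bullet> (g x - f x)) = 0"
proof -
  define I where "I f = (L2_norm M f)\<^sup>2" for f :: "'a \<Rightarrow> 'b"
  define m where "m = (INF f\<in>K. I f)"
  have bdd: "bdd_below (I ` K)" by (rule bdd_belowI[of _ 0]) (auto simp: I_def)
  have m_le: "m \<le> I f" if "f \<in> K" for f unfolding m_def using bdd that by (rule cINF_lower)
  have "\<exists>f\<in>K. I f < m + 1 / real (Suc n)" for n
  proof -
    have "(INF f\<in>K. I f) < m + 1 / real (Suc n)" by (simp add: m_def)
    then show ?thesis using ne bdd by (subst (asm) cINF_less_iff) auto
  qed
  then obtain fs where fs: "\<And>n. fs n \<in> K" "\<And>n. I (fs n) < m + 1 / real (Suc n)" by metis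
  \<comment> \<open>The midpoint of \<open>f\<close> and \<open>g\<close> belongs to the set, so its square norm is at least \<open>m\<close>.\<close>
  have par: "I (\<lambda>x. f x - g x) \<le> 2 * (I f - m) + 2 * (I g - m)" if fg: "f \<in> K" "g \<in> K" for f g
  proof -
    let ?h = "\<lambda>x. f x + (1/2) *\<^sub>R (g x - f x)"
    have h: "?h \<in> K" by (rule affine[OF fg])
    have eq: "(norm (a - b))\<^sup>2 = 2 * (norm a)\<^sup>2 + 2 * (norm b)\<^sup>2 - 4 * (norm (a + (1/2) *\<^sub>R (b - a)))\<^sup>2" for a b :: 'b
      by (simp add: power2_norm_eq_inner inner_simps inner_commute algebra_simps)
    have "I (\<lambda>x. f x - g x) = (LINT x|M. 2 * (norm (f x))\<^sup>2 + 2 * (norm (g x))\<^sup>2 - 4 * (norm (?h x))\<^sup>2)"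
      unfolding I_def L2_norm_power2 by (subst eq) simp
    also have "\<dots> = 2 * I f + 2 * I g - 4 * I ?h"
      unfolding I_def L2_norm_power2
      using L2_integrable[OF L2[OF fg(1)]] L2_integrable[OF L2[OF fg(2)]] L2_integrable[OF L2[OF h]] by simp
    finally show ?thesis using m_le[OF h] by simp
  qed
  have "\<exists>N. \<forall>j\<ge>N. \<forall>k\<ge>N. L2_norm M (\<lambda>x. fs j x - fs k x) < e" if e: "0 < e" for e
  proof -
    obtain N where N: "4 / e\<^sup>2 < real N" using reals_Archimedean2 by blast
    have N0: "0 < real N" using N e by (smt (verit) divide_nonneg_nonneg zero_le_power2)
    have small: "1 / real (Suc j) < e\<^sup>2 / 4" if "N \<le> j" for j
    proof -
      have "4 / e\<^sup>2 < real (Suc j)" using N that by linarith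
      then show ?thesis using e by (simp add: field_simps)
    qed
    have near: "I (fs j) - m < e\<^sup>2 / 4" if "N \<le> j" for j
    proof -
      have "I (fs j) - m < 1 / real (Suc j)" using fs(2)[of j] by (simp only: diff_less_eq add.commute)
      also note small[OF that]
      finally show ?thesis .
    qed
    have "L2_norm M (\<lambda>x. fs j x - fs k x) < e" if jk: "N \<le> j" "N \<le> k" for j k
    proof (rule power2_less_imp_less)
      have "(L2_norm M (\<lambda>x. fs j x - fs k x))\<^sup>2 \<le> 2 * (I (fs j) - m) + 2 * (I (fs k) - m)"
        using par[OF fs(1) fs(1)] by (simp add: I_def)
      also have "\<dots> < e\<^sup>2"
        using near[OF jk(1)] near[OF jk(2)] by simp
      finally show "(L2_norm M (\<lambda>x. fs j x - fs k x))\<^sup>2 < e\<^sup>2" .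
    qed (use e in simp)
    then show ?thesis by blast
  qed
  then obtain f where f: "L2 M f" "(\<lambda>n. L2_norm M (\<lambda>x. fs n x - f x)) \<longlonglongrightarrow> 0"
    using L2_complete[of M fs] L2[OF fs(1)] by blast
  have fK: "f \<in> K" by (rule closed[OF fs(1) f])
  have "(\<lambda>n. I (fs n)) \<longlonglongrightarrow> I f"
    unfolding I_def using L2_norm_tendsto[OF L2[OF fs(1)] f] by (intro tendsto_power)
  moreover have "(\<lambda>n. m + 1 / real (Suc n)) \<longlonglongrightarrow> m + 0"
    using LIMSEQ_inverse_real_of_nat by (intro tendsto_add tendsto_const) (simp add: inverse_eq_divide)
  ultimately have "I f \<le> m + 0"
    using fs(2) by (intro LIMSEQ_le) (auto intro: less_imp_le)
  then have min: "I f \<le> I g" if "g \<in> K" for g using m_le[OF that] by simp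
  show ?thesis
  proof
    show "f \<in> K" by (rule fK)
    fix g assume g: "g \<in> K"
    define h where "h x = g x - f x" for x
    have h: "L2 M h" unfolding h_def by (intro L2_diff L2 g fK)
    define c where "c = (LINT x|M. f x \<bullet> h x)"
    have "0 \<le> I h * t\<^sup>2 - 2 * (- c) * t + 0" for t
    proof -
      have eq: "(norm (a + t *\<^sub>R b))\<^sup>2 = (norm a)\<^sup>2 + 2 * t * (a \<bullet> b) + t\<^sup>2 * (norm b)\<^sup>2" for a b :: 'b
        by (simp add: power2_norm_eq_inner inner_simps inner_commute algebra_simps power2_eq_square[of t])
      have "I f \<le> I (\<lambda>x. f x + t *\<^sub>R h x)"
        unfolding h_def by (intro min affine fK g)
      also have "\<dots> = (LINT x|M. (norm (f x))\<^sup>2 + 2 * t * (f x \<bullet> h x) + t\<^sup>2 * (norm (h x))\<^sup>2)"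
        unfolding I_def L2_norm_power2 eq by simp
      also have "\<dots> = I f + 2 * t * c + t\<^sup>2 * I h"
        unfolding I_def L2_norm_power2 c_def
        using L2_integrable[OF f(1)] L2_integrable[OF h] L2_inner_integrable[OF f(1) h] by simp
      finally show ?thesis by (simp add: algebra_simps)
    qed
    then have "(- c)\<^sup>2 \<le> I h * 0" by (rule quadratic_nonneg_imp_discriminant[rotated]) (simp add: I_def)
    then show "(LINT x|M. f x \<bullet> (g x - f x)) = 0" by (simp add: c_def h_def)
  qed
qed

section \<open>Test functions and the fundamental lemma of the calculus of variations\<close>

lemma grad_classical_eq:
  assumes "(f has_derivative D) (at x)" shows "grad_classical f x $ k = D (axis k 1)"
  using frechet_derivative_at[OF assms] by (simp add: grad_classical_def)

lemma has_derivative_grad_classical: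
  assumes "f differentiable_on UNIV"
  shows "(f has_derivative frechet_derivative f (at x)) (at x)"
  using assms by (auto simp: differentiable_on_def frechet_derivative_works[symmetric])

lemma grad_classical_add:
  assumes "f differentiable_on UNIV" "g differentiable_on UNIV"
  shows "grad_classical (\<lambda>x. f x + g x) x $ k = grad_classical f x $ k + grad_classical g x $ k"
  by (subst grad_classical_eq[OF has_derivative_add[OF assms[THEN has_derivative_grad_classical]]])
    (simp add: grad_classical_def)

lemma grad_classical_mult:
  assumes "f differentiable_on UNIV" "g differentiable_on UNIV"
  shows "grad_classical (\<lambda>x. f x * g x) x $ k = f x * grad_classical g x $ k + grad_classical f x $ k * g x"
  by (subst grad_classical_eq[OF has_derivative_mult[OF assms[THEN has_derivative_grad_classical]]])
    (simp add: grad_classical_def)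

lemma grad_classical_const: "grad_classical (\<lambda>x. c) x $ k = 0"
  by (subst grad_classical_eq[OF has_derivative_const]) simp

lemma Ck_const: "Ck m (\<lambda>x. c)"
  by (induction m arbitrary: c) (auto simp: grad_classical_const)

text \<open>The recursion only says that the partial derivatives lose one order, so that the orders are nested
  needs an argument.\<close>
lemma Ck_Suc_imp: "Ck (Suc m) f \<Longrightarrow> Ck m f"
proof (induction m arbitrary: f)
  case 0 then show ?case by (auto intro: differentiable_imp_continuous_on)
next
  case (Suc m)
  then show ?case by (subst Ck.simps(2)) (auto simp: Ck.simps(2)[of "Suc m"] simp del: Ck.simps)
qed

lemma Ck_add: "Ck m f \<Longrightarrow> Ck m g \<Longrightarrow> Ck m (\<lambda>x. f x + g x)"
proof (induction m arbitrary: f g)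
  case (Suc m)
  then have d: "f differentiable_on UNIV" "g differentiable_on UNIV" by auto
  show ?case using Suc by (auto simp: grad_classical_add[OF d])
qed (auto intro: continuous_intros)

lemma Ck_mult: "Ck m f \<Longrightarrow> Ck m g \<Longrightarrow> Ck m (\<lambda>x. f x * g x)"
proof (induction m arbitrary: f g)
  case (Suc m)
  then have d: "f differentiable_on UNIV" "g differentiable_on UNIV" by auto
  have "Ck m f" "Ck m g" using Suc.prems by (auto intro: Ck_Suc_imp simp del: Ck.simps)
  with Suc show ?case by (auto simp: grad_classical_mult[OF d] intro!: Ck_add)
qed (auto intro: continuous_intros)

lemma smooth_add: "smooth f \<Longrightarrow> smooth g \<Longrightarrow> smooth (\<lambda>x. f x + g x)"
  and smooth_mult: "smooth f \<Longrightarrow> smooth g \<Longrightarrow> smooth (\<lambda>x. f x * g x)"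
  and smooth_const: "smooth (\<lambda>x. c)"
  by (simp_all add: smooth_def Ck_add Ck_mult Ck_const)

lemma smooth_differentiable: "smooth f \<Longrightarrow> f differentiable_on UNIV"
  unfolding smooth_def by (drule spec[of _ 1]) simp

lemma smooth_continuous: "smooth f \<Longrightarrow> continuous_on UNIV f"
  using smooth_differentiable differentiable_imp_continuous_on by blast

lemma smooth_continuous_grad: "smooth f \<Longrightarrow> continuous_on UNIV (grad_classical f)"
proof -
  assume "smooth f"
  then have "\<forall>k. continuous_on UNIV (\<lambda>x. grad_classical f x $ k)"
    unfolding smooth_def by (drule_tac spec[of _ 1]) simp
  then have "continuous_on UNIV (\<lambda>x. \<chi> k. grad_classical f x $ k)"
    by (intro continuous_on_vec_lambda) auto
  then show ?thesis by simp
qed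

lemma grad_classical_linear:
  assumes "smooth f" "smooth g"
  shows "grad_classical (\<lambda>x. s * f x + t * g x) x = s *\<^sub>R grad_classical f x + t *\<^sub>R grad_classical g x"
proof -
  note d = assms[THEN smooth_differentiable]
  have c: "(\<lambda>x. c) differentiable_on UNIV" for c :: real by simp
  show ?thesis
    using d by (simp add: vec_eq_iff grad_classical_add[OF differentiable_on_mult[OF c d(1)] differentiable_on_mult[OF c d(2)]]
        grad_classical_mult[OF c d(1)] grad_classical_mult[OF c d(2)] grad_classical_const)
qed

text \<open>The case \<open>j = 0\<close> is the classical function that vanishes to infinite order at 0. The powers \<open>t\<^sup>j\<close> in
  the denominator make the family closed under differentiation, up to linear combinations.\<close>
definition flat_exp :: "real \<Rightarrow> nat \<Rightarrow> real \<Rightarrow> real" where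
  "flat_exp c j t = (if 0 < t then exp (- c / t) / t ^ j else 0)"

lemma flat_exp_DERIV:
  assumes c: "0 < c"
  shows "(flat_exp c j has_real_derivative c * flat_exp c (j + 2) t - real j * flat_exp c (j + 1) t) (at t)"
proof -
  consider "0 < t" | "t < 0" | "t = 0" by linarith
  then show ?thesis
  proof cases
    case 1
    have "((\<lambda>t. exp (- c / t) / t ^ j) has_real_derivative
        (exp (- c / t) * (c / t\<^sup>2) * t ^ j - exp (- c / t) * (real j * t ^ (j - 1))) / (t ^ j * t ^ j)) (at t)"
      using 1 by (auto intro!: derivative_eq_intros simp: power2_eq_square)
    also have "(exp (- c / t) * (c / t\<^sup>2) * t ^ j - exp (- c / t) * (real j * t ^ (j - 1))) / (t ^ j * t ^ j)
        = c * flat_exp c (j + 2) t - real j * flat_exp c (j + 1) t"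
      using 1 by (cases j) (auto simp: flat_exp_def field_simps power2_eq_square)
    finally show ?thesis
    proof (rule DERIV_cong_ev[THEN iffD1, rotated 3])
      have "\<forall>\<^sub>F s in nhds t. s \<in> {0<..}" using 1 by (intro eventually_nhds_in_open) auto
      then show "\<forall>\<^sub>F s in nhds t. exp (- c / s) / s ^ j = flat_exp c j s"
        by eventually_elim (simp add: flat_exp_def)
    qed auto
  next
    case 2
    have "((\<lambda>t. 0) has_real_derivative 0) (at t)" by simp
    then show ?thesis
    proof (rule DERIV_cong_ev[THEN iffD1, rotated 3])
      have "\<forall>\<^sub>F s in nhds t. s \<in> {..<0}" using 2 by (intro eventually_nhds_in_open) auto
      then show "\<forall>\<^sub>F s in nhds t. 0 = flat_exp c j s"
        by eventually_elim (simp add: flat_exp_def)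
    qed (use 2 in \<open>auto simp: flat_exp_def\<close>)
  next
    case 3
    \<comment> \<open>The difference quotient at 0 from the right is a constant times \<open>u ^ (j + 1) / exp u\<close> for \<open>u = c / h\<close>.\<close>
    have "((\<lambda>h. (c / h) ^ (j + 1) / exp (c / h)) \<longlongrightarrow> 0) (at_right 0)"
    proof (rule filterlim_compose[OF tendsto_power_div_exp_0])
      show "filterlim (\<lambda>h. c / h) at_top (at_right 0)"
        using c filterlim_tendsto_pos_mult_at_top[OF tendsto_const c filterlim_inverse_at_top_right]
        by (simp add: divide_inverse)
    qed
    then have "((\<lambda>h. (c / h) ^ (j + 1) / exp (c / h) / c ^ (j + 1)) \<longlongrightarrow> 0 / c ^ (j + 1)) (at_right 0)"
      by (intro tendsto_divide tendsto_const) (use c in auto)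
    then have r: "((\<lambda>h. (flat_exp c j h - flat_exp c j 0) / (h - 0)) \<longlongrightarrow> 0) (at_right 0)"
      unfolding div_0
    proof (rule Lim_transform_eventually)
      show "\<forall>\<^sub>F h in at_right 0. (c / h) ^ (j + 1) / exp (c / h) / c ^ (j + 1) = (flat_exp c j h - flat_exp c j 0) / (h - 0)"
        unfolding eventually_at_right_field
        using c by (intro exI[of _ 1]) (auto simp: flat_exp_def exp_minus field_simps power_divide)
    qed
    have l: "((\<lambda>h. (flat_exp c j h - flat_exp c j 0) / (h - 0)) \<longlongrightarrow> 0) (at_left 0)"
      by (rule Lim_transform_eventually[OF tendsto_const])
        (auto simp: eventually_at_left_field flat_exp_def intro!: exI[of _ "-1"])
    have "(flat_exp c j has_real_derivative 0) (at 0)"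
      unfolding has_field_derivative_iff using l r by (rule filterlim_split_at)
    then show ?thesis by (simp add: 3 flat_exp_def)
  qed
qed

text \<open>The induction over the order of smoothness is for all \<open>j\<close> at once, because differentiation raises \<open>j\<close>.\<close>
lemma smooth_flat_exp:
  assumes c: "0 < c"
  shows "smooth (\<lambda>x. flat_exp c j (s * x $ i + b))"
proof -
  have der: "((\<lambda>x :: R2. flat_exp c j (s * x $ i + b)) has_derivative
      (\<lambda>v. (c * flat_exp c (j + 2) (s * x $ i + b) - real j * flat_exp c (j + 1) (s * x $ i + b)) * (s * v $ i))) (at x)" for j x
  proof -
    have "((\<lambda>x :: R2. s * x $ i + b) has_derivative (\<lambda>v. s * v $ i)) (at x)"
      by (auto intro!: derivative_eq_intros bounded_linear.has_derivative[OF bounded_linear_vec_nth])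
    from has_derivative_compose[OF this flat_exp_DERIV[OF c, unfolded has_field_derivative_def]]
    show ?thesis by (simp add: mult_ac)
  qed
  have "Ck m (\<lambda>x. flat_exp c j (s * x $ i + b))" for m
  proof (induction m arbitrary: j)
    case 0
    show ?case
      using der by (auto simp: continuous_on_eq_continuous_at intro: has_derivative_continuous)
  next
    case (Suc m)
    have "grad_classical (\<lambda>x. flat_exp c j (s * x $ i + b)) x $ k =
      (s * axis k 1 $ i) * (c * flat_exp c (j + 2) (s * x $ i + b) + (- real j) * flat_exp c (j + 1) (s * x $ i + b))" for x k
      by (subst grad_classical_eq[OF der]) (simp add: algebra_simps)
    moreover have "(\<lambda>x :: R2. flat_exp c j (s * x $ i + b)) differentiable_on UNIV"
      unfolding differentiable_on_def using der differentiableI by blast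
    moreover have "Ck m (\<lambda>x. (s * axis k 1 $ i) * (c * flat_exp c (j + 2) (s * x $ i + b) + (- real j) * flat_exp c (j + 1) (s * x $ i + b)))" for k
      by (intro Ck_mult Ck_add Ck_const Suc.IH)
    ultimately show ?case by simp
  qed
  then show ?thesis by (simp add: smooth_def)
qed

text \<open>A product of four one-dimensional flat functions, one for each side of the box; it vanishes
  outside the open box.\<close>
definition box_bump :: "real \<Rightarrow> R2 \<Rightarrow> R2 \<Rightarrow> R2 \<Rightarrow> real" where
  "box_bump c a b x = (flat_exp c 0 (x $ 1 - a $ 1) * flat_exp c 0 (b $ 1 - x $ 1)) *
     (flat_exp c 0 (x $ 2 - a $ 2) * flat_exp c 0 (b $ 2 - x $ 2))"

lemma test_function_box_bump:
  assumes "0 < c" "cbox a b \<subseteq> \<Omega>"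
  shows "test_function \<Omega> (box_bump c a b)"
proof -
  have "{x. box_bump c a b x \<noteq> 0} \<subseteq> cbox a b"
    by (auto simp: box_bump_def flat_exp_def mem_box_cart forall_2 split: if_splits)
  then have cl: "closure {x. box_bump c a b x \<noteq> 0} \<subseteq> cbox a b"
    and "bounded {x. box_bump c a b x \<noteq> 0}"
    by (rule closure_minimal[OF _ closed_cbox], rule bounded_subset[OF bounded_cbox])
  moreover have "smooth (box_bump c a b)"
    unfolding box_bump_def
    using smooth_flat_exp[OF assms(1), of 0 1 _ "- a $ _"] smooth_flat_exp[OF assms(1), of 0 "-1" _ "b $ _"]
    by (intro smooth_mult) (simp_all add: algebra_simps)
  ultimately show ?thesis
    using assms(2) unfolding test_function_def
    by (auto simp: compact_closure)
qed

lemma flat_exp_le_1: "0 \<le> c \<Longrightarrow> 0 \<le> flat_exp c 0 t \<and> flat_exp c 0 t \<le> 1"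
  by (auto simp: flat_exp_def)

lemma box_bump_le_1: "0 \<le> c \<Longrightarrow> \<bar>box_bump c a b x\<bar> \<le> 1"
  using flat_exp_le_1[of c] by (auto simp: box_bump_def abs_mult intro!: mult_le_one)

text \<open>As \<open>c\<close> tends to 0, \<open>exp (- c / t)\<close> tends to 1 for each \<open>t > 0\<close>: the parameter of the bump serves as
  the approximation parameter, and all bumps stay below 1.\<close>
lemma box_bump_tendsto: "(\<lambda>n. box_bump (1 / real (Suc n)) a b x) \<longlonglongrightarrow> indicator (box a b) x"
proof -
  have t: "(\<lambda>n. flat_exp (1 / real (Suc n)) 0 t) \<longlonglongrightarrow> (if 0 < t then 1 else 0)" for t
  proof (cases "0 < t")
    case True
    have "(\<lambda>n. exp (- (1 / real (Suc n)) / t)) \<longlonglongrightarrow> exp (- 0 / t)"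
      using True LIMSEQ_inverse_real_of_nat
      by (intro tendsto_intros) (auto simp: inverse_eq_divide)
    then show ?thesis using True by (simp add: flat_exp_def)
  qed (simp add: flat_exp_def)
  have "(\<lambda>n. box_bump (1 / real (Suc n)) a b x) \<longlonglongrightarrow>
     ((if 0 < x $ 1 - a $ 1 then 1 else 0) * (if 0 < b $ 1 - x $ 1 then 1 else 0)) *
     ((if 0 < x $ 2 - a $ 2 then 1 else 0) * (if 0 < b $ 2 - x $ 2 then 1 else 0))"
    unfolding box_bump_def by (intro tendsto_mult t)
  then show ?thesis
    by (auto simp: indicator_def mem_box_cart forall_2 split: if_splits)
qed

lemma borel_measurable_lebesgue_on:
  "f \<in> borel_measurable borel \<Longrightarrow> f \<in> borel_measurable (lebesgue_on S)"
  by (auto intro!: measurable_restrict_space1 measurable_completion)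

lemma smooth_measurable: "smooth f \<Longrightarrow> f \<in> borel_measurable (lebesgue_on S)"
  and smooth_grad_measurable: "smooth f \<Longrightarrow> grad_classical f \<in> borel_measurable (lebesgue_on S)"
  by (intro borel_measurable_lebesgue_on borel_measurable_continuous_onI smooth_continuous smooth_continuous_grad, assumption)+

text \<open>Testing with the bumps shows that the integral of \<open>v\<close> over every box in \<open>\<Omega>\<close> vanishes. At almost
  every point \<open>v\<close> is the limit of its averages over small cubes with a corner at this point, and these
  averages are 0.\<close>
theorem fundamental_lemma_calculus_of_variations:
  fixes v :: "R2 \<Rightarrow> real"
  assumes "open \<Omega>" and v: "integrable (lebesgue_on \<Omega>) v"
    and test: "\<And>f. test_function \<Omega> f \<Longrightarrow> (LINT x|lebesgue_on \<Omega>. v x * f x) = 0"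
  shows "AE x in lebesgue_on \<Omega>. v x = 0"
proof -
  have [measurable]: "\<Omega> \<in> sets lebesgue" using assms(1) by auto
  \<comment> \<open>Extension by 0 gives a function on the plane, as the differentiation theorem requires.\<close>
  define w where "w x = (if x \<in> \<Omega> then v x else 0)" for x
  have w: "integrable lebesgue w"
  proof -
    have "w = (\<lambda>x. indicator \<Omega> x *\<^sub>R v x)" by (auto simp: w_def fun_eq_iff)
    then show ?thesis using v by (simp add: integrable_restrict_space)
  qed
  have w_int: "w integrable_on cbox a b" for a b
    using integrable_on_lebesgue[OF w] integrable_on_subcbox by blast
  have zero: "integral (cbox a b) w = 0" if ab: "cbox a b \<subseteq> \<Omega>" for a b
  proof -
    have "(\<lambda>n. LINT x|lebesgue_on \<Omega>. v x * box_bump (1 / real (Suc n)) a b x)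
        \<longlonglongrightarrow> (LINT x|lebesgue_on \<Omega>. v x * indicator (box a b) x)"
    proof (rule integral_dominated_convergence)
      show "integrable (lebesgue_on \<Omega>) (\<lambda>x. \<bar>v x\<bar>)" using v by simp
      show "AE x in lebesgue_on \<Omega>. (\<lambda>n. v x * box_bump (1 / real (Suc n)) a b x) \<longlonglongrightarrow> v x * indicator (box a b) x"
        by (intro AE_I2 tendsto_intros box_bump_tendsto)
      show "AE x in lebesgue_on \<Omega>. norm (v x * box_bump (1 / real (Suc n)) a b x) \<le> \<bar>v x\<bar>" for n
        using box_bump_le_1[of "1 / real (Suc n)" a b] by (auto simp: abs_mult mult_left_le)
      show "(\<lambda>x. v x * box_bump (1 / real (Suc n)) a b x) \<in> borel_measurable (lebesgue_on \<Omega>)" for n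
      proof (intro borel_measurable_times)
        show "box_bump (1 / real (Suc n)) a b \<in> borel_measurable (lebesgue_on \<Omega>)"
          using test_function_box_bump[of "1 / real (Suc n)", OF _ ab]
          by (intro smooth_measurable) (simp add: test_function_def)
      qed (rule borel_measurable_integrable[OF v])
      show "(\<lambda>x. v x * indicator (box a b) x) \<in> borel_measurable (lebesgue_on \<Omega>)"
        by (intro borel_measurable_times borel_measurable_integrable[OF v])
          (rule borel_measurable_lebesgue_on, simp)
    qed
    moreover have "(LINT x|lebesgue_on \<Omega>. v x * box_bump (1 / real (Suc n)) a b x) = 0" for n
      by (rule test) (rule test_function_box_bump[OF _ ab], simp)
    ultimately have "(LINT x|lebesgue_on \<Omega>. v x * indicator (box a b) x) = 0"
      by (simp only: LIMSEQ_const_iff)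
    also have "(LINT x|lebesgue_on \<Omega>. v x * indicator (box a b) x) = (LINT x|lebesgue. (if x \<in> box a b then w x else 0))"
      by (subst integral_restrict_space) (auto simp: w_def indicator_def intro!: Bochner_Integration.integral_cong)
    also have "\<dots> = integral UNIV (\<lambda>x. if x \<in> box a b then w x else 0)"
    proof -
      have "integrable lebesgue (\<lambda>x. indicator (box a b) x *\<^sub>R w x)"
        by (rule integrable_mult_indicator[OF _ w]) auto
      then have "integrable lebesgue (\<lambda>x. if x \<in> box a b then w x else 0)"
        by (rule Bochner_Integration.integrable_cong[THEN iffD1, rotated -1]) (auto simp: indicator_def)
      then show ?thesis by (rule integral_lebesgue[symmetric])
    qed
    also have "\<dots> = integral (box a b) w" by (rule integral_restrict_UNIV)
    also have "\<dots> = integral (cbox a b) w" by (rule integral_open_interval)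
    finally show ?thesis .
  qed
  obtain N where N: "negligible N"
    "\<And>x e. x \<notin> N \<Longrightarrow> 0 < e \<Longrightarrow> \<exists>d>0. \<forall>h. 0 < h \<and> h < d \<longrightarrow>
       norm (integral (cbox x (x + h *\<^sub>R One)) w /\<^sub>R h ^ DIM(R2) - w x) < e"
    using integrable_ccontinuous_explicit[of w] w_int by blast
  have "v x = 0" if x: "x \<in> \<Omega>" "x \<notin> N" for x
  proof (rule ccontr)
    assume "v x \<noteq> 0"
    then have "0 < \<bar>w x\<bar>" using x by (simp add: w_def)
    then obtain d where d: "0 < d" "\<And>h. 0 < h \<Longrightarrow> h < d \<Longrightarrow>
       norm (integral (cbox x (x + h *\<^sub>R One)) w /\<^sub>R h ^ DIM(R2) - w x) < \<bar>w x\<bar>"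
      using N(2)[OF x(2)] by blast
    obtain \<epsilon> where \<epsilon>: "0 < \<epsilon>" "ball x \<epsilon> \<subseteq> \<Omega>" using assms(1) x(1) openE by blast
    define h where "h = min (d / 2) (\<epsilon> / 4)"
    have h: "0 < h" "h < d" "h \<le> \<epsilon> / 4" using d \<epsilon> by (auto simp: h_def)
    have "cbox x (x + h *\<^sub>R One) \<subseteq> ball x \<epsilon>"
    proof
      fix y assume "y \<in> cbox x (x + h *\<^sub>R One)"
      then have "\<bar>(y - x) \<bullet> i\<bar> \<le> h" if "i \<in> Basis" for i
        using that by (auto simp: mem_box inner_add_left inner_diff_left inner_sum_left inner_Basis)
      then have "(\<Sum>i\<in>Basis. \<bar>(y - x) \<bullet> i\<bar>) \<le> (\<Sum>i\<in>(Basis :: R2 set). h)"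
        by (intro sum_mono)
      then have "norm (y - x) \<le> 2 * h"
        using norm_le_l1[of "y - x"] by simp
      then show "y \<in> ball x \<epsilon>" using h \<epsilon> by (simp add: dist_norm norm_minus_commute)
    qed
    then have "integral (cbox x (x + h *\<^sub>R One)) w = 0" using \<epsilon> by (intro zero) auto
    then show False using d(2)[OF h(1,2)] by simp
  qed
  moreover have "AE x in lebesgue_on \<Omega>. x \<notin> N"
  proof -
    have "AE x in lebesgue. x \<notin> N"
      using N(1) by (simp add: AE_not_in negligible_iff_null_sets)
    then show ?thesis by (subst AE_restrict_space_iff) auto
  qed
  ultimately show ?thesis by (auto simp: AE_restrict_space_iff)
qed

section \<open>One-dimensional Hausdorff measure\<close>

text \<open>Caratheodory's criterion. Given a closed set \<open>F\<close>, the part of \<open>A\<close> off \<open>F\<close> is cut into shells according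
  to the distance from \<open>F\<close>. Shells whose indices differ by at least 2 have positive distance from each
  other, so additivity on separated sets bounds the sum over the even shells, and the sum over the odd
  ones, by \<open>H A\<close>. The series over all shells therefore converges, and \<open>A - F\<close> is approximated in measure
  by parts of \<open>A\<close> that have positive distance from \<open>F\<close>.\<close>
lemma metric_outer_measure_borel:
  fixes H :: "'a::metric_space set \<Rightarrow> ennreal"
  assumes empty: "H {} = 0" and mono: "\<And>A B. A \<subseteq> B \<Longrightarrow> H A \<le> H B"
    and subadd: "\<And>A :: nat \<Rightarrow> 'a set. H (\<Union>i. A i) \<le> (\<Sum>i. H (A i))"
    and metric: "\<And>A B \<delta>. 0 < \<delta> \<Longrightarrow> (\<And>x y. x \<in> A \<Longrightarrow> y \<in> B \<Longrightarrow> \<delta> \<le> dist x y) \<Longrightarrow> H A + H B \<le> H (A \<union> B)"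
  shows "measure_space UNIV (sets borel) H"
proof -
  have oms: "outer_measure_space UNIV H"
    by (auto simp: outer_measure_space_def positive_def increasing_def countably_subadditive_def
        empty intro: mono subadd)
  interpret sigma_algebra UNIV "UNIV :: 'a set set"
    by (simp add: sigma_algebra_Pow flip: Pow_UNIV)
  let ?L = "lambda_system UNIV UNIV H"
  have ms: "measure_space UNIV ?L H"
    using caratheodory_lemma[OF oms] .
  have sub2: "H (A \<union> B) \<le> H A + H B" for A B
  proof -
    define S where "S n = (if n = (0::nat) then A else if n = 1 then B else {})" for n
    have "H (A \<union> B) \<le> H (\<Union>n. S n)"
      by (intro mono) (auto simp: S_def intro: exI[of _ 0] exI[of _ 1])
    also have "\<dots> \<le> (\<Sum>n. H (S n))" by (rule subadd)
    also have "\<dots> = (\<Sum>n\<in>{0,1}. H (S n))"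
      by (rule suminf_finite) (auto simp: S_def empty)
    also have "\<dots> = H A + H B" by (simp add: S_def)
    finally show ?thesis .
  qed
  have "F \<in> ?L" if F: "closed F" for F
  proof (cases "F = {}")
    case True then show ?thesis by (auto simp: lambda_system_eq empty)
  next
    case False
    have "H (A \<inter> F) + H (A - F) \<le> H A" for A
    proof (cases "H A = \<infinity>")
      case finA: False
      \<comment> \<open>The shells accumulate at \<open>F\<close>; \<open>B n\<close> is what remains of \<open>A - F\<close> without the shells from \<open>n\<close> on.\<close>
      define R where "R k = {x\<in>A. 1 / real (k + 2) \<le> infdist x F \<and> infdist x F < 1 / real (k + 1)}" for k
      define B where "B n = {x\<in>A. 1 / real (n + 1) \<le> infdist x F}" for n
      have far: "H U + H V \<le> H (U \<union> V)"
        if "s < t" "\<And>x. x \<in> U \<Longrightarrow> t \<le> infdist x F" "\<And>x. x \<in> V \<Longrightarrow> infdist x F \<le> s" for U V s t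
      proof (rule metric[of "t - s"])
        fix x y assume "x \<in> U" "y \<in> V"
        with that(2)[of x] that(3)[of y] show "t - s \<le> dist x y"
          using infdist_triangle[of x F y] by linarith
      qed (use that in auto)
      \<comment> \<open>The even shells are the case \<open>c = 0\<close>, the odd ones the case \<open>c = 1\<close>.\<close>
      have alt: "(\<Sum>j<N. H (R (2 * j + c))) \<le> H (\<Union>j<N. R (2 * j + c))" for N c
      proof (induction N)
        case (Suc N)
        have "(\<Sum>j<Suc N. H (R (2 * j + c))) \<le> H (\<Union>j<N. R (2 * j + c)) + H (R (2 * N + c))"
          using Suc by (simp add: add_right_mono)
        also have "\<dots> \<le> H ((\<Union>j<N. R (2 * j + c)) \<union> R (2 * N + c))"
        proof (cases "N = 0")
          case False
          show ?thesis
          proof (rule far)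
            show "1 / real (2 * N + c + 1) < 1 / real (2 * N + c)"
              using False by (simp add: field_simps)
            fix x assume "x \<in> (\<Union>j<N. R (2 * j + c))"
            then obtain j where j: "j < N" "x \<in> R (2 * j + c)" by auto
            have "1 / real (2 * N + c) \<le> 1 / real (2 * j + c + 2)"
              using j(1) by (intro divide_left_mono) auto
            with j(2) show "1 / real (2 * N + c) \<le> infdist x F" by (auto simp: R_def)
          qed (auto simp: R_def)
        qed (simp add: empty)
        also have "(\<Union>j<N. R (2 * j + c)) \<union> R (2 * N + c) = (\<Union>j<Suc N. R (2 * j + c))"
          by (auto simp: less_Suc_eq)
        finally show ?case .
      qed (simp add: empty)
      have two: "(\<Sum>k<2 * N. f k) = (\<Sum>j<N. f (2 * j)) + (\<Sum>j<N. f (2 * j + 1))" for N and f :: "nat \<Rightarrow> ennreal"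
        by (induction N) (auto simp: algebra_simps)
      have bd: "(\<Sum>k<N. H (R k)) \<le> 2 * H A" for N
      proof -
        have "(\<Sum>k<N. H (R k)) \<le> (\<Sum>k<2 * N. H (R k))"
          by (intro sum_mono2) auto
        also have "\<dots> = (\<Sum>j<N. H (R (2 * j + 0))) + (\<Sum>j<N. H (R (2 * j + 1)))"
          using two by simp
        also have "\<dots> \<le> H A + H A"
          by (intro add_mono order_trans[OF alt] mono) (auto simp: R_def)
        finally show ?thesis by (simp add: mult_2)
      qed
      have fin: "H (R k) < top" for k
        using mono[of "R k" A] finA by (auto simp: R_def top.not_eq_extremum less_le_trans le_less_trans)
      define r where "r k = enn2real (H (R k))" for k
      have Hr: "H (R k) = ennreal (r k)" and r0: "0 \<le> r k" for k
        using fin[of k] by (auto simp: r_def)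
      have "(\<Sum>k<N. r k) \<le> enn2real (2 * H A)" for N
      proof -
        have "ennreal (\<Sum>k<N. r k) \<le> 2 * H A"
          using bd[of N] by (simp add: Hr r0 sum_ennreal)
        moreover have "2 * H A < top" using finA by (simp add: ennreal_mult_less_top less_top)
        ultimately show ?thesis
          by (metis enn2real_mono enn2real_ennreal r0 sum_nonneg)
      qed
      then have sr: "summable r"
        by (intro summableI_nonneg_bounded r0)
      have split: "H (A - F) \<le> H (B n) + ennreal (\<Sum>k. r (k + n))" for n
      proof -
        have "A - F \<subseteq> B n \<union> (\<Union>k. R (k + n))"
        proof
          fix x assume x: "x \<in> A - F"
          then have pos: "0 < infdist x F"
            using F False by (metis DiffD2 in_closed_iff_infdist_zero infdist_nonneg less_eq_real_def)
          show "x \<in> B n \<union> (\<Union>k. R (k + n))"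
          proof (cases "x \<in> B n")
            case notB: False
            \<comment> \<open>The first \<open>m\<close> with \<open>1 / (m + 1) \<le> infdist x F\<close> places \<open>x\<close> in the shell with index \<open>m - 1\<close>.\<close>
            define m where "m = (LEAST m. 1 / real (m + 1) \<le> infdist x F)"
            obtain m0 where "1 / real (Suc m0) < infdist x F"
              using nat_approx_posE[OF pos] .
            then have "\<exists>m. 1 / real (m + 1) \<le> infdist x F"
              by (intro exI[of _ m0]) simp
            then have m: "1 / real (m + 1) \<le> infdist x F"
              unfolding m_def by (rule LeastI_ex)
            have "\<not> m \<le> n"
            proof
              assume "m \<le> n"
              then have "1 / real (n + 1) \<le> 1 / real (m + 1)" by (intro divide_left_mono) auto
              with m notB x show False by (auto simp: B_def)
            qed
            then have "n < m" by simp
            then obtain k where k: "m = Suc (k + n)" using less_iff_Suc_add by (auto simp: add.commute)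
            have "\<not> 1 / real (k + n + 1) \<le> infdist x F"
              using not_less_Least[of "k + n" "\<lambda>m. 1 / real (m + 1) \<le> infdist x F"] k
              unfolding m_def[symmetric] by simp
            then have "x \<in> R (k + n)" using m k x by (auto simp: R_def)
            then show ?thesis by auto
          qed simp
        qed
        then have "H (A - F) \<le> H (B n) + H (\<Union>k. R (k + n))"
          using mono sub2 order_trans by blast
        also have "H (\<Union>k. R (k + n)) \<le> (\<Sum>k. H (R (k + n)))" by (rule subadd)
        also have "\<dots> = ennreal (\<Sum>k. r (k + n))"
          unfolding Hr using sr by (intro suminf_ennreal2 r0) (simp add: summable_iff_shift)
        finally show ?thesis by (simp add: add_left_mono)
      qed
      have le: "H (A \<inter> F) + H (A - F) \<le> H A + ennreal (\<Sum>k. r (k + n))" for n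
      proof -
        have "H (B n) + H (A \<inter> F) \<le> H (B n \<union> A \<inter> F)"
          by (rule far[of 0 "1 / real (n + 1)"]) (auto simp: B_def)
        also have "\<dots> \<le> H A" by (intro mono) (auto simp: B_def)
        finally have "H (A \<inter> F) + H (B n) \<le> H A" by (simp add: add.commute)
        then have "H (A \<inter> F) + (H (B n) + ennreal (\<Sum>k. r (k + n))) \<le> H A + ennreal (\<Sum>k. r (k + n))"
          by (metis add.assoc add_right_mono)
        then show ?thesis using split[of n] by (meson add_left_mono order_trans)
      qed
      have "(\<lambda>n. \<Sum>k. r (k + n)) \<longlonglongrightarrow> 0"
        using suminf_exist_split2[OF sr] .
      then have "(\<lambda>n. H A + ennreal (\<Sum>k. r (k + n))) \<longlonglongrightarrow> H A + ennreal 0"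
        by (intro tendsto_add tendsto_const tendsto_ennrealI)
      then show ?thesis
        using le by (intro LIMSEQ_le_const[of _ "H A"]) auto
    qed simp
    moreover have "H A \<le> H (A \<inter> F) + H (A - F)" for A
      using sub2[of "A \<inter> F" "A - F"] by (simp add: Int_Diff_Un)
    ultimately show ?thesis by (auto simp: lambda_system_eq intro: antisym)
  qed
  then have "sigma_sets UNIV {F. closed F} \<subseteq> ?L"
    using ms by (intro sigma_algebra.sigma_sets_subset) (auto simp: measure_space_def)
  then have "sets borel \<subseteq> ?L"
    by (simp add: borel_eq_closed)
  then show ?thesis
    using measure_down[OF ms] sets.sigma_algebra_axioms[of "borel :: 'a measure"] by simp
qed

lemma hausdorff1_pre_le:
  assumes "A \<subseteq> (\<Union>n. U n)" "\<And>n. bounded (U n)" "\<And>n. diameter (U n) \<le> \<delta>"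
  shows "hausdorff1_pre \<delta> A \<le> (\<Sum>n. ennreal (diameter (U n)))"
  unfolding hausdorff1_pre_def using assms by (intro INF_lower) auto

lemma hausdorff1_preE:
  assumes "hausdorff1_pre \<delta> A < c"
  obtains U where "A \<subseteq> (\<Union>n. U n)" "\<And>n. bounded (U n)" "\<And>n. diameter (U n) \<le> \<delta>"
    "(\<Sum>n. ennreal (diameter (U n))) < c"
  using assms unfolding hausdorff1_pre_def by (auto simp: INF_less_iff)

lemma hausdorff1_pre_antimono:
  assumes "\<delta> \<le> \<delta>'" shows "hausdorff1_pre \<delta>' A \<le> hausdorff1_pre \<delta> A"
  unfolding hausdorff1_pre_def by (rule INF_superset_mono) (use assms in \<open>auto intro: order_trans\<close>)

lemma hausdorff1_pre_mono:
  assumes "A \<subseteq> B" shows "hausdorff1_pre \<delta> A \<le> hausdorff1_pre \<delta> B"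
  unfolding hausdorff1_pre_def by (rule INF_superset_mono) (use assms in auto)

text \<open>The covers of the pieces are chosen within \<open>\<epsilon> / 2\<^sup>i\<^sup>+\<^sup>1\<close> of the infimum and enumerated together.\<close>
lemma hausdorff1_pre_UN:
  fixes A :: "nat \<Rightarrow> R2 set"
  shows "hausdorff1_pre \<delta> (\<Union>i. A i) \<le> (\<Sum>i. hausdorff1_pre \<delta> (A i))"
proof (rule ennreal_le_epsilon)
  fix \<epsilon> :: real assume fin: "(\<Sum>i. hausdorff1_pre \<delta> (A i)) < top" and \<epsilon>: "0 < \<epsilon>"
  have "\<exists>U. A i \<subseteq> (\<Union>n. U n) \<and> (\<forall>n. bounded (U n) \<and> diameter (U n) \<le> \<delta>) \<and>
      (\<Sum>n. ennreal (diameter (U n))) \<le> hausdorff1_pre \<delta> (A i) + ennreal (\<epsilon> * (1/2) ^ Suc i)" for i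
  proof -
    have "hausdorff1_pre \<delta> (A i) < top"
      using fin ennreal_suminf_lessD by blast
    then have "hausdorff1_pre \<delta> (A i) < hausdorff1_pre \<delta> (A i) + ennreal (\<epsilon> * (1/2) ^ Suc i)"
      using \<epsilon> by (auto simp: ennreal_add_left_cancel_less[of _ 0, simplified])
    then show ?thesis
      by (elim hausdorff1_preE) (blast intro: less_imp_le)
  qed
  then obtain U where U: "\<And>i. A i \<subseteq> (\<Union>n. U i n)" "\<And>i n. bounded (U i n)" "\<And>i n. diameter (U i n) \<le> \<delta>"
    "\<And>i. (\<Sum>n. ennreal (diameter (U i n))) \<le> hausdorff1_pre \<delta> (A i) + ennreal (\<epsilon> * (1/2) ^ Suc i)"
    by metis
  define V where "V m = (case prod_decode m of (i, n) \<Rightarrow> U i n)" for m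
  have "(\<Union>i. A i) \<subseteq> (\<Union>m. V m)"
  proof
    fix x assume "x \<in> (\<Union>i. A i)"
    then obtain i n where "x \<in> U i n" using U(1) by blast
    then have "x \<in> V (prod_encode (i, n))" by (simp add: V_def)
    then show "x \<in> (\<Union>m. V m)" by blast
  qed
  then have "hausdorff1_pre \<delta> (\<Union>i. A i) \<le> (\<Sum>m. ennreal (diameter (V m)))"
    using U(2,3) by (intro hausdorff1_pre_le) (auto simp: V_def split: prod.split)
  also have "\<dots> = (\<Sum>m. (\<lambda>(i, n). ennreal (diameter (U i n))) (prod_decode m))"
    by (intro suminf_cong) (auto simp: V_def split: prod.split)
  also have "\<dots> = (\<Sum>i. \<Sum>n. ennreal (diameter (U i n)))"
    by (rule suminf_ennreal_2dimen) simp
  also have "\<dots> \<le> (\<Sum>i. hausdorff1_pre \<delta> (A i) + ennreal (\<epsilon> * (1/2) ^ Suc i))"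
    by (intro suminf_le U(4)) auto
  also have "\<dots> = (\<Sum>i. hausdorff1_pre \<delta> (A i)) + (\<Sum>i. ennreal (\<epsilon> * (1/2) ^ Suc i))"
    by (simp add: suminf_add)
  also have "(\<Sum>i. ennreal (\<epsilon> * (1/2) ^ Suc i)) = ennreal \<epsilon>"
    using sums_mult[OF power_half_series, of \<epsilon>] \<epsilon> by (intro suminf_ennreal_eq) auto
  finally show "hausdorff1_pre \<delta> (\<Union>i. A i) \<le> (\<Sum>i. hausdorff1_pre \<delta> (A i)) + ennreal \<epsilon>" .
qed

text \<open>A covering set of diameter at most \<open>\<delta>\<close> cannot meet both parts, so every cover of the union splits into
  covers of the two parts.\<close>
lemma hausdorff1_pre_separated:
  assumes sep: "\<And>x y. x \<in> A \<Longrightarrow> y \<in> B \<Longrightarrow> \<delta> < dist x y"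
  shows "hausdorff1_pre \<delta> A + hausdorff1_pre \<delta> B \<le> hausdorff1_pre \<delta> (A \<union> B)"
  unfolding hausdorff1_pre_def[of _ "A \<union> B"]
proof (intro INF_greatest, clarify)
  fix U :: "nat \<Rightarrow> R2 set" assume U: "A \<union> B \<subseteq> (\<Union>n. U n)" "\<forall>n. bounded (U n) \<and> diameter (U n) \<le> \<delta>"
  define V where "V C n = (if U n \<inter> C = {} then {} else U n)" for C n
  have V: "hausdorff1_pre \<delta> C \<le> (\<Sum>n. ennreal (diameter (V C n)))" if "C \<subseteq> A \<union> B" for C
  proof (cases "0 \<le> \<delta>")
    case True
    have "C \<subseteq> (\<Union>n. V C n)"
    proof
      fix x assume x: "x \<in> C"
      then have "x \<in> (\<Union>n. U n)" using U(1) that by blast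
      then obtain n where "x \<in> U n" by blast
      with x have "x \<in> V C n" by (auto simp: V_def)
      then show "x \<in> (\<Union>n. V C n)" by blast
    qed
    then show ?thesis using U(2) True by (intro hausdorff1_pre_le) (auto simp: V_def)
  next
    case False
    moreover have "diameter (U 0) \<le> \<delta>" "bounded (U 0)" using U(2) by blast+
    ultimately show ?thesis using diameter_ge_0[of "U 0"] by linarith
  qed
  have "hausdorff1_pre \<delta> A + hausdorff1_pre \<delta> B
      \<le> (\<Sum>n. ennreal (diameter (V A n))) + (\<Sum>n. ennreal (diameter (V B n)))"
    by (intro add_mono V) auto
  also have "\<dots> = (\<Sum>n. ennreal (diameter (V A n)) + ennreal (diameter (V B n)))"
    by (simp add: suminf_add)
  also have "\<dots> \<le> (\<Sum>n. ennreal (diameter (U n)))"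
  proof (intro suminf_le)
    fix n
    have "U n \<inter> A = {} \<or> U n \<inter> B = {}"
    proof (rule ccontr)
      assume "\<not> ?thesis"
      then obtain x y where "x \<in> U n" "x \<in> A" "y \<in> U n" "y \<in> B" by blast
      then show False
        using sep[of x y] diameter_bounded_bound[of "U n" x y] spec[OF U(2), of n] by auto
    qed
    then show "ennreal (diameter (V A n)) + ennreal (diameter (V B n)) \<le> ennreal (diameter (U n))"
      by (auto simp: V_def)
  qed auto
  finally show "hausdorff1_pre \<delta> A + hausdorff1_pre \<delta> B \<le> (\<Sum>n. ennreal (diameter (U n)))" .
qed

lemma hausdorff1_pre_le_outer: "0 < \<delta> \<Longrightarrow> hausdorff1_pre \<delta> A \<le> hausdorff1_outer A"
  unfolding hausdorff1_outer_def by (rule SUP_upper) simp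

lemma hausdorff1_outer_measure_space: "measure_space UNIV (sets borel) hausdorff1_outer"
proof (rule metric_outer_measure_borel)
  have "hausdorff1_pre \<delta> {} \<le> 0" if "0 < \<delta>" for \<delta>
    using hausdorff1_pre_le[of "{}" "\<lambda>_. {}" \<delta>] that by simp
  then show "hausdorff1_outer {} = 0"
    unfolding hausdorff1_outer_def by (intro antisym SUP_least) auto
  show "hausdorff1_outer A \<le> hausdorff1_outer B" if "A \<subseteq> B" for A B
    unfolding hausdorff1_outer_def by (intro SUP_mono') (rule hausdorff1_pre_mono[OF that])
  show "hausdorff1_outer (\<Union>i. A i) \<le> (\<Sum>i. hausdorff1_outer (A i))" for A :: "nat \<Rightarrow> R2 set"
    unfolding hausdorff1_outer_def[of "\<Union>i. A i"]
    by (intro SUP_least order_trans[OF hausdorff1_pre_UN] suminf_le hausdorff1_pre_le_outer) auto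
  show "hausdorff1_outer A + hausdorff1_outer B \<le> hausdorff1_outer (A \<union> B)"
    if sep: "0 < \<delta>" "\<And>x y. x \<in> A \<Longrightarrow> y \<in> B \<Longrightarrow> \<delta> \<le> dist x y" for A B \<delta>
  proof -
    have "hausdorff1_pre s A + hausdorff1_pre t B \<le> hausdorff1_outer (A \<union> B)" if "0 < s" "0 < t" for s t
    proof -
      define u where "u = min (\<delta> / 2) (min s t)"
      have u: "0 < u" "u < \<delta>" "u \<le> s" "u \<le> t" using that sep by (auto simp: u_def)
      have "hausdorff1_pre s A + hausdorff1_pre t B \<le> hausdorff1_pre u A + hausdorff1_pre u B"
        using u by (intro add_mono hausdorff1_pre_antimono)
      also have "\<dots> \<le> hausdorff1_pre u (A \<union> B)"
        using sep(2) u(2) by (intro hausdorff1_pre_separated) (meson less_le_trans)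
      also have "\<dots> \<le> hausdorff1_outer (A \<union> B)" using u by (intro hausdorff1_pre_le_outer)
      finally show ?thesis .
    qed
    then show ?thesis
      unfolding hausdorff1_outer_def[of A] hausdorff1_outer_def[of B]
      by (auto simp: ennreal_SUP_add_left[symmetric] ennreal_SUP_add_right intro!: SUP_least)
  qed
qed

lemma space_hausdorff1 [simp]: "space hausdorff1 = UNIV"
  and sets_hausdorff1 [measurable_cong, simp]: "sets hausdorff1 = sets borel"
  unfolding hausdorff1_def using sets.sigma_sets_eq[of borel] by (auto simp: space_measure_of_conv)

lemma emeasure_hausdorff1:
  assumes "A \<in> sets borel" shows "emeasure hausdorff1 A = hausdorff1_outer A"
  unfolding hausdorff1_def
  using assms hausdorff1_outer_measure_space
  by (intro emeasure_measure_of_sigma) (auto simp: measure_space_def)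

lemma emeasure_lborel_rectangle:
  fixes a b c d :: real
  assumes "a \<le> b" "c \<le> d"
  shows "emeasure lborel (cbox (vector [a, c]) (vector [b, d] :: R2)) = ennreal ((b - a) * (d - c))"
proof -
  have ne: "cbox (vector [a, c]) (vector [b, d] :: R2) \<noteq> {}"
    using assms by (auto simp: interval_ne_empty_cart forall_2)
  have "emeasure lborel (cbox (vector [a, c]) (vector [b, d] :: R2))
      = ennreal (measure lborel (cbox (vector [a, c]) (vector [b, d] :: R2)))"
    by (intro emeasure_eq_ennreal_measure) (simp add: emeasure_lborel_cbox_eq)
  also have "measure lborel (cbox (vector [a, c]) (vector [b, d] :: R2)) = (b - a) * (d - c)"
    using content_cbox_cart[OF ne] by (simp add: UNIV_2)
  finally show ?thesis .
qed

text \<open>Projecting to the vertical axis does not increase diameters. A cover of \<open>A\<close> by sets \<open>U n\<close> thus yields a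
  cover of the strip by rectangles of width \<open>2 R\<close> and height at most the diameter of \<open>U n\<close>.\<close>
lemma emeasure_strip_le_hausdorff1:
  fixes S A :: "R2 set"
  assumes "0 < R" and S: "\<And>x. x \<in> S \<Longrightarrow> \<bar>x $ 1\<bar> \<le> R \<and> (\<exists>y\<in>A. y $ 2 = x $ 2)"
  shows "emeasure lborel S \<le> ennreal (2 * R) * hausdorff1_outer A"
proof -
  \<comment> \<open>Dividing by \<open>2 R\<close> puts the estimate in the form of a lower bound for every member of the infimum.\<close>
  have cancel: "ennreal (2 * R) * (ennreal (1 / (2 * R)) * t) = t"
    "ennreal (1 / (2 * R)) * (ennreal (2 * R) * t) = t" for t
    using \<open>0 < R\<close> by (auto simp: mult.assoc[symmetric] ennreal_mult'[symmetric])
  have "ennreal (1 / (2 * R)) * emeasure lborel S \<le> hausdorff1_pre 1 A"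
    unfolding hausdorff1_pre_def
  proof (intro INF_greatest, clarify)
    fix U :: "nat \<Rightarrow> R2 set" assume U: "A \<subseteq> (\<Union>n. U n)" "\<forall>n. bounded (U n) \<and> diameter (U n) \<le> 1"
    define B where "B n = (if U n = {} then {} else
      cbox (vector [- R, Inf ((\<lambda>y. y $ 2) ` U n)]) (vector [R, Sup ((\<lambda>y. y $ 2) ` U n)]) :: R2 set)" for n
    have bdd: "bounded ((\<lambda>y. y $ 2) ` U n)" for n
      using U(2) by (intro bounded_linear_image bounded_linear_vec_nth) auto
    have mem: "Inf ((\<lambda>y. y $ 2) ` U n) \<le> y $ 2" "y $ 2 \<le> Sup ((\<lambda>y. y $ 2) ` U n)" if "y \<in> U n" for n y
      using that bdd[of n] by (auto intro!: cInf_lower cSup_upper bounded_imp_bdd_below bounded_imp_bdd_above)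
    have mB: "emeasure lborel (B n) \<le> ennreal (2 * R) * ennreal (diameter (U n))" for n
    proof (cases "U n = {}")
      case False
      have d: "y $ 2 - z $ 2 \<le> diameter (U n)" if "y \<in> U n" "z \<in> U n" for y z
        using diameter_bounded_bound[of "U n" y z] U(2) that component_le_norm_cart[of "y - z" 2]
        by (auto simp: dist_norm)
      have "Sup ((\<lambda>y. y $ 2) ` U n) \<le> Inf ((\<lambda>y. y $ 2) ` U n) + diameter (U n)"
      proof (rule cSup_least, use False in simp, clarify)
        fix y assume y: "y \<in> U n"
        have "y $ 2 - diameter (U n) \<le> Inf ((\<lambda>y. y $ 2) ` U n)"
          by (rule cInf_greatest) (use False d[OF y] in \<open>auto simp: algebra_simps\<close>)
        then show "y $ 2 \<le> Inf ((\<lambda>y. y $ 2) ` U n) + diameter (U n)" by simp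
      qed
      moreover have "Inf ((\<lambda>y. y $ 2) ` U n) \<le> Sup ((\<lambda>y. y $ 2) ` U n)"
        using mem False by (meson ex_in_conv order_trans)
      ultimately show ?thesis
        using \<open>0 < R\<close> False
        by (auto simp: B_def emeasure_lborel_rectangle ennreal_mult'[symmetric] intro!: ennreal_leI)
    qed (simp add: B_def)
    have "S \<subseteq> (\<Union>n. B n)"
    proof
      fix x assume x: "x \<in> S"
      obtain y where y: "y \<in> A" "y $ 2 = x $ 2" using S[OF x] by auto
      then obtain n where n: "y \<in> U n" using U by auto
      then have "x \<in> B n"
        using S[OF x] mem[OF n] y by (auto simp: B_def mem_box_cart forall_2)
      then show "x \<in> (\<Union>n. B n)" by blast
    qed
    then have "emeasure lborel S \<le> emeasure lborel (\<Union>n. B n)"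
      by (intro emeasure_mono) (auto simp: B_def)
    also have "\<dots> \<le> (\<Sum>n. emeasure lborel (B n))"
      by (intro emeasure_subadditive_countably) (auto simp: B_def)
    also have "\<dots> \<le> (\<Sum>n. ennreal (2 * R) * ennreal (diameter (U n)))"
      by (intro suminf_le mB) auto
    finally have "emeasure lborel S \<le> ennreal (2 * R) * (\<Sum>n. ennreal (diameter (U n)))"
      by simp
    then have "ennreal (1 / (2 * R)) * emeasure lborel S
        \<le> ennreal (1 / (2 * R)) * (ennreal (2 * R) * (\<Sum>n. ennreal (diameter (U n))))"
      by (rule mult_left_mono) simp
    then show "ennreal (1 / (2 * R)) * emeasure lborel S \<le> (\<Sum>n. ennreal (diameter (U n)))"
      by (simp only: cancel)
  qed
  then have "ennreal (2 * R) * (ennreal (1 / (2 * R)) * emeasure lborel S)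
      \<le> ennreal (2 * R) * hausdorff1_pre 1 A"
    by (rule mult_left_mono) simp
  then have "emeasure lborel S \<le> ennreal (2 * R) * hausdorff1_pre 1 A"
    by (simp only: cancel)
  also have "\<dots> \<le> ennreal (2 * R) * hausdorff1_outer A"
    by (intro mult_left_mono hausdorff1_pre_le_outer) auto
  finally show ?thesis .
qed

text \<open>In the plane, two orthonormal vectors span the space.\<close>
lemma norm_le_orthonormal_coords:
  fixes e n z :: R2
  assumes "norm e = 1" "norm n = 1" "e \<bullet> n = 0"
  shows "norm z \<le> \<bar>z \<bullet> e\<bar> + \<bar>z \<bullet> n\<bar>"
proof -
  have ne: "e \<noteq> n" using assms by auto
  have indep: "independent {e, n}"
    using assms by (intro pairwise_orthogonal_independent)
      (auto simp: pairwise_def orthogonal_def inner_commute)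
  have "dim {e, n} = DIM(R2)"
    using indep ne by (simp add: dim_eq_card_independent)
  then have "span {e, n} = UNIV"
    using dim_eq_full by blast
  then have "z \<in> span {e, n}" by simp
  then obtain s where "z - s *\<^sub>R e \<in> span {n}" unfolding span_insert by blast
  then obtain t where "z - s *\<^sub>R e = t *\<^sub>R n" unfolding span_singleton by blast
  then have z: "z = s *\<^sub>R e + t *\<^sub>R n" by (simp add: algebra_simps)
  have "e \<bullet> e = 1" "n \<bullet> n = 1" using assms by (auto simp: dot_square_norm)
  then have "z \<bullet> e = s" "z \<bullet> n = t"
    using assms(3) inner_commute[of n e] by (auto simp: z inner_add_left)
  then show ?thesis
    using norm_triangle_ineq[of "s *\<^sub>R e" "t *\<^sub>R n"] assms by (simp add: z)
qed

text \<open>Over an interval of length \<open>2 r / N\<close> the graph has diameter at most \<open>(1 + K) 2 r / N\<close>. The sum over \<open>N\<close>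
  intervals does not depend on \<open>N\<close>, so the bound holds for every scale \<open>\<delta>\<close>.\<close>
lemma hausdorff1_lipschitz_graph_finite:
  fixes e n p :: R2 and \<gamma> :: "real \<Rightarrow> real"
  assumes on: "norm e = 1" "norm n = 1" "e \<bullet> n = 0" and lip: "K-lipschitz_on UNIV \<gamma>" and "0 < r"
    and A: "A \<subseteq> ball p r" "\<And>x. x \<in> A \<Longrightarrow> x \<bullet> n = \<gamma> (x \<bullet> e)"
  shows "hausdorff1_outer A \<le> ennreal ((1 + K) * (2 * r))"
  unfolding hausdorff1_outer_def
proof (intro SUP_least)
  fix \<delta> :: real assume "\<delta> \<in> {0<..}"
  then have \<delta>: "0 < \<delta>" by simp
  have K: "0 \<le> K" using lip by (rule lipschitz_on_nonneg)
  obtain N :: nat where N: "(1 + K) * (2 * r) / \<delta> < real N" using reals_Archimedean2 by blast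
  then have N0: "0 < N" using K \<delta> \<open>0 < r\<close> by (smt (verit) divide_pos_pos mult_pos_pos of_nat_0_less_iff)
  define h where "h = 2 * r / real N"
  have h: "0 < h" using N0 \<open>0 < r\<close> by (simp add: h_def)
  have small: "(1 + K) * h \<le> \<delta>"
    using N N0 \<delta> by (simp add: h_def field_simps)
  define c where "c = p \<bullet> e - r"
  define U where "U k = (if k < N then {x\<in>A. c + real k * h \<le> x \<bullet> e \<and> x \<bullet> e \<le> c + real (k + 1) * h} else {})" for k
  have bdd: "bounded (U k)" for k
    by (rule bounded_subset[OF bounded_ball[of p r]]) (use A(1) in \<open>auto simp: U_def\<close>)
  have diam: "diameter (U k) \<le> (1 + K) * h" for k
  proof (rule diameter_le)
    fix x y assume xy: "x \<in> U k" "y \<in> U k"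
    then have xA: "x \<in> A" "y \<in> A" and d: "\<bar>(x - y) \<bullet> e\<bar> \<le> h"
      by (auto simp: U_def inner_diff_left algebra_simps split: if_splits)
    have "\<bar>(x - y) \<bullet> n\<bar> \<le> K * \<bar>(x - y) \<bullet> e\<bar>"
      using lipschitz_onD[OF lip, of "x \<bullet> e" "y \<bullet> e"] A(2)[OF xA(1)] A(2)[OF xA(2)]
      by (simp add: dist_real_def inner_diff_left)
    also have "\<dots> \<le> K * h" using d K by (intro mult_left_mono)
    finally show "norm (x - y) \<le> (1 + K) * h"
      using norm_le_orthonormal_coords[OF on, of "x - y"] d by (simp add: algebra_simps)
  qed (use K h in simp)
  have "A \<subseteq> (\<Union>k. U k)"
  proof
    fix x assume x: "x \<in> A"
    have "\<bar>(x - p) \<bullet> e\<bar> \<le> norm (x - p)"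
      using Cauchy_Schwarz_ineq2[of "x - p" e] on by simp
    also have "\<dots> < r" using x A(1) by (auto simp: dist_norm norm_minus_commute)
    finally have t: "0 < x \<bullet> e - c" "x \<bullet> e - c < 2 * r"
      by (auto simp: c_def inner_diff_left)
    define k where "k = nat \<lfloor>(x \<bullet> e - c) / h\<rfloor>"
    have k: "real k \<le> (x \<bullet> e - c) / h" "(x \<bullet> e - c) / h < real k + 1"
      using t h by (auto simp: k_def)
    have "real k < real N"
    proof -
      have "(x \<bullet> e - c) / h < 2 * r / h" using t h by (intro divide_strict_right_mono) auto
      also have "\<dots> = real N" using N0 \<open>0 < r\<close> by (simp add: h_def)
      finally show ?thesis using k by linarith
    qed
    then have "x \<in> U k"
      using k h x by (auto simp: U_def field_simps)
    then show "x \<in> (\<Union>k. U k)" by blast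
  qed
  then have "hausdorff1_pre \<delta> A \<le> (\<Sum>k. ennreal (diameter (U k)))"
    using bdd diam small by (intro hausdorff1_pre_le) (auto intro: order_trans)
  also have "\<dots> = (\<Sum>k<N. ennreal (diameter (U k)))"
    by (rule suminf_finite) (auto simp: U_def)
  also have "\<dots> \<le> (\<Sum>k<N. ennreal ((1 + K) * h))"
    by (intro sum_mono ennreal_leI diam)
  also have "\<dots> = ennreal ((1 + K) * (2 * r))"
    using K h N0 by (simp add: sum_ennreal h_def ennreal_of_nat_eq_real_of_nat ennreal_mult'[symmetric])
  finally show "hausdorff1_pre \<delta> A \<le> ennreal ((1 + K) * (2 * r))" .
qed

text \<open>In a coordinate ball the frontier lies on the graph, since a point strictly below the graph has a
  neighbourhood disjoint from \<open>\<Omega>\<close> and a point strictly above it belongs to \<open>\<Omega>\<close>; by compactness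
  finitely many balls suffice.\<close>
lemma lipschitz_boundary_finite_measure:
  assumes "open \<Omega>" "bounded \<Omega>" "lipschitz_boundary \<Omega>"
  shows "emeasure hausdorff1 (frontier \<Omega>) < \<infinity>"
proof -
  have comp: "compact (frontier \<Omega>)"
    using assms by (simp add: compact_frontier_bounded)
  have "\<exists>r>0. hausdorff1_outer (frontier \<Omega> \<inter> ball p r) < \<infinity>" if p: "p \<in> frontier \<Omega>" for p
  proof -
    obtain r e n \<gamma> K where r: "0 < r" and on: "norm e = 1" "norm n = 1" "e \<bullet> n = 0"
      and lip: "K-lipschitz_on UNIV \<gamma>"
      and eq: "\<Omega> \<inter> ball p r = {x \<in> ball p r. \<gamma> (x \<bullet> e) < x \<bullet> n}"
      using assms(3)[unfolded lipschitz_boundary_def, rule_format, OF p]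
      by (elim exE conjE) (rule that)
    have cont: "continuous_on UNIV (\<lambda>x. \<gamma> (x \<bullet> e))"
      using lipschitz_on_continuous_on[OF lip]
      by (rule continuous_on_compose2) (auto intro!: continuous_intros)
    have "x \<bullet> n = \<gamma> (x \<bullet> e)" if x: "x \<in> frontier \<Omega> \<inter> ball p r" for x
    proof (rule ccontr)
      assume "x \<bullet> n \<noteq> \<gamma> (x \<bullet> e)"
      moreover have "x \<notin> \<Omega>" using x assms(1) by (auto simp: frontier_def interior_open)
      ultimately have lt: "x \<bullet> n < \<gamma> (x \<bullet> e)" using eq x by force
      define V where "V = ball p r \<inter> {y. y \<bullet> n < \<gamma> (y \<bullet> e)}"
      have "open V" unfolding V_def
        by (intro open_Int open_ball open_Collect_less cont continuous_intros)
      moreover have "x \<in> V" using x lt by (auto simp: V_def)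
      moreover have "V \<inter> \<Omega> = {}" using eq by (force simp: V_def)
      ultimately have "x \<notin> closure \<Omega>"
        using open_Int_closure_eq_empty by blast
      then show False using x by (auto simp: frontier_def)
    qed
    then have "hausdorff1_outer (frontier \<Omega> \<inter> ball p r) \<le> ennreal ((1 + K) * (2 * r))"
      by (intro hausdorff1_lipschitz_graph_finite[OF on lip r]) auto
    then have "hausdorff1_outer (frontier \<Omega> \<inter> ball p r) < \<infinity>"
      by (rule le_less_trans) simp
    then show ?thesis using r by blast
  qed
  then obtain r where r: "\<And>p. p \<in> frontier \<Omega> \<Longrightarrow> 0 < r p \<and> hausdorff1_outer (frontier \<Omega> \<inter> ball p (r p)) < \<infinity>"
    by metis
  obtain D where D: "D \<subseteq> frontier \<Omega>" "finite D" "frontier \<Omega> \<subseteq> (\<Union>p\<in>D. ball p (r p))"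
  proof (rule compactE_image[OF comp, of "frontier \<Omega>" "\<lambda>p. ball p (r p)"])
    show "frontier \<Omega> \<subseteq> (\<Union>p\<in>frontier \<Omega>. ball p (r p))"
      using r by force
  qed auto
  have meas: "frontier \<Omega> \<inter> ball p s \<in> sets borel" for p s by auto
  have "emeasure hausdorff1 (frontier \<Omega>) \<le> emeasure hausdorff1 (\<Union>p\<in>D. frontier \<Omega> \<inter> ball p (r p))"
  proof (rule emeasure_mono)
    show "frontier \<Omega> \<subseteq> (\<Union>p\<in>D. frontier \<Omega> \<inter> ball p (r p))" using D(3) by blast
    show "(\<Union>p\<in>D. frontier \<Omega> \<inter> ball p (r p)) \<in> sets hausdorff1"
      unfolding sets_hausdorff1 using D(2) meas by blast
  qed
  also have "\<dots> \<le> (\<Sum>p\<in>D. emeasure hausdorff1 (frontier \<Omega> \<inter> ball p (r p)))"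
    using D by (intro emeasure_subadditive_finite) auto
  also have "\<dots> < \<infinity>"
    using D(1,2) r by (subst infinity_ennreal_def, subst ennreal_sum_less_top) (auto simp: emeasure_hausdorff1 meas)
  finally show ?thesis .
qed

section \<open>The Friedrichs inequality\<close>

text \<open>The radius \<open>R\<close> is a parameter because it determines the constants of the inequalities.\<close>
locale bounded_open_set =
  fixes \<Omega> :: "R2 set" and R :: real
  assumes open\<Omega>: "open \<Omega>" and R: "0 < R" and sub: "\<Omega> \<subseteq> ball 0 R"
begin

text \<open>The time at which the ray from \<open>x\<close> in direction \<open>- e\<^sub>1\<close> first leaves \<open>\<Omega>\<close>; the value 0 off \<open>\<Omega>\<close> makes this
  a Borel function on the whole plane.\<close>
definition exit_time :: "R2 \<Rightarrow> real" where
  "exit_time x = (if x \<in> \<Omega> then Inf {t. 0 \<le> t \<and> x - t *\<^sub>R axis 1 1 \<notin> \<Omega>} else 0)"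

definition exit_point :: "R2 \<Rightarrow> R2" where
  "exit_point x = x - exit_time x *\<^sub>R axis 1 1"

lemma leaves_within_2R:
  assumes "x \<in> \<Omega>" shows "x - (2 * R) *\<^sub>R axis 1 1 \<notin> \<Omega>"
proof
  assume "x - (2 * R) *\<^sub>R axis 1 1 \<in> \<Omega>"
  then have "norm (x - (2 * R) *\<^sub>R axis 1 (1::real)) < R" using sub by auto
  moreover have "norm x < R" using sub assms by auto
  ultimately show False
    using R norm_triangle_ineq4[of x "x - (2 * R) *\<^sub>R axis 1 1"] by simp
qed

lemma exit_time:
  assumes "x \<in> \<Omega>"
  shows "0 < exit_time x" "exit_time x \<le> 2 * R" "exit_point x \<notin> \<Omega>"
    "\<And>t. 0 \<le> t \<Longrightarrow> t < exit_time x \<Longrightarrow> x - t *\<^sub>R axis 1 1 \<in> \<Omega>"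
proof -
  let ?T = "{t. 0 \<le> t \<and> x - t *\<^sub>R axis 1 1 \<notin> \<Omega>}"
  have T: "exit_time x = Inf ?T" using assms by (simp add: exit_time_def)
  have ne: "?T \<noteq> {}" using leaves_within_2R[OF assms] R by (auto intro!: exI[of _ "2 * R"])
  have bdd: "bdd_below ?T" by (rule bdd_belowI[of _ 0]) auto
  have "?T = {0..} \<inter> (\<lambda>t. x - t *\<^sub>R axis 1 1) -` (- \<Omega>)" by auto
  also have "closed \<dots>"
    using open\<Omega> by (intro closed_Int closed_vimage continuous_intros) auto
  finally have "Inf ?T \<in> ?T" by (rule closed_contains_Inf[OF ne bdd])
  then have in_T: "0 \<le> exit_time x" "exit_point x \<notin> \<Omega>" by (auto simp: T[symmetric] exit_point_def)
  then show "exit_point x \<notin> \<Omega>" by blast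
  have "exit_time x \<noteq> 0" using in_T(2) assms by (auto simp: exit_point_def)
  then show "0 < exit_time x" using in_T(1) by simp
  show "exit_time x \<le> 2 * R"
    unfolding T using leaves_within_2R[OF assms] R by (intro cInf_lower bdd) auto
  show "x - t *\<^sub>R axis 1 1 \<in> \<Omega>" if "0 \<le> t" "t < exit_time x" for t
    using that cInf_lower[OF _ bdd, of t] unfolding T by force
qed

lemma exit_point_frontier:
  assumes x: "x \<in> \<Omega>" shows "exit_point x \<in> frontier \<Omega>"
proof -
  have "closed ((\<lambda>t. x - t *\<^sub>R axis 1 1) -` closure \<Omega>)"
    by (intro closed_vimage continuous_intros) auto
  moreover have "{0..<exit_time x} \<subseteq> (\<lambda>t. x - t *\<^sub>R axis 1 1) -` closure \<Omega>"
    using exit_time(4)[OF x] closure_subset[of \<Omega>] by (simp add: subset_iff)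
  ultimately have "closure {0..<exit_time x} \<subseteq> (\<lambda>t. x - t *\<^sub>R axis 1 1) -` closure \<Omega>"
    by (rule closure_minimal[rotated])
  moreover have "exit_time x \<in> closure {0..<exit_time x}"
    using exit_time(1)[OF x] by simp
  ultimately have "exit_point x \<in> closure \<Omega>"
    unfolding exit_point_def by blast
  then show ?thesis
    using exit_time(3)[OF x] open\<Omega> by (simp add: frontier_def interior_open)
qed

text \<open>The exit time is lower semicontinuous on \<open>\<Omega>\<close>: it exceeds \<open>c\<close> if and only if a compact segment starting
  at \<open>x\<close> lies in \<open>\<Omega>\<close>, which is an open condition on \<open>x\<close>.\<close>
lemma exit_time_measurable [measurable]: "exit_time \<in> borel_measurable borel"
  unfolding borel_measurable_iff_greater
proof (intro allI)
  fix c :: real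
  show "{w \<in> space borel. c < exit_time w} \<in> sets borel"
  proof (cases "c < 0")
    case True
    then have "c < exit_time x" for x
      using exit_time(1)[of x] by (cases "x \<in> \<Omega>") (auto simp: exit_time_def)
    then show ?thesis by simp
  next
    case False
    \<comment> \<open>The sum of the compact segment and the closed complement of \<open>\<Omega>\<close>: the points whose segment meets it.\<close>
    let ?C = "\<Union>z\<in>(\<lambda>t. t *\<^sub>R axis 1 (1::real)) ` {0..c}. \<Union>y\<in>- \<Omega>. {z + y} :: R2 set"
    have "{w \<in> space borel. c < exit_time w} = - ?C"
    proof (intro set_eqI iffI)
      fix x assume "x \<in> {w \<in> space borel. c < exit_time w}"
      then have "c < exit_time x" by simp
      then have "x \<in> \<Omega>" using False by (auto simp: exit_time_def split: if_splits)
      show "x \<in> - ?C"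
      proof
        assume "x \<in> ?C"
        then obtain t y where "0 \<le> t" "t \<le> c" "y \<notin> \<Omega>" "x = t *\<^sub>R axis 1 1 + y" by auto
        then show False using exit_time(4)[OF \<open>x \<in> \<Omega>\<close>, of t] \<open>c < exit_time x\<close> by simp
      qed
    next
      fix x assume x: "x \<in> - ?C"
      have inside: "x - t *\<^sub>R axis 1 1 \<in> \<Omega>" if "0 \<le> t" "t \<le> c" for t
      proof (rule ccontr)
        assume "x - t *\<^sub>R axis 1 1 \<notin> \<Omega>"
        then have "x \<in> ?C"
          using that by (intro UN_I[of "t *\<^sub>R axis 1 1"] UN_I[of "x - t *\<^sub>R axis 1 1"]) auto
        with x show False by blast
      qed
      have "x \<in> \<Omega>" using inside[of 0] False by simp
      then have "c < exit_time x"
        using exit_time(1,3)[of x] inside[of "exit_time x"] by (force simp: exit_point_def)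
      then show "x \<in> {w \<in> space borel. c < exit_time w}" by simp
    qed
    moreover have "open (- ?C)"
      using open\<Omega>
      by (intro open_Compl compact_closed_sums compact_continuous_image continuous_intros) auto
    ultimately show ?thesis by (simp only: borel_open)
  qed
qed

lemma exit_point_measurable [measurable]: "exit_point \<in> borel_measurable borel"
  unfolding exit_point_def by measurable

text \<open>The points that exit through \<open>A\<close> lie in the strip over the projection of \<open>A\<close>. Hence the distribution of
  the exit point is dominated by \<open>2 R\<close> times the Hausdorff measure on the frontier.\<close>
lemma nn_integral_exit_point_le:
  assumes [measurable]: "F \<in> borel_measurable borel"
  shows "(\<integral>\<^sup>+x. F (exit_point x) * indicator \<Omega> x \<partial>lborel)
    \<le> ennreal (2 * R) * (\<integral>\<^sup>+x. F x * indicator (frontier \<Omega>) x \<partial>hausdorff1)"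
proof -
  have [measurable]: "\<Omega> \<in> sets borel" "frontier \<Omega> \<in> sets borel" using open\<Omega> by auto
  let ?M = "distr (density lborel (indicator \<Omega>)) hausdorff1 exit_point"
  let ?N = "density hausdorff1 (\<lambda>x. ennreal (2 * R) * indicator (frontier \<Omega>) x)"
  have "?M \<le> ?N"
  proof (subst le_measure, simp, intro ballI)
    fix A assume "A \<in> sets ?M"
    then have [measurable]: "A \<in> sets borel" by simp
    let ?S = "{x \<in> \<Omega>. exit_point x \<in> A}"
    have S: "?S \<in> sets borel" by measurable
    have "emeasure ?M A = emeasure lborel ?S"
    proof (subst emeasure_distr)
      have V: "exit_point -` A \<in> sets borel"
        using measurable_sets[OF exit_point_measurable, of A] by simp
      have "(\<lambda>x. indicator \<Omega> x * indicator (exit_point -` A) x) = (indicator ?S :: _ \<Rightarrow> ennreal)"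
        by (auto simp: fun_eq_iff indicator_def)
      then have "emeasure (density lborel (indicator \<Omega>)) (exit_point -` A \<inter> space (density lborel (indicator \<Omega>)))
          = (\<integral>\<^sup>+x. indicator ?S x \<partial>lborel)"
        using V by (simp add: emeasure_density del: nn_integral_indicator)
      then show "emeasure (density lborel (indicator \<Omega>)) (exit_point -` A \<inter> space (density lborel (indicator \<Omega>)))
          = emeasure lborel ?S" using S by simp
    qed auto
    also have "\<dots> \<le> ennreal (2 * R) * hausdorff1_outer (A \<inter> frontier \<Omega>)"
    proof (rule emeasure_strip_le_hausdorff1[OF R])
      fix x assume x: "x \<in> ?S"
      have "\<bar>x $ 1\<bar> \<le> R" using component_le_norm_cart[of x 1] sub x by force
      moreover have "exit_point x $ 2 = x $ 2" by (simp add: exit_point_def axis_def)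
      ultimately show "\<bar>x $ 1\<bar> \<le> R \<and> (\<exists>y\<in>A \<inter> frontier \<Omega>. y $ 2 = x $ 2)"
        using x exit_point_frontier[of x] by blast
    qed
    also have "\<dots> = ennreal (2 * R) * emeasure hausdorff1 (A \<inter> frontier \<Omega>)"
      by (simp add: emeasure_hausdorff1)
    also have "\<dots> = emeasure ?N A"
      by (subst emeasure_density)
        (auto simp: mult.assoc nn_integral_cmult indicator_inter_arith[symmetric] Int_commute)
    finally show "emeasure ?M A \<le> emeasure ?N A" .
  qed
  then have "(\<integral>\<^sup>+x. F x \<partial>?M) \<le> (\<integral>\<^sup>+x. F x \<partial>?N)"
    by (intro nn_integral_mono_measure) simp_all
  also have "(\<integral>\<^sup>+x. F x \<partial>?M) = (\<integral>\<^sup>+x. F (exit_point x) * indicator \<Omega> x \<partial>lborel)"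
    by (subst nn_integral_distr) (auto simp: nn_integral_density mult.commute)
  also have "(\<integral>\<^sup>+x. F x \<partial>?N) = ennreal (2 * R) * (\<integral>\<^sup>+x. F x * indicator (frontier \<Omega>) x \<partial>hausdorff1)"
    by (subst nn_integral_density) (auto simp: mult_ac nn_integral_cmult[symmetric])
  finally show ?thesis .
qed

text \<open>The integral over \<open>x\<close> does not depend on the translation by \<open>t e\<^sub>1\<close>, so the integral over \<open>t\<close> contributes
  the length \<open>2 R\<close>.\<close>
lemma nn_integral_translates:
  assumes [measurable]: "q \<in> borel_measurable borel"
  shows "(\<integral>\<^sup>+x. \<integral>\<^sup>+t. indicator {0..2 * R} t * q (x - t *\<^sub>R axis 1 1 :: R2) \<partial>lborel \<partial>lborel)
    = ennreal (2 * R) * (\<integral>\<^sup>+x. q x \<partial>lborel)"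
proof -
  have "(\<integral>\<^sup>+x. \<integral>\<^sup>+t. indicator {0..2 * R} t * q (x - t *\<^sub>R axis 1 1) \<partial>lborel \<partial>lborel)
      = (\<integral>\<^sup>+t. \<integral>\<^sup>+x. indicator {0..2 * R} t * q (x - t *\<^sub>R axis 1 1) \<partial>lborel \<partial>lborel)"
    by (rule lborel_pair.Fubini'[where f = "\<lambda>t x. indicator {0..2 * R} t * q (x - t *\<^sub>R axis 1 1)"]) measurable
  also have "\<dots> = (\<integral>\<^sup>+t. indicator {0..2 * R} t * (\<integral>\<^sup>+x. q x \<partial>lborel) \<partial>lborel)"
  proof (intro nn_integral_cong)
    fix t :: real
    have "(\<integral>\<^sup>+x. q x \<partial>lborel) = (\<integral>\<^sup>+x. q x \<partial>distr lborel borel ((+) (- t *\<^sub>R axis 1 1)))"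
      by (subst lborel_distr_plus) simp
    also have "\<dots> = (\<integral>\<^sup>+x. q (x - t *\<^sub>R axis 1 1) \<partial>lborel)"
      by (subst nn_integral_distr) (auto simp: algebra_simps)
    finally show "(\<integral>\<^sup>+x. indicator {0..2 * R} t * q (x - t *\<^sub>R axis 1 1) \<partial>lborel)
        = indicator {0..2 * R} t * (\<integral>\<^sup>+x. q x \<partial>lborel)"
      by (subst nn_integral_cmult) auto
  qed
  also have "\<dots> = ennreal (2 * R) * (\<integral>\<^sup>+x. q x \<partial>lborel)"
    using R by (subst nn_integral_multc) auto
  finally show ?thesis .
qed

text \<open>The fundamental theorem of calculus for \<open>f\<^sup>2\<close> on the segment from the exit point to \<open>x\<close>. Splitting
  \<open>2 f \<partial>\<^sub>1f\<close> with weight \<open>\<epsilon>\<close> allows the part with \<open>f\<^sup>2\<close> to be made small.\<close>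
lemma square_le_exit_point:
  assumes f: "smooth f" and x: "x \<in> \<Omega>" and \<epsilon>: "0 < \<epsilon>"
  defines "q \<equiv> \<lambda>y. ennreal (\<epsilon> * (f y)\<^sup>2 + 1 / \<epsilon> * (norm (grad_classical f y))\<^sup>2) * indicator \<Omega> y"
  shows "ennreal ((f x)\<^sup>2) \<le> ennreal ((f (exit_point x))\<^sup>2)
    + (\<integral>\<^sup>+t. indicator {0..2 * R} t * q (x - t *\<^sub>R axis 1 1) \<partial>lborel)"
proof -
  let ?s = "exit_time x" and ?y = "\<lambda>t. x - t *\<^sub>R axis 1 1 :: R2"
  define Q where "Q y = \<epsilon> * (f y)\<^sup>2 + 1 / \<epsilon> * (norm (grad_classical f y))\<^sup>2" for y
  have s: "0 < ?s" "?s \<le> 2 * R" using exit_time[OF x] by auto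
  have contQ: "continuous_on UNIV Q"
    unfolding Q_def using \<epsilon> by (intro continuous_intros smooth_continuous smooth_continuous_grad f) auto
  have contQy: "continuous_on A (\<lambda>t. Q (?y t))" for A
    by (rule continuous_on_compose2[OF contQ]) (auto intro!: continuous_intros)
  have Q0: "0 \<le> Q y" for y using \<epsilon> by (simp add: Q_def)
  let ?h = "\<lambda>t. 2 * f (?y t) * (- grad_classical f (?y t) $ 1)"
  have der: "((\<lambda>t. (f (?y t))\<^sup>2) has_real_derivative ?h t) (at t)" for t
  proof -
    have "(?y has_derivative (\<lambda>u. - u *\<^sub>R axis 1 1)) (at t)"
      by (auto intro!: derivative_eq_intros)
    from has_derivative_compose[OF this has_derivative_grad_classical[OF smooth_differentiable[OF f]]]
    have "((\<lambda>t. f (?y t)) has_derivative (\<lambda>u. frechet_derivative f (at (?y t)) (- u *\<^sub>R axis 1 1))) (at t)" .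
    moreover have "frechet_derivative f (at (?y t)) (- u *\<^sub>R axis 1 1) = - grad_classical f (?y t) $ 1 * u" for u
      using linear_scale[OF has_derivative_linear[OF has_derivative_grad_classical[OF smooth_differentiable[OF f], of "?y t"]], of "- u"]
      by (simp add: grad_classical_def)
    ultimately have "((\<lambda>t. f (?y t)) has_real_derivative - grad_classical f (?y t) $ 1) (at t)"
      by (simp only: has_field_derivative_def)
    then show ?thesis by (auto intro!: derivative_eq_intros)
  qed
  have "(?h has_integral (f (?y ?s))\<^sup>2 - (f (?y 0))\<^sup>2) {0..?s}"
    using s der by (intro fundamental_theorem_of_calculus)
      (auto simp: has_real_derivative_iff_has_vector_derivative[symmetric] intro: has_field_derivative_at_within)
  then have 1: "((\<lambda>t. - ?h t) has_integral (f x)\<^sup>2 - (f (exit_point x))\<^sup>2) {0..?s}"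
    by (drule_tac has_integral_neg) (simp add: exit_point_def)
  have intQ: "(\<lambda>t. Q (?y t)) integrable_on {0..?s}"
    by (intro integrable_continuous_interval contQy)
  then have 2: "((\<lambda>t. Q (?y t)) has_integral integral {0..?s} (\<lambda>t. Q (?y t))) {0..?s}" by blast
  have "(f x)\<^sup>2 - (f (exit_point x))\<^sup>2 \<le> integral {0..?s} (\<lambda>t. Q (?y t))"
  proof (rule has_integral_le[OF 1 2])
    fix t
    let ?a = "f (?y t)" and ?b = "grad_classical f (?y t) $ 1"
    have "2 * (sqrt \<epsilon> * ?a) * (?b / sqrt \<epsilon>) \<le> (sqrt \<epsilon> * ?a)\<^sup>2 + (?b / sqrt \<epsilon>)\<^sup>2"
      by (rule sum_squares_bound)
    then have "2 * ?a * ?b \<le> \<epsilon> * ?a\<^sup>2 + ?b\<^sup>2 / \<epsilon>"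
      using \<epsilon> by (simp add: power_mult_distrib power_divide)
    also have "?b\<^sup>2 / \<epsilon> \<le> (norm (grad_classical f (?y t)))\<^sup>2 / \<epsilon>"
      using \<epsilon> component_le_norm_cart[of "grad_classical f (?y t)" 1]
      by (intro divide_right_mono) (auto simp: abs_le_square_iff[symmetric])
    finally show "- ?h t \<le> Q (?y t)" by (simp add: Q_def)
  qed
  then have "ennreal ((f x)\<^sup>2) \<le> ennreal ((f (exit_point x))\<^sup>2 + integral {0..?s} (\<lambda>t. Q (?y t)))"
    by (intro ennreal_leI) simp
  also have "\<dots> = ennreal ((f (exit_point x))\<^sup>2) + ennreal (integral {0..?s} (\<lambda>t. Q (?y t)))"
    using Q0 by (intro ennreal_plus integral_nonneg intQ) auto
  also have "ennreal (integral {0..?s} (\<lambda>t. Q (?y t))) = (\<integral>\<^sup>+t. ennreal (indicator {0..?s} t * Q (?y t)) \<partial>lborel)"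
  proof (rule nn_integral_has_integral_lborel[symmetric])
    show "(\<lambda>t. indicator {0..?s} t * Q (?y t)) \<in> borel_measurable borel"
      by (intro borel_measurable_times borel_measurable_indicator borel_measurable_continuous_onI contQy) auto
    show "((\<lambda>t. indicator {0..?s} t * Q (?y t)) has_integral integral {0..?s} (\<lambda>t. Q (?y t))) UNIV"
    proof -
      have "(\<lambda>t. indicator {0..?s} t * Q (?y t)) = (\<lambda>t. if t \<in> {0..?s} then Q (?y t) else 0)"
        by (auto simp: fun_eq_iff)
      then show ?thesis using 2 by (simp only: has_integral_restrict_UNIV)
    qed
  qed (use Q0 in auto)
  also have "\<dots> \<le> (\<integral>\<^sup>+t. indicator {0..2 * R} t * q (?y t) \<partial>lborel)"
  proof (rule nn_integral_mono_AE)
    \<comment> \<open>The exit point itself is outside \<open>\<Omega>\<close>, where \<open>q\<close> vanishes.\<close>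
    have "AE t in lborel. t \<noteq> ?s" by (rule AE_lborel_singleton)
    then show "AE t in lborel. ennreal (indicator {0..?s} t * Q (?y t)) \<le> indicator {0..2 * R} t * q (?y t)"
    proof eventually_elim
      case (elim t)
      show ?case
      proof (cases "t \<in> {0..?s}")
        case True
        then have "?y t \<in> \<Omega>" using elim by (intro exit_time(4)[OF x]) auto
        then show ?thesis using True s by (simp add: q_def Q_def)
      qed simp
    qed
  qed
  finally show ?thesis by (simp add: add_left_mono)
qed

lemma finite_measure_domain: "finite_measure (lebesgue_on \<Omega>)"
  using open\<Omega> bounded_subset[OF bounded_ball sub]
  by (intro finite_measure_lebesgue_on lmeasurable_open)

lemma smooth_bounded:
  assumes "smooth f"
  obtains B where "\<And>x. x \<in> closure \<Omega> \<Longrightarrow> \<bar>f x\<bar> \<le> B" "\<And>x. x \<in> closure \<Omega> \<Longrightarrow> norm (grad_classical f x) \<le> B"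
proof -
  have c: "compact (closure \<Omega>)" using bounded_subset[OF bounded_ball sub] by (simp add: compact_closure)
  have "bounded (f ` closure \<Omega>)" "bounded (grad_classical f ` closure \<Omega>)"
    using smooth_continuous[OF assms] smooth_continuous_grad[OF assms] c
    by (auto intro!: compact_imp_bounded compact_continuous_image intro: continuous_on_subset)
  then obtain b1 b2 where "\<forall>x\<in>closure \<Omega>. \<bar>f x\<bar> \<le> b1" "\<forall>x\<in>closure \<Omega>. norm (grad_classical f x) \<le> b2"
    unfolding bounded_iff by auto
  then show thesis by (intro that[of "max b1 b2"]) (auto simp: le_max_iff_disj)
qed

lemma L2_smooth: "smooth f \<Longrightarrow> L2 (lebesgue_on \<Omega>) f"
  and L2_smooth_grad: "smooth f \<Longrightarrow> L2 (lebesgue_on \<Omega>) (grad_classical f)"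
proof -
  assume f: "smooth f"
  obtain B where B: "\<And>x. x \<in> closure \<Omega> \<Longrightarrow> \<bar>f x\<bar> \<le> B" "\<And>x. x \<in> closure \<Omega> \<Longrightarrow> norm (grad_classical f x) \<le> B"
    using smooth_bounded[OF f] by blast
  have "x \<in> closure \<Omega>" if "x \<in> space (lebesgue_on \<Omega>)" for x
    using that closure_subset[of \<Omega>] by auto
  then show "L2 (lebesgue_on \<Omega>) f" "L2 (lebesgue_on \<Omega>) (grad_classical f)"
    by (intro L2_bounded[where B=B] finite_measure_domain smooth_measurable smooth_grad_measurable f; simp add: B)+
qed

end

lemma borel_measurable_boundary_measure:
  "f \<in> borel_measurable borel \<Longrightarrow> f \<in> borel_measurable (boundary_measure \<Omega>)"
  unfolding boundary_measure_def
  by (intro measurable_completion measurable_restrict_space1) simp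

lemma space_boundary_measure [simp]: "space (boundary_measure \<Omega>) = frontier \<Omega>"
  by (simp add: boundary_measure_def space_restrict_space)

lemma nn_integral_boundary_measure:
  "(\<integral>\<^sup>+x. F x \<partial>boundary_measure \<Omega>) = (\<integral>\<^sup>+x. F x * indicator (frontier \<Omega>) x \<partial>hausdorff1)"
  unfolding boundary_measure_def nn_integral_completion
  by (rule nn_integral_restrict_space) simp

lemma nn_integral_lebesgue_on:
  "\<Omega> \<in> sets lebesgue \<Longrightarrow> (\<integral>\<^sup>+x. F x \<partial>lebesgue_on \<Omega>) = (\<integral>\<^sup>+x. F x * indicator \<Omega> x \<partial>lborel)"
  by (simp add: nn_integral_restrict_space nn_integral_completion)

text \<open>With a boundary of infinite length, the integrals over the boundary that define traces could take the
  default value 0 for functions that are not square integrable there.\<close>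
locale finite_perimeter_domain = bounded_open_set +
  assumes finite_boundary: "emeasure hausdorff1 (frontier \<Omega>) < \<infinity>"
begin

lemma finite_measure_boundary: "finite_measure (boundary_measure \<Omega>)"
proof (rule finite_measureI)
  have "emeasure (boundary_measure \<Omega>) (frontier \<Omega>) = (\<integral>\<^sup>+x. 1 \<partial>boundary_measure \<Omega>)"
    by (simp flip: space_boundary_measure)
  also have "\<dots> = emeasure hausdorff1 (frontier \<Omega>)"
    unfolding nn_integral_boundary_measure by simp
  finally show "emeasure (boundary_measure \<Omega>) (space (boundary_measure \<Omega>)) \<noteq> \<infinity>"
    using finite_boundary by simp
qed

lemma L2_smooth_boundary: "smooth f \<Longrightarrow> L2 (boundary_measure \<Omega>) f"
proof -
  assume f: "smooth f"
  obtain B where B: "\<And>x. x \<in> closure \<Omega> \<Longrightarrow> \<bar>f x\<bar> \<le> B"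
    using smooth_bounded[OF f] by blast
  show ?thesis
    by (intro L2_bounded[where B=B] finite_measure_boundary borel_measurable_boundary_measure
        borel_measurable_continuous_onI smooth_continuous f) (simp add: B frontier_def)
qed

text \<open>Integrating \<open>square_le_exit_point\<close> over \<open>\<Omega>\<close> leaves the integral of \<open>f\<^sup>2\<close> on the right with a factor
  \<open>2 R \<epsilon>\<close>. For \<open>\<epsilon> = 1 / (4 R)\<close> this is half of the left hand side, which is finite, and can be absorbed.\<close>
theorem friedrichs_smooth:
  assumes f: "smooth f"
  shows "(L2_norm (lebesgue_on \<Omega>) f)\<^sup>2 \<le> 4 * R * (L2_norm (boundary_measure \<Omega>) f)\<^sup>2
    + 16 * R\<^sup>2 * (L2_norm (lebesgue_on \<Omega>) (grad_classical f))\<^sup>2"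
proof -
  let ?A = "(L2_norm (lebesgue_on \<Omega>) f)\<^sup>2" and ?B = "(L2_norm (boundary_measure \<Omega>) f)\<^sup>2"
    and ?D = "(L2_norm (lebesgue_on \<Omega>) (grad_classical f))\<^sup>2"
  have [measurable]: "f \<in> borel_measurable borel" "grad_classical f \<in> borel_measurable borel"
    using smooth_continuous[OF f] smooth_continuous_grad[OF f] by (auto intro: borel_measurable_continuous_onI)
  have [measurable]: "\<Omega> \<in> sets borel" using open\<Omega> by auto
  have \<Omega>: "\<Omega> \<in> sets lebesgue" using open\<Omega> by auto
  define \<epsilon> where "\<epsilon> = 1 / (4 * R)"
  have \<epsilon>: "0 < \<epsilon>" using R by (simp add: \<epsilon>_def)
  define q where "q y = ennreal (\<epsilon> * (f y)\<^sup>2 + 1 / \<epsilon> * (norm (grad_classical f y))\<^sup>2) * indicator \<Omega> y" for y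
  have [measurable]: "q \<in> borel_measurable borel" unfolding q_def by measurable
  have A: "(\<integral>\<^sup>+x. ennreal ((f x)\<^sup>2) * indicator \<Omega> x \<partial>lborel) = ennreal ?A"
    using nn_integral_L2[OF L2_smooth[OF f]] by (simp add: nn_integral_lebesgue_on[OF \<Omega>])
  have D: "(\<integral>\<^sup>+x. ennreal ((norm (grad_classical f x))\<^sup>2) * indicator \<Omega> x \<partial>lborel) = ennreal ?D"
    using nn_integral_L2[OF L2_smooth_grad[OF f]] by (simp add: nn_integral_lebesgue_on[OF \<Omega>])
  have B: "(\<integral>\<^sup>+x. ennreal ((f x)\<^sup>2) * indicator (frontier \<Omega>) x \<partial>hausdorff1) = ennreal ?B"
    using nn_integral_L2[OF L2_smooth_boundary[OF f]] by (simp add: nn_integral_boundary_measure)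
  have q: "(\<integral>\<^sup>+y. q y \<partial>lborel) = ennreal (\<epsilon> * ?A + 1 / \<epsilon> * ?D)"
  proof -
    have "(\<integral>\<^sup>+y. q y \<partial>lborel) = (\<integral>\<^sup>+y. ennreal \<epsilon> * (ennreal ((f y)\<^sup>2) * indicator \<Omega> y)
        + ennreal (1 / \<epsilon>) * (ennreal ((norm (grad_classical f y))\<^sup>2) * indicator \<Omega> y) \<partial>lborel)"
      using \<epsilon> by (intro nn_integral_cong)
        (simp add: q_def ennreal_plus[symmetric] ennreal_mult'[symmetric] indicator_def del: ennreal_plus)
    also have "\<dots> = ennreal \<epsilon> * ennreal ?A + ennreal (1 / \<epsilon>) * ennreal ?D"
      by (simp add: nn_integral_add nn_integral_cmult A D)
    finally show ?thesis using \<epsilon> by (simp add: ennreal_mult'[symmetric])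
  qed
  have "ennreal ?A \<le> (\<integral>\<^sup>+x. (ennreal ((f (exit_point x))\<^sup>2) * indicator \<Omega> x)
      + (\<integral>\<^sup>+t. indicator {0..2 * R} t * q (x - t *\<^sub>R axis 1 1) \<partial>lborel) \<partial>lborel)"
    unfolding A[symmetric]
  proof (intro nn_integral_mono)
    fix x
    show "ennreal ((f x)\<^sup>2) * indicator \<Omega> x \<le> ennreal ((f (exit_point x))\<^sup>2) * indicator \<Omega> x
      + (\<integral>\<^sup>+t. indicator {0..2 * R} t * q (x - t *\<^sub>R axis 1 1) \<partial>lborel)"
      using square_le_exit_point[OF f _ \<epsilon>, of x] unfolding q_def by (cases "x \<in> \<Omega>") simp_all
  qed
  also have "\<dots> = (\<integral>\<^sup>+x. ennreal ((f (exit_point x))\<^sup>2) * indicator \<Omega> x \<partial>lborel)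
      + ennreal (2 * R) * ennreal (\<epsilon> * ?A + 1 / \<epsilon> * ?D)"
    unfolding q[symmetric] nn_integral_translates[OF \<open>q \<in> _\<close>, symmetric]
    by (rule nn_integral_add) measurable
  also have "(\<integral>\<^sup>+x. ennreal ((f (exit_point x))\<^sup>2) * indicator \<Omega> x \<partial>lborel) \<le> ennreal (2 * R) * ennreal ?B"
    unfolding B[symmetric] by (rule nn_integral_exit_point_le) measurable
  finally have "ennreal ?A \<le> ennreal (2 * R) * ennreal ?B + ennreal (2 * R) * ennreal (\<epsilon> * ?A + 1 / \<epsilon> * ?D)"
    by (simp add: add_right_mono)
  also have "\<dots> = ennreal (2 * R * ?B + 2 * R * (\<epsilon> * ?A + 1 / \<epsilon> * ?D))"
    using R \<epsilon> by (simp add: ennreal_mult'[symmetric] ennreal_plus[symmetric] del: ennreal_plus)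
  finally have "?A \<le> 2 * R * ?B + 2 * R * (\<epsilon> * ?A + 1 / \<epsilon> * ?D)"
    using R \<epsilon> by (subst (asm) ennreal_le_iff) auto
  also have "2 * R * (\<epsilon> * ?A + 1 / \<epsilon> * ?D) = ?A / 2 + 8 * R\<^sup>2 * ?D"
    using R by (simp add: \<epsilon>_def field_simps power2_eq_square)
  finally show ?thesis by simp
qed

end

section \<open>Weak gradients and traces\<close>

lemma H1_grad:
  assumes "H1 \<Omega> u"
  shows "L2 (lebesgue_on \<Omega>) (grad \<Omega> u)" "weak_gradient \<Omega> u (grad \<Omega> u)"
proof -
  have "\<exists>v. L2 (lebesgue_on \<Omega>) v \<and> weak_gradient \<Omega> u v" using assms by (simp add: H1_def)
  from someI_ex[OF this] show "L2 (lebesgue_on \<Omega>) (grad \<Omega> u)" "weak_gradient \<Omega> u (grad \<Omega> u)"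
    unfolding grad_def by blast+
qed

lemma has_trace_H1: "has_trace \<Omega> u g \<Longrightarrow> H1 \<Omega> u"
  and has_trace_L2: "has_trace \<Omega> u g \<Longrightarrow> L2 (lebesgue_on \<Omega>) u"
  and has_trace_L2_grad: "has_trace \<Omega> u g \<Longrightarrow> L2 (lebesgue_on \<Omega>) (grad \<Omega> u)"
  and has_trace_L2_boundary: "has_trace \<Omega> u g \<Longrightarrow> L2 (boundary_measure \<Omega>) g"
  by (auto simp: has_trace_def H1_grad) (simp add: H1_def)

text \<open>With norms instead of integrals of squares the triangle inequality applies directly.\<close>
lemma has_trace_iff:
  "has_trace \<Omega> u g \<longleftrightarrow> H1 \<Omega> u \<and> L2 (boundary_measure \<Omega>) g \<and>
    (\<exists>f. (\<forall>n. smooth (f n)) \<and>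
      (\<lambda>n. L2_norm (lebesgue_on \<Omega>) (\<lambda>x. f n x - u x)) \<longlonglongrightarrow> 0 \<and>
      (\<lambda>n. L2_norm (lebesgue_on \<Omega>) (\<lambda>x. grad_classical (f n) x - grad \<Omega> u x)) \<longlonglongrightarrow> 0 \<and>
      (\<lambda>n. L2_norm (boundary_measure \<Omega>) (\<lambda>x. f n x - g x)) \<longlonglongrightarrow> 0)"
proof -
  have sq: "(\<lambda>n. L2_norm M (h n)) \<longlonglongrightarrow> 0 \<longleftrightarrow> (\<lambda>n. LINT x|M. (norm (h n x))\<^sup>2) \<longlonglongrightarrow> 0"
    for M :: "R2 measure" and h :: "nat \<Rightarrow> R2 \<Rightarrow> 'b::euclidean_space"
  proof
    assume "(\<lambda>n. L2_norm M (h n)) \<longlonglongrightarrow> 0"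
    from tendsto_power[OF this, of 2] show "(\<lambda>n. LINT x|M. (norm (h n x))\<^sup>2) \<longlonglongrightarrow> 0"
      by (simp add: L2_norm_power2)
  next
    assume "(\<lambda>n. LINT x|M. (norm (h n x))\<^sup>2) \<longlonglongrightarrow> 0"
    from tendsto_real_sqrt[OF this] show "(\<lambda>n. L2_norm M (h n)) \<longlonglongrightarrow> 0"
      by (simp add: L2_norm_def)
  qed
  have add: "(\<lambda>n. a n + b n) \<longlonglongrightarrow> 0 \<longleftrightarrow> a \<longlonglongrightarrow> 0 \<and> b \<longlonglongrightarrow> 0"
    if "\<And>n. 0 \<le> a n" "\<And>n. 0 \<le> b n" for a b :: "nat \<Rightarrow> real"
  proof
    assume *: "(\<lambda>n. a n + b n) \<longlonglongrightarrow> 0"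
    show "a \<longlonglongrightarrow> 0 \<and> b \<longlonglongrightarrow> 0"
      using that by (auto intro!: tendsto_sandwich[OF _ _ tendsto_const *])
  qed (use tendsto_add in force)
  show ?thesis
    unfolding has_trace_def sq by (subst add) (simp_all add: conj_assoc)
qed

context finite_perimeter_domain
begin

abbreviation "\<mu> \<equiv> lebesgue_on \<Omega>"
abbreviation "\<beta> \<equiv> boundary_measure \<Omega>"

lemma L2_test_function:
  assumes "test_function \<Omega> f"
  shows "L2 \<mu> f" "L2 \<mu> (\<lambda>x. grad_classical f x $ k)"
  using assms by (auto simp: test_function_def intro: L2_smooth L2_component(1) L2_smooth_grad)

text \<open>The reason why statements about \<^const>\<open>grad\<close> can be proved for any convenient weak gradient.\<close>
lemma weak_gradient_unique:
  assumes v: "L2 \<mu> v" "weak_gradient \<Omega> u v" and w: "L2 \<mu> w" "weak_gradient \<Omega> u w"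
  shows "AE x in \<mu>. v x = w x"
proof -
  interpret finite_measure \<mu> by (rule finite_measure_domain)
  have "AE x in \<mu>. v x $ k - w x $ k = 0" for k
  proof (rule fundamental_lemma_calculus_of_variations[OF open\<Omega>])
    note L2 = L2_component(1)[OF v(1), of k] L2_component(1)[OF w(1), of k]
    show "integrable \<mu> (\<lambda>x. v x $ k - w x $ k)"
      by (intro L2_imp_integrable L2_diff L2)
    fix f assume f: "test_function \<Omega> f"
    have "(LINT x|\<mu>. v x $ k * f x) = (LINT x|\<mu>. w x $ k * f x)"
      using v(2)[unfolded weak_gradient_def, rule_format, OF f, of k]
        w(2)[unfolded weak_gradient_def, rule_format, OF f, of k] by linarith
    then show "(LINT x|\<mu>. (v x $ k - w x $ k) * f x) = 0"
      using L2_mult_integrable[OF L2(1) L2_test_function(1)[OF f]]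
        L2_mult_integrable[OF L2(2) L2_test_function(1)[OF f]]
      by (simp add: left_diff_distrib)
  qed
  then have "AE x in \<mu>. \<forall>k. v x $ k - w x $ k = 0" by (simp add: AE_all_countable)
  then show ?thesis by eventually_elim (simp add: vec_eq_iff)
qed

lemma grad_eq_AE:
  assumes "L2 \<mu> u" "L2 \<mu> v" "weak_gradient \<Omega> u v"
  shows "H1 \<Omega> u" "AE x in \<mu>. grad \<Omega> u x = v x"
proof -
  show "H1 \<Omega> u" using assms by (auto simp: H1_def)
  from weak_gradient_unique[OF H1_grad[OF this] assms(2,3)]
  show "AE x in \<mu>. grad \<Omega> u x = v x" .
qed

lemma weak_gradient_linear:
  assumes "L2 \<mu> u" "L2 \<mu> v" "weak_gradient \<Omega> u v" "L2 \<mu> u'" "L2 \<mu> v'" "weak_gradient \<Omega> u' v'"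
  shows "weak_gradient \<Omega> (\<lambda>x. s * u x + t * u' x) (\<lambda>x. s *\<^sub>R v x + t *\<^sub>R v' x)"
  unfolding weak_gradient_def
proof (intro allI impI)
  fix f k assume f: "test_function \<Omega> f"
  note test = L2_test_function[OF f]
  note int = L2_mult_integrable[OF assms(1) test(2)] L2_mult_integrable[OF assms(4) test(2)]
    L2_mult_integrable[OF L2_component(1)[OF assms(2)] test(1)]
    L2_mult_integrable[OF L2_component(1)[OF assms(5)] test(1)]
  have "(LINT x|\<mu>. (s * u x + t * u' x) * grad_classical f x $ k)
      = s * (LINT x|\<mu>. u x * grad_classical f x $ k) + t * (LINT x|\<mu>. u' x * grad_classical f x $ k)"
    using int by (simp add: algebra_simps)
  also have "\<dots> = - (s * (LINT x|\<mu>. v x $ k * f x) + t * (LINT x|\<mu>. v' x $ k * f x))"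
    using assms(3,6) f by (simp add: weak_gradient_def)
  also have "\<dots> = - (LINT x|\<mu>. (s *\<^sub>R v x + t *\<^sub>R v' x) $ k * f x)"
    using int by (simp add: algebra_simps)
  finally show "(LINT x|\<mu>. (s * u x + t * u' x) * grad_classical f x $ k)
      = - (LINT x|\<mu>. (s *\<^sub>R v x + t *\<^sub>R v' x) $ k * f x)" .
qed

lemma weak_gradient_limit:
  assumes u: "\<And>n. L2 \<mu> (u n)" "L2 \<mu> U" "(\<lambda>n. L2_norm \<mu> (\<lambda>x. u n x - U x)) \<longlonglongrightarrow> 0"
    and v: "\<And>n. L2 \<mu> (v n)" "L2 \<mu> V" "(\<lambda>n. L2_norm \<mu> (\<lambda>x. v n x - V x)) \<longlonglongrightarrow> 0"
    and weak: "\<And>n. weak_gradient \<Omega> (u n) (v n)"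
  shows "weak_gradient \<Omega> U V"
  unfolding weak_gradient_def
proof (intro allI impI)
  fix f k assume f: "test_function \<Omega> f"
  note test = L2_test_function[OF f]
  have "(\<lambda>n. L2_norm \<mu> (\<lambda>x. v n x $ k - V x $ k)) \<longlonglongrightarrow> 0"
  proof (rule tendsto_sandwich[OF _ _ tendsto_const v(3)])
    show "\<forall>\<^sub>F n in sequentially. L2_norm \<mu> (\<lambda>x. v n x $ k - V x $ k) \<le> L2_norm \<mu> (\<lambda>x. v n x - V x)"
      using L2_component(2)[OF L2_diff[OF v(1) v(2)]] by simp
  qed simp
  from L2_inner_tendsto[OF L2_component(1)[OF v(1)] L2_component(1)[OF v(2)] test(1) this]
  have R: "(\<lambda>n. LINT x|\<mu>. v n x $ k * f x) \<longlonglongrightarrow> (LINT x|\<mu>. V x $ k * f x)" by simp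
  from L2_inner_tendsto[OF u(1,2) test(2) u(3)]
  have L: "(\<lambda>n. LINT x|\<mu>. u n x * grad_classical f x $ k) \<longlonglongrightarrow> (LINT x|\<mu>. U x * grad_classical f x $ k)" for k by simp
  have "(LINT x|\<mu>. u n x * grad_classical f x $ k) = - (LINT x|\<mu>. v n x $ k * f x)" for n
    using weak f by (simp add: weak_gradient_def)
  with L[of k] have "(\<lambda>n. - (LINT x|\<mu>. v n x $ k * f x)) \<longlonglongrightarrow> (LINT x|\<mu>. U x * grad_classical f x $ k)" by simp
  from LIMSEQ_unique[OF this tendsto_minus[OF R]]
  show "(LINT x|\<mu>. U x * grad_classical f x $ k) = - (LINT x|\<mu>. V x $ k * f x)" .
qed

lemma has_trace_linear:
  assumes u: "has_trace \<Omega> u g" and w: "has_trace \<Omega> w h"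
  shows "has_trace \<Omega> (\<lambda>x. s * u x + t * w x) (\<lambda>x. s * g x + t * h x)"
    "AE x in \<mu>. grad \<Omega> (\<lambda>x. s * u x + t * w x) x = s *\<^sub>R grad \<Omega> u x + t *\<^sub>R grad \<Omega> w x"
proof -
  let ?z = "\<lambda>x. s * u x + t * w x" and ?G = "\<lambda>x. s *\<^sub>R grad \<Omega> u x + t *\<^sub>R grad \<Omega> w x"
  note L2u = has_trace_L2[OF u] has_trace_L2_grad[OF u] has_trace_L2_boundary[OF u]
  note L2w = has_trace_L2[OF w] has_trace_L2_grad[OF w] has_trace_L2_boundary[OF w]
  have z: "L2 \<mu> ?z" using L2_add[OF L2_scaleR[OF L2u(1), of s] L2_scaleR[OF L2w(1), of t]] by simp
  have G: "L2 \<mu> ?G" by (intro L2_add L2_scaleR L2u L2w)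
  have weak: "weak_gradient \<Omega> ?z ?G"
    by (intro weak_gradient_linear L2u L2w H1_grad has_trace_H1[OF u] has_trace_H1[OF w])
  note grad = grad_eq_AE[OF z G weak]
  then show "AE x in \<mu>. grad \<Omega> ?z x = ?G x" by blast
  obtain f where f: "\<And>n. smooth (f n)" "(\<lambda>n. L2_norm \<mu> (\<lambda>x. f n x - u x)) \<longlonglongrightarrow> 0"
      "(\<lambda>n. L2_norm \<mu> (\<lambda>x. grad_classical (f n) x - grad \<Omega> u x)) \<longlonglongrightarrow> 0"
      "(\<lambda>n. L2_norm \<beta> (\<lambda>x. f n x - g x)) \<longlonglongrightarrow> 0"
    using u unfolding has_trace_iff by blast
  obtain k where k: "\<And>n. smooth (k n)" "(\<lambda>n. L2_norm \<mu> (\<lambda>x. k n x - w x)) \<longlonglongrightarrow> 0"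
      "(\<lambda>n. L2_norm \<mu> (\<lambda>x. grad_classical (k n) x - grad \<Omega> w x)) \<longlonglongrightarrow> 0"
      "(\<lambda>n. L2_norm \<beta> (\<lambda>x. k n x - h x)) \<longlonglongrightarrow> 0"
    using w unfolding has_trace_iff by blast
  let ?f = "\<lambda>n x. s * f n x + t * k n x"
  show "has_trace \<Omega> ?z (\<lambda>x. s * g x + t * h x)"
    unfolding has_trace_iff
  proof (intro conjI exI[of _ ?f] allI)
    show "L2 \<beta> (\<lambda>x. s * g x + t * h x)"
      using L2_add[OF L2_scaleR[OF L2u(3), of s] L2_scaleR[OF L2w(3), of t]] by simp
    show "smooth (?f n)" for n by (intro smooth_add smooth_mult smooth_const f k)
    show "(\<lambda>n. L2_norm \<mu> (\<lambda>x. ?f n x - ?z x)) \<longlonglongrightarrow> 0"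
      using L2_norm_combination_tendsto[OF L2_smooth[OF f(1)] L2u(1) f(2) L2_smooth[OF k(1)] L2w(1) k(2), of s t] by simp
    show "(\<lambda>n. L2_norm \<beta> (\<lambda>x. ?f n x - (s * g x + t * h x))) \<longlonglongrightarrow> 0"
      using L2_norm_combination_tendsto[OF L2_smooth_boundary[OF f(1)] L2u(3) f(4) L2_smooth_boundary[OF k(1)] L2w(3) k(4), of s t] by simp
    have "L2_norm \<mu> (\<lambda>x. grad_classical (?f n) x - grad \<Omega> ?z x)
        = L2_norm \<mu> (\<lambda>x. (s *\<^sub>R grad_classical (f n) x + t *\<^sub>R grad_classical (k n) x) - ?G x)" for n
    proof (rule L2_norm_cong_AE)
      show "AE x in \<mu>. grad_classical (?f n) x - grad \<Omega> ?z x
          = (s *\<^sub>R grad_classical (f n) x + t *\<^sub>R grad_classical (k n) x) - ?G x"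
        using grad(2) by eventually_elim (simp add: grad_classical_linear[OF f(1) k(1)])
    qed (intro L2_borel L2_diff L2_smooth_grad smooth_add smooth_mult smooth_const f k H1_grad grad(1)
        L2_add L2_scaleR L2u L2w)+
    then show "(\<lambda>n. L2_norm \<mu> (\<lambda>x. grad_classical (?f n) x - grad \<Omega> ?z x)) \<longlonglongrightarrow> 0"
      using L2_norm_combination_tendsto[OF L2_smooth_grad[OF f(1)] L2u(2) f(3) L2_smooth_grad[OF k(1)] L2w(2) k(3), of s t] by simp
  qed (rule grad(1))
qed

text \<open>A diagonal argument: for each \<open>n\<close> one smooth function is chosen that is \<open>1 / (n + 1)\<close> close to \<open>u n\<close> in
  the three norms.\<close>
lemma has_trace_closed:
  assumes u: "\<And>n. has_trace \<Omega> (u n) g" and U: "L2 \<mu> U" "(\<lambda>n. L2_norm \<mu> (\<lambda>x. u n x - U x)) \<longlonglongrightarrow> 0"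
    and G: "L2 \<mu> G" "(\<lambda>n. L2_norm \<mu> (\<lambda>x. grad \<Omega> (u n) x - G x)) \<longlonglongrightarrow> 0"
  shows "has_trace \<Omega> U g" "AE x in \<mu>. grad \<Omega> U x = G x"
proof -
  note L2u = has_trace_L2[OF u] has_trace_L2_grad[OF u] has_trace_L2_boundary[OF u]
  have weak: "weak_gradient \<Omega> U G"
    by (rule weak_gradient_limit[OF L2u(1) U L2u(2) G H1_grad(2)[OF has_trace_H1[OF u]]])
  note grad = grad_eq_AE[OF U(1) G(1) weak]
  then show "AE x in \<mu>. grad \<Omega> U x = G x" by blast
  define close where "close n f \<longleftrightarrow> smooth f \<and> L2_norm \<mu> (\<lambda>x. f x - u n x) < 1 / real (Suc n)
      \<and> L2_norm \<mu> (\<lambda>x. grad_classical f x - grad \<Omega> (u n) x) < 1 / real (Suc n)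
      \<and> L2_norm \<beta> (\<lambda>x. f x - g x) < 1 / real (Suc n)" for n f
  have "\<exists>f. close n f" for n
  proof -
    obtain f where f: "\<And>m. smooth (f m)" "(\<lambda>m. L2_norm \<mu> (\<lambda>x. f m x - u n x)) \<longlonglongrightarrow> 0"
      "(\<lambda>m. L2_norm \<mu> (\<lambda>x. grad_classical (f m) x - grad \<Omega> (u n) x)) \<longlonglongrightarrow> 0"
      "(\<lambda>m. L2_norm \<beta> (\<lambda>x. f m x - g x)) \<longlonglongrightarrow> 0"
      using u[of n] unfolding has_trace_iff by blast
    have pos: "0 < 1 / real (Suc n)" by simp
    have "\<forall>\<^sub>F m in sequentially. L2_norm \<mu> (\<lambda>x. f m x - u n x) < 1 / real (Suc n)
      \<and> L2_norm \<mu> (\<lambda>x. grad_classical (f m) x - grad \<Omega> (u n) x) < 1 / real (Suc n)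
      \<and> L2_norm \<beta> (\<lambda>x. f m x - g x) < 1 / real (Suc n)"
      by (intro eventually_conj order_tendstoD(2)[OF f(2) pos] order_tendstoD(2)[OF f(3) pos] order_tendstoD(2)[OF f(4) pos])
    from eventually_happens[OF this] f(1) show ?thesis by (auto simp: close_def)
  qed
  then obtain f where "\<And>n. close n (f n)" by metis
  then have f: "\<And>n. smooth (f n)" "\<And>n. L2_norm \<mu> (\<lambda>x. f n x - u n x) < 1 / real (Suc n)"
      "\<And>n. L2_norm \<mu> (\<lambda>x. grad_classical (f n) x - grad \<Omega> (u n) x) < 1 / real (Suc n)"
      "\<And>n. L2_norm \<beta> (\<lambda>x. f n x - g x) < 1 / real (Suc n)"
    unfolding close_def by blast+
  have inv: "(\<lambda>n. 1 / real (Suc n)) \<longlonglongrightarrow> 0"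
    using LIMSEQ_inverse_real_of_nat by (simp add: inverse_eq_divide)
  have squeeze: "a \<longlonglongrightarrow> 0" if "\<And>n. 0 \<le> a n" "\<And>n. a n \<le> 1 / real (Suc n) + b n" "b \<longlonglongrightarrow> 0" for a b :: "nat \<Rightarrow> real"
  proof (rule tendsto_sandwich[OF _ _ tendsto_const])
    show "(\<lambda>n. 1 / real (Suc n) + b n) \<longlonglongrightarrow> 0" using tendsto_add[OF inv that(3)] by simp
  qed (use that in auto)
  show "has_trace \<Omega> U g"
    unfolding has_trace_iff
  proof (intro conjI exI[of _ f] allI)
    show "(\<lambda>n. L2_norm \<mu> (\<lambda>x. f n x - U x)) \<longlonglongrightarrow> 0"
    proof (rule squeeze[OF _ _ U(2)])
      show "L2_norm \<mu> (\<lambda>x. f n x - U x) \<le> 1 / real (Suc n) + L2_norm \<mu> (\<lambda>x. u n x - U x)" for n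
        using L2_norm_triangle_diff[OF L2_smooth[OF f(1)] L2u(1) U(1), of n n] f(2)[of n] by linarith
    qed simp
    show "(\<lambda>n. L2_norm \<mu> (\<lambda>x. grad_classical (f n) x - grad \<Omega> U x)) \<longlonglongrightarrow> 0"
    proof (rule squeeze[OF _ _ G(2)])
      fix n
      have "L2_norm \<mu> (\<lambda>x. grad_classical (f n) x - grad \<Omega> U x) = L2_norm \<mu> (\<lambda>x. grad_classical (f n) x - G x)"
      proof (rule L2_norm_cong_AE)
        show "AE x in \<mu>. grad_classical (f n) x - grad \<Omega> U x = grad_classical (f n) x - G x"
          using grad(2) by eventually_elim simp
      qed (intro L2_borel L2_diff L2_smooth_grad f H1_grad grad(1) G(1))+
      then show "L2_norm \<mu> (\<lambda>x. grad_classical (f n) x - grad \<Omega> U x) \<le> 1 / real (Suc n) + L2_norm \<mu> (\<lambda>x. grad \<Omega> (u n) x - G x)"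
        using L2_norm_triangle_diff[OF L2_smooth_grad[OF f(1)] L2u(2) G(1), of n n] f(3)[of n] by linarith
    qed simp
    show "(\<lambda>n. L2_norm \<beta> (\<lambda>x. f n x - g x)) \<longlonglongrightarrow> 0"
    proof (rule squeeze[OF _ _ tendsto_const])
      show "L2_norm \<beta> (\<lambda>x. f n x - g x) \<le> 1 / real (Suc n) + 0" for n
        using f(4)[of n] by linarith
    qed simp
    show "smooth (f n)" for n by (rule f(1))
  qed (rule grad(1), rule L2u(3))
qed

text \<open>The boundary term vanishes in the limit along the smooth functions that define the trace.\<close>
theorem friedrichs_H1_0:
  assumes "H1_0 \<Omega> v"
  shows "L2_norm \<mu> v \<le> 4 * R * L2_norm \<mu> (grad \<Omega> v)"
proof (rule power2_le_imp_le)
  have v: "has_trace \<Omega> v (\<lambda>_. 0)" using assms by (simp add: H1_0_def)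
  obtain f where f: "\<And>n. smooth (f n)" "(\<lambda>n. L2_norm \<mu> (\<lambda>x. f n x - v x)) \<longlonglongrightarrow> 0"
      "(\<lambda>n. L2_norm \<mu> (\<lambda>x. grad_classical (f n) x - grad \<Omega> v x)) \<longlonglongrightarrow> 0"
      "(\<lambda>n. L2_norm \<beta> (\<lambda>x. f n x - 0)) \<longlonglongrightarrow> 0"
    using v unfolding has_trace_iff by blast
  have "(L2_norm \<mu> v)\<^sup>2 \<le> 4 * R * 0\<^sup>2 + 16 * R\<^sup>2 * (L2_norm \<mu> (grad \<Omega> v))\<^sup>2"
  proof (rule LIMSEQ_le)
    show "(\<lambda>n. (L2_norm \<mu> (f n))\<^sup>2) \<longlonglongrightarrow> (L2_norm \<mu> v)\<^sup>2"
      by (intro tendsto_power L2_norm_tendsto L2_smooth f has_trace_L2[OF v])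
    show "(\<lambda>n. 4 * R * (L2_norm \<beta> (f n))\<^sup>2 + 16 * R\<^sup>2 * (L2_norm \<mu> (grad_classical (f n)))\<^sup>2)
        \<longlonglongrightarrow> 4 * R * 0\<^sup>2 + 16 * R\<^sup>2 * (L2_norm \<mu> (grad \<Omega> v))\<^sup>2"
      using f(4) by (intro tendsto_intros L2_norm_tendsto L2_smooth_grad f has_trace_L2_grad[OF v]) simp
  qed (use friedrichs_smooth[OF f(1)] in blast)
  then show "(L2_norm \<mu> v)\<^sup>2 \<le> (4 * R * L2_norm \<mu> (grad \<Omega> v))\<^sup>2"
    by (simp add: power_mult_distrib)
qed (use R in simp)

end

section \<open>Weak solutions: existence and stability\<close>

lemma weak_solution_trace: "weak_solution \<Omega> \<sigma> g u \<Longrightarrow> has_trace \<Omega> u g"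
  by (simp add: weak_solution_def)

context finite_perimeter_domain
begin

lemma has_trace_add_H1_0:
  assumes "has_trace \<Omega> u g" "H1_0 \<Omega> v"
  shows "has_trace \<Omega> (\<lambda>x. u x + v x) g" "AE x in \<mu>. grad \<Omega> (\<lambda>x. u x + v x) x = grad \<Omega> u x + grad \<Omega> v x"
  using has_trace_linear[OF assms(1) assms(2)[unfolded H1_0_def], of 1 1] by simp_all

lemma has_trace_diff_H1_0:
  assumes "has_trace \<Omega> u g" "has_trace \<Omega> w g"
  shows "H1_0 \<Omega> (\<lambda>x. u x - w x)" "AE x in \<mu>. grad \<Omega> (\<lambda>x. u x - w x) x = grad \<Omega> u x - grad \<Omega> w x"
  using has_trace_linear[OF assms, of 1 "-1"] by (simp_all add: H1_0_def)

lemma L2_norm_grad_diff: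
  assumes "has_trace \<Omega> u g" "has_trace \<Omega> w g"
  shows "L2_norm \<mu> (grad \<Omega> (\<lambda>x. u x - w x)) = L2_norm \<mu> (\<lambda>x. grad \<Omega> u x - grad \<Omega> w x)"
  by (intro L2_norm_cong_AE has_trace_diff_H1_0(2)[OF assms] L2_borel L2_diff has_trace_L2_grad[OF assms(1)]
      has_trace_L2_grad[OF assms(2)] has_trace_L2_grad[OF has_trace_diff_H1_0(1)[OF assms, unfolded H1_0_def]])

text \<open>With \<open>E u = \<surd>\<sigma> \<nabla>u\<close>, the energy of \<open>u\<close> is the square norm of \<open>E u\<close>, so a solution is obtained from the
  projection of 0 to the affine set of all \<open>E u\<close> with \<open>u\<close> of trace \<open>g\<close>. If \<open>E (u n)\<close> converges, then so do
  the gradients, because \<open>\<sigma> \<ge> c\<close>; the Friedrichs inequality for the differences, which have trace 0,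
  makes \<open>u n\<close> a Cauchy sequence, and its limit has trace \<open>g\<close> and the limit of the gradients as its
  gradient.\<close>
theorem weak_solution_exists:
  assumes \<sigma>: "\<sigma> \<in> borel_measurable \<mu>" and c: "0 < c" and bd: "AE x in \<mu>. c \<le> \<sigma> x \<and> \<sigma> x \<le> C"
    and g: "H_half \<Omega> g"
  shows "\<exists>u. weak_solution \<Omega> \<sigma> g u"
proof -
  define E where "E u x = sqrt (\<sigma> x) *\<^sub>R grad \<Omega> u x" for u x
  define K where "K = {F. L2 \<mu> F \<and> (\<exists>u. has_trace \<Omega> u g \<and> (AE x in \<mu>. F x = E u x))}"
  have E: "L2 \<mu> (E u)" if u: "has_trace \<Omega> u h" for u h
  proof (rule L2_norm_le_AE(1)[OF _ has_trace_L2_grad[OF u], of _ "sqrt \<bar>C\<bar>"])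
    show "E u \<in> borel_measurable \<mu>"
      unfolding E_def using \<sigma> L2_borel[OF has_trace_L2_grad[OF u]] by measurable
    show "AE x in \<mu>. norm (E u x) \<le> sqrt \<bar>C\<bar> * norm (grad \<Omega> u x)"
      using bd by eventually_elim (use c in \<open>auto simp: E_def intro!: mult_right_mono\<close>)
  qed simp
  have E_in_K: "E u \<in> K" if "has_trace \<Omega> u g" for u
    using E[OF that] that by (auto simp: K_def)
  obtain F where F: "F \<in> K" "\<And>H. H \<in> K \<Longrightarrow> (LINT x|\<mu>. F x \<bullet> (H x - F x)) = 0"
  proof (rule L2_affine_projection[of K \<mu>])
    show "K \<noteq> {}" using g E_in_K by (auto simp: H_half_def)
    show "L2 \<mu> F" if "F \<in> K" for F using that by (simp add: K_def)
    fix F H t assume "F \<in> K" "H \<in> K"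
    then obtain u w where FH: "L2 \<mu> F" "L2 \<mu> H" and u: "has_trace \<Omega> u g" "AE x in \<mu>. F x = E u x"
      and w: "has_trace \<Omega> w g" "AE x in \<mu>. H x = E w x" by (auto simp: K_def)
    let ?z = "\<lambda>x. (1 - t) * u x + t * w x"
    note z = has_trace_linear[OF u(1) w(1), of "1 - t" t]
    have "has_trace \<Omega> ?z g" using z(1) by (simp add: algebra_simps)
    moreover have "AE x in \<mu>. F x + t *\<^sub>R (H x - F x) = E ?z x"
      using u(2) w(2) z(2)
    proof eventually_elim
      case (elim x)
      show ?case
        unfolding E_def elim(3) elim(1)[unfolded E_def] elim(2)[unfolded E_def] by (simp add: algebra_simps)
    qed
    moreover have "L2 \<mu> (\<lambda>x. F x + t *\<^sub>R (H x - F x))" by (intro L2_add L2_scaleR L2_diff FH)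
    ultimately show "(\<lambda>x. F x + t *\<^sub>R (H x - F x)) \<in> K" by (auto simp: K_def)
  next
    fix Fs F assume Fs: "\<And>n. Fs n \<in> K" and F: "L2 \<mu> F" "(\<lambda>n. L2_norm \<mu> (\<lambda>x. Fs n x - F x)) \<longlonglongrightarrow> 0"
    have "\<exists>u. has_trace \<Omega> u g \<and> (AE x in \<mu>. Fs n x = E u x)" and L2Fs: "L2 \<mu> (Fs n)" for n
      using Fs[of n] by (auto simp: K_def)
    then obtain u where u: "\<And>n. has_trace \<Omega> (u n) g" "\<And>n. AE x in \<mu>. Fs n x = E (u n) x" by metis
    \<comment> \<open>The candidate for the limit of the gradients.\<close>
    define G where "G x = (1 / sqrt (\<sigma> x)) *\<^sub>R F x" for x
    have mG: "(\<lambda>x. (1 / sqrt (\<sigma> x)) *\<^sub>R H x) \<in> borel_measurable \<mu>" if "L2 \<mu> H" for H :: "R2 \<Rightarrow> R2"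
      using \<sigma> L2_borel[OF that] by measurable
    have bG: "AE x in \<mu>. norm ((1 / sqrt (\<sigma> x)) *\<^sub>R H x) \<le> 1 / sqrt c * norm (H x)" for H :: "R2 \<Rightarrow> R2"
      using bd by eventually_elim (use c in \<open>auto intro!: mult_right_mono divide_left_mono simp: divide_inverse\<close>)
    have G: "L2 \<mu> G"
      unfolding G_def by (rule L2_norm_le_AE(1)[OF mG[OF F(1)] F(1) _ bG]) (use c in simp)
    have gradG: "L2_norm \<mu> (\<lambda>x. grad \<Omega> (u n) x - G x) \<le> 1 / sqrt c * L2_norm \<mu> (\<lambda>x. Fs n x - F x)" for n
    proof (rule L2_norm_le_AE(2)[OF L2_borel[OF L2_diff[OF has_trace_L2_grad[OF u(1)] G]] L2_diff[OF L2Fs F(1)]])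
      show "AE x in \<mu>. norm (grad \<Omega> (u n) x - G x) \<le> 1 / sqrt c * norm (Fs n x - F x)"
        using bG[of "\<lambda>x. Fs n x - F x"] bd u(2)[of n]
      proof eventually_elim
        case (elim x)
        have "grad \<Omega> (u n) x - G x = (1 / sqrt (\<sigma> x)) *\<^sub>R (Fs n x - F x)"
          using elim c by (simp add: E_def G_def scaleR_diff_right)
        with elim show ?case by simp
      qed
    qed (use c in simp)
    have gradG0: "(\<lambda>n. L2_norm \<mu> (\<lambda>x. grad \<Omega> (u n) x - G x)) \<longlonglongrightarrow> 0"
    proof (rule tendsto_sandwich[OF _ _ tendsto_const])
      show "(\<lambda>n. 1 / sqrt c * L2_norm \<mu> (\<lambda>x. Fs n x - F x)) \<longlonglongrightarrow> 0"
        using tendsto_mult_left[OF F(2), of "1 / sqrt c"] by simp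
    qed (use gradG in auto)
    have diff: "L2_norm \<mu> (\<lambda>x. u m x - u n x)
        \<le> 4 * R * (L2_norm \<mu> (\<lambda>x. grad \<Omega> (u m) x - G x) + L2_norm \<mu> (\<lambda>x. grad \<Omega> (u n) x - G x))" for m n
    proof -
      have "L2_norm \<mu> (\<lambda>x. u m x - u n x) \<le> 4 * R * L2_norm \<mu> (\<lambda>x. grad \<Omega> (u m) x - grad \<Omega> (u n) x)"
        using friedrichs_H1_0[OF has_trace_diff_H1_0(1)[OF u(1) u(1)], of m n]
        unfolding L2_norm_grad_diff[OF u(1) u(1)] .
      also have "L2_norm \<mu> (\<lambda>x. grad \<Omega> (u m) x - grad \<Omega> (u n) x)
          \<le> L2_norm \<mu> (\<lambda>x. grad \<Omega> (u m) x - G x) + L2_norm \<mu> (\<lambda>x. grad \<Omega> (u n) x - G x)"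
        using L2_norm_triangle_diff[OF has_trace_L2_grad[OF u(1)] G has_trace_L2_grad[OF u(1)], of m n]
        by (simp add: L2_norm_minus_commute[of \<mu> G])
      finally show ?thesis using R by simp
    qed
    have "\<exists>N. \<forall>m\<ge>N. \<forall>n\<ge>N. L2_norm \<mu> (\<lambda>x. u m x - u n x) < e" if "0 < e" for e
    proof -
      have "0 < e / (8 * R)" using that R by simp
      from order_tendstoD(2)[OF gradG0 this]
      obtain N where N: "\<And>n. N \<le> n \<Longrightarrow> L2_norm \<mu> (\<lambda>x. grad \<Omega> (u n) x - G x) < e / (8 * R)"
        by (auto simp: eventually_sequentially)
      have "L2_norm \<mu> (\<lambda>x. u m x - u n x) < e" if "N \<le> m" "N \<le> n" for m n
      proof -
        have "4 * R * (L2_norm \<mu> (\<lambda>x. grad \<Omega> (u m) x - G x) + L2_norm \<mu> (\<lambda>x. grad \<Omega> (u n) x - G x))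
            < 4 * R * (e / (8 * R) + e / (8 * R))"
          using N[OF that(1)] N[OF that(2)] R by (intro mult_strict_left_mono add_strict_mono) auto
        also have "\<dots> = e" using R by (simp add: field_simps)
        finally show ?thesis using diff[of m n] by linarith
      qed
      then show ?thesis by blast
    qed
    then obtain U where U: "L2 \<mu> U" "(\<lambda>n. L2_norm \<mu> (\<lambda>x. u n x - U x)) \<longlonglongrightarrow> 0"
      using L2_complete[of \<mu> u] has_trace_L2[OF u(1)] by blast
    note tr = has_trace_closed[OF u(1) U G gradG0]
    have "AE x in \<mu>. F x = E U x"
      using tr(2) bd by eventually_elim (use c in \<open>simp add: E_def G_def\<close>)
    then show "F \<in> K" using F(1) tr(1) by (auto simp: K_def)
  qed blast
  obtain u where u: "has_trace \<Omega> u g" "AE x in \<mu>. F x = E u x" and L2F: "L2 \<mu> F"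
    using F(1) by (auto simp: K_def)
  have "(LINT x|\<mu>. \<sigma> x * (grad \<Omega> u x \<bullet> grad \<Omega> v x)) = 0" if v: "H1_0 \<Omega> v" for v
  proof -
    note uv = has_trace_add_H1_0[OF u(1) v]
    have "(LINT x|\<mu>. \<sigma> x * (grad \<Omega> u x \<bullet> grad \<Omega> v x)) = (LINT x|\<mu>. F x \<bullet> (E (\<lambda>x. u x + v x) x - F x))"
    proof (rule integral_cong_AE)
      show "AE x in \<mu>. \<sigma> x * (grad \<Omega> u x \<bullet> grad \<Omega> v x) = F x \<bullet> (E (\<lambda>x. u x + v x) x - F x)"
        using u(2) uv(2) bd
      proof eventually_elim
        case (elim x)
        have "0 \<le> \<sigma> x" using elim c by linarith
        with elim show ?case by (simp add: E_def algebra_simps flip: mult.assoc)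
      qed
      show "(\<lambda>x. \<sigma> x * (grad \<Omega> u x \<bullet> grad \<Omega> v x)) \<in> borel_measurable \<mu>"
        using \<sigma> L2_borel[OF has_trace_L2_grad[OF u(1)]] L2_borel[OF has_trace_L2_grad[OF v[unfolded H1_0_def]]]
        by measurable
      show "(\<lambda>x. F x \<bullet> (E (\<lambda>x. u x + v x) x - F x)) \<in> borel_measurable \<mu>"
        by (intro borel_measurable_inner L2_borel L2_diff L2F E[OF uv(1)])
    qed
    also have "\<dots> = 0" by (rule F(2)[OF E_in_K[OF uv(1)]])
    finally show ?thesis .
  qed
  with u(1) show ?thesis by (auto simp: weak_solution_def)
qed

text \<open>The difference \<open>z = w - u\<close> is an admissible test function in both equations, and subtracting them gives
  \<open>\<integral> \<rho> |\<nabla>z|\<^sup>2 = \<integral> (\<sigma> - \<rho>) \<nabla>u \<bullet> \<nabla>z\<close>. On the right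
  the solution \<open>w\<close> occurs through \<open>z\<close> alone, whose norm is then cancelled.\<close>
theorem weak_solution_stability:
  assumes u: "weak_solution \<Omega> \<sigma> g u" and w: "weak_solution \<Omega> \<rho> g w"
    and m: "\<sigma> \<in> borel_measurable \<mu>" "\<rho> \<in> borel_measurable \<mu>"
    and bd: "AE x in \<mu>. \<bar>\<sigma> x\<bar> \<le> C" "AE x in \<mu>. \<bar>\<rho> x\<bar> \<le> C" "0 \<le> C"
    and c: "0 < c" "AE x in \<mu>. c \<le> \<rho> x"
    and \<delta>: "AE x in \<mu>. \<bar>\<rho> x - \<sigma> x\<bar> \<le> \<delta>" "0 \<le> \<delta>"
  shows "L2_norm \<mu> (\<lambda>x. grad \<Omega> w x - grad \<Omega> u x) \<le> \<delta> / c * L2_norm \<mu> (grad \<Omega> u)"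
proof -
  note tu = weak_solution_trace[OF u] and tw = weak_solution_trace[OF w]
  let ?z = "\<lambda>x. w x - u x"
  let ?u = "grad \<Omega> u" and ?w = "grad \<Omega> w" and ?Z = "grad \<Omega> ?z"
  note z = has_trace_diff_H1_0[OF tw tu]
  note L2u = has_trace_L2_grad[OF tu] and L2w = has_trace_L2_grad[OF tw]
    and L2z = has_trace_L2_grad[OF z(1)[unfolded H1_0_def]]
  have weak: "(LINT x|\<mu>. \<sigma> x * (?u x \<bullet> ?Z x)) = 0" "(LINT x|\<mu>. \<rho> x * (?w x \<bullet> ?Z x)) = 0"
    using u w z(1) by (simp_all add: weak_solution_def)
  note int = L2_weighted(1)[OF m(1) bd(1,3) L2u L2z] L2_weighted(1)[OF m(2) bd(2,3) L2u L2z]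
    L2_weighted(1)[OF m(2) bd(2,3) L2w L2z] L2_weighted(1)[OF m(2) bd(2,3) L2z L2z]
  have "c * (L2_norm \<mu> ?Z)\<^sup>2 = (LINT x|\<mu>. c * (norm (?Z x))\<^sup>2)" by (simp add: L2_norm_power2)
  also have "\<dots> \<le> (LINT x|\<mu>. \<rho> x * (?Z x \<bullet> ?Z x))"
  proof (rule integral_mono_AE)
    show "AE x in \<mu>. c * (norm (?Z x))\<^sup>2 \<le> \<rho> x * (?Z x \<bullet> ?Z x)"
      using c(2) by eventually_elim (simp add: power2_norm_eq_inner mult_right_mono)
  qed (intro integrable_mult_right L2_integrable L2z int)+
  also have "\<dots> = (LINT x|\<mu>. \<rho> x * (?w x \<bullet> ?Z x) - \<rho> x * (?u x \<bullet> ?Z x))"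
  proof (rule integral_cong_AE)
    show "AE x in \<mu>. \<rho> x * (?Z x \<bullet> ?Z x) = \<rho> x * (?w x \<bullet> ?Z x) - \<rho> x * (?u x \<bullet> ?Z x)"
      using z(2) by eventually_elim (simp add: inner_diff_left right_diff_distrib)
  qed (intro borel_measurable_integrable Bochner_Integration.integrable_diff int)+
  also have "\<dots> = - (LINT x|\<mu>. (\<rho> x - \<sigma> x) * (?u x \<bullet> ?Z x))"
    using int weak by (simp add: left_diff_distrib)
  also have "\<dots> \<le> \<delta> * L2_norm \<mu> ?u * L2_norm \<mu> ?Z"
    using L2_weighted(2)[OF borel_measurable_diff[OF m(2,1)] \<delta> L2u L2z] by linarith
  finally have main: "c * (L2_norm \<mu> ?Z)\<^sup>2 \<le> \<delta> * L2_norm \<mu> ?u * L2_norm \<mu> ?Z" .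
  have "L2_norm \<mu> ?Z \<le> \<delta> / c * L2_norm \<mu> ?u"
  proof (cases "L2_norm \<mu> ?Z = 0")
    case True
    then show ?thesis using \<delta> c by simp
  next
    case False
    then have "0 < L2_norm \<mu> ?Z" by (simp add: less_le)
    then have "c * L2_norm \<mu> ?Z \<le> \<delta> * L2_norm \<mu> ?u"
      using main by (simp add: power2_eq_square)
    then show ?thesis using c by (simp add: field_simps)
  qed
  then show ?thesis unfolding L2_norm_grad_diff[OF tw tu] .
qed

section \<open>Power densities and the likelihood\<close>

lemma conductivities_bounds:
  assumes "\<sigma> \<in> conductivities \<Omega> c C"
  shows "\<sigma> \<in> borel_measurable \<mu>" "AE x in \<mu>. c \<le> \<sigma> x \<and> \<sigma> x \<le> C" "AE x in \<mu>. c \<le> \<sigma> x"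
    "0 < c \<Longrightarrow> AE x in \<mu>. \<bar>\<sigma> x\<bar> \<le> C"
  using assms by (auto simp: conductivities_def elim: eventually_mono)

lemma potential_weak_solution:
  assumes "\<sigma> \<in> conductivities \<Omega> c C" "0 < c" "H_half \<Omega> g"
  shows "weak_solution \<Omega> \<sigma> g (potential \<Omega> \<sigma> g)"
  unfolding potential_def
  by (rule someI_ex[of "weak_solution \<Omega> \<sigma> g"], rule weak_solution_exists[OF conductivities_bounds(1)[OF assms(1)] assms(2)
        conductivities_bounds(2)[OF assms(1)] assms(3)])

lemma power_density_integrable:
  assumes "\<sigma> \<in> conductivities \<Omega> c C" "0 < c" "0 \<le> C" "H_half \<Omega> (g i)" "H_half \<Omega> (g j)"
  shows "integrable \<mu> (power_density \<Omega> g \<sigma> i j)"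
proof -
  note tr = has_trace_L2_grad[OF weak_solution_trace[OF potential_weak_solution[OF assms(1,2)]]]
  show ?thesis
    unfolding power_density_def
    by (rule L2_weighted(1)[OF conductivities_bounds(1)[OF assms(1)] conductivities_bounds(4)[OF assms(1,2)] assms(3)
        tr[OF assms(4)] tr[OF assms(5)]])
qed

lemma L1_norm_diff_le:
  assumes "integrable \<mu> f" "integrable \<mu> h"
  shows "\<bar>L1_norm \<Omega> f - L1_norm \<Omega> h\<bar> \<le> L1_norm \<Omega> (\<lambda>x. f x - h x)"
proof -
  have "\<bar>L1_norm \<Omega> f - L1_norm \<Omega> h\<bar> = \<bar>LINT x|\<mu>. \<bar>f x\<bar> - \<bar>h x\<bar>\<bar>"
    using assms by (simp add: L1_norm_def)
  also have "\<dots> \<le> (LINT x|\<mu>. \<bar>\<bar>f x\<bar> - \<bar>h x\<bar>\<bar>)" by (rule integral_abs_bound)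
  also have "\<dots> \<le> L1_norm \<Omega> (\<lambda>x. f x - h x)"
    unfolding L1_norm_def using assms by (intro integral_mono) auto
  finally show ?thesis .
qed

text \<open>The difference of the densities is the telescoping sum
  \<open>(\<rho> - \<sigma>) \<nabla>w\<^sub>i \<bullet> \<nabla>w\<^sub>j + \<sigma> \<nabla>(w\<^sub>i - u\<^sub>i) \<bullet> \<nabla>w\<^sub>j + \<sigma> \<nabla>u\<^sub>i \<bullet> \<nabla>(w\<^sub>j - u\<^sub>j)\<close>. The norms of \<open>\<nabla>w\<close> are estimated by those of
  \<open>\<nabla>u\<close>, so that for fixed \<open>\<sigma>\<close> the bound depends on \<open>\<rho>\<close> through \<open>\<delta>\<close> alone and tends to 0 with \<open>\<delta>\<close>.\<close>
lemma power_density_L1_stability: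
  assumes \<sigma>: "\<sigma> \<in> conductivities \<Omega> c C" and \<rho>: "\<rho> \<in> conductivities \<Omega> c C"
    and c: "0 < c" "0 \<le> C" and g: "H_half \<Omega> (g i)" "H_half \<Omega> (g j)"
    and \<delta>: "AE x in \<mu>. \<bar>\<rho> x - \<sigma> x\<bar> \<le> \<delta>" "0 \<le> \<delta>"
  defines "a \<equiv> \<lambda>k. L2_norm \<mu> (grad \<Omega> (potential \<Omega> \<sigma> (g k)))"
  shows "L1_norm \<Omega> (\<lambda>x. power_density \<Omega> g \<rho> i j x - power_density \<Omega> g \<sigma> i j x)
    \<le> \<delta> * (a i + \<delta> / c * a i) * (a j + \<delta> / c * a j)
      + C * (\<delta> / c * a i) * (a j + \<delta> / c * a j) + C * a i * (\<delta> / c * a j)"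
proof -
  let ?u = "\<lambda>k. grad \<Omega> (potential \<Omega> \<sigma> (g k))" and ?w = "\<lambda>k. grad \<Omega> (potential \<Omega> \<rho> (g k))"
  note m = conductivities_bounds(1)[OF \<sigma>] conductivities_bounds(1)[OF \<rho>]
  note bd = conductivities_bounds(4)[OF \<sigma> c(1)] conductivities_bounds(4)[OF \<rho> c(1)]
  have L2u: "L2 \<mu> (?u k)" and L2w: "L2 \<mu> (?w k)" if "H_half \<Omega> (g k)" for k
    using has_trace_L2_grad[OF weak_solution_trace[OF potential_weak_solution[OF _ c(1) that]]] \<sigma> \<rho> by auto
  have d: "L2_norm \<mu> (\<lambda>x. ?w k x - ?u k x) \<le> \<delta> / c * a k" if k: "H_half \<Omega> (g k)" for k
    unfolding a_def
    by (rule weak_solution_stability[OF potential_weak_solution[OF \<sigma> c(1) k] potential_weak_solution[OF \<rho> c(1) k]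
          m bd c(2) c(1) conductivities_bounds(3)[OF \<rho>] \<delta>])
  have a0: "0 \<le> a k" for k by (simp add: a_def)
  have nw: "L2_norm \<mu> (?w k) \<le> a k + \<delta> / c * a k" if k: "H_half \<Omega> (g k)" for k
    using L2_norm_triangle_le[OF L2w[OF k] L2u[OF k]] d[OF k] by (simp add: a_def)
  note L2 = L2u[OF g(1)] L2u[OF g(2)] L2w[OF g(1)] L2w[OF g(2)]
  let ?A = "\<lambda>x. (\<rho> x - \<sigma> x) * (?w i x \<bullet> ?w j x)" and ?B = "\<lambda>x. \<sigma> x * ((?w i x - ?u i x) \<bullet> ?w j x)"
    and ?D = "\<lambda>x. \<sigma> x * (?u i x \<bullet> (?w j x - ?u j x))"
  note WA = L2_weighted[OF borel_measurable_diff[OF m(2,1)] \<delta> L2(3,4)]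
  note WB = L2_weighted[OF m(1) bd(1) c(2) L2_diff[OF L2(3,1)] L2(4)]
  note WD = L2_weighted[OF m(1) bd(1) c(2) L2(1) L2_diff[OF L2(4,2)]]
  have "L1_norm \<Omega> (\<lambda>x. power_density \<Omega> g \<rho> i j x - power_density \<Omega> g \<sigma> i j x) = (LINT x|\<mu>. \<bar>?A x + ?B x + ?D x\<bar>)"
    unfolding L1_norm_def power_density_def
    by (intro Bochner_Integration.integral_cong refl arg_cong[where f=abs]) (simp add: inner_diff_left inner_diff_right algebra_simps)
  also have "\<dots> \<le> (LINT x|\<mu>. \<bar>?A x\<bar> + \<bar>?B x\<bar> + \<bar>?D x\<bar>)"
    using WA(1) WB(1) WD(1)
    by (intro integral_mono integrable_abs Bochner_Integration.integrable_add) auto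
  also have "\<dots> = (LINT x|\<mu>. \<bar>?A x\<bar>) + (LINT x|\<mu>. \<bar>?B x\<bar>) + (LINT x|\<mu>. \<bar>?D x\<bar>)"
    using integrable_abs[OF WA(1)] integrable_abs[OF WB(1)] integrable_abs[OF WD(1)] by simp
  also have "\<dots> \<le> \<delta> * L2_norm \<mu> (?w i) * L2_norm \<mu> (?w j)
      + C * L2_norm \<mu> (\<lambda>x. ?w i x - ?u i x) * L2_norm \<mu> (?w j)
      + C * L2_norm \<mu> (?u i) * L2_norm \<mu> (\<lambda>x. ?w j x - ?u j x)"
    by (intro add_mono WA(3) WB(3) WD(3))
  also have "\<dots> \<le> \<delta> * (a i + \<delta> / c * a i) * (a j + \<delta> / c * a j)
      + C * (\<delta> / c * a i) * (a j + \<delta> / c * a j) + C * a i * (\<delta> / c * a j)"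
    using c \<delta>(2) a0[of i] a0[of j]
    by (intro add_mono mult_mono mult_nonneg_nonneg nw d g order_refl) (auto simp: a_def)
  finally show ?thesis .
qed

lemma neg_log_likelihood_continuous:
  assumes \<sigma>: "\<sigma> \<in> conductivities \<Omega> c C" and c: "0 < c" "0 \<le> C"
    and g: "\<forall>i\<in>{1..d}. H_half \<Omega> (g i)" and \<tau>: "\<forall>i\<in>{1..d}. \<forall>j\<in>{1..d}. 0 < \<tau> i j" and y: "L1_data \<Omega> d y"
  shows "Linf_continuous_at \<Omega> (conductivities \<Omega> c C) (neg_log_likelihood \<Omega> d g \<tau> y) \<sigma>"
  unfolding Linf_continuous_at_def
proof (intro allI impI)
  fix \<epsilon> :: real assume \<epsilon>: "0 < \<epsilon>"
  define a where "a k = L2_norm \<mu> (grad \<Omega> (potential \<Omega> \<sigma> (g k)))" for k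
  \<comment> \<open>The bound of \<open>power_density_L1_stability\<close>, weighted and summed: a modulus of continuity at \<open>\<sigma>\<close>.\<close>
  define T where "T \<delta> = (\<Sum>i=1..d. \<Sum>j=1..d. (\<delta> * (a i + \<delta> / c * a i) * (a j + \<delta> / c * a j)
      + C * (\<delta> / c * a i) * (a j + \<delta> / c * a j) + C * a i * (\<delta> / c * a j)) / \<tau> i j)" for \<delta>
  have \<tau>0: "\<tau> i j \<noteq> 0" if "i \<in> {1..d}" "j \<in> {1..d}" for i j
    using \<tau> that by (metis less_irrefl)
  have "(T \<longlongrightarrow> T 0) (at_right 0)"
    unfolding T_def using \<tau>0 c by (intro tendsto_intros) auto
  then have "(T \<longlongrightarrow> 0) (at_right 0)" by (simp add: T_def)
  from order_tendstoD(2)[OF this \<epsilon>]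
  have "\<exists>\<delta>>0. T \<delta> < \<epsilon>"
    unfolding eventually_at_right_field using dense by blast
  then obtain \<delta> where \<delta>: "0 < \<delta>" "T \<delta> < \<epsilon>" by blast
  have "\<bar>neg_log_likelihood \<Omega> d g \<tau> y \<rho> - neg_log_likelihood \<Omega> d g \<tau> y \<sigma>\<bar> < \<epsilon>"
    if \<rho>: "\<rho> \<in> conductivities \<Omega> c C" "Linf_norm \<Omega> (\<lambda>x. \<rho> x - \<sigma> x) < ereal \<delta>" for \<rho>
  proof -
    have "AE x in \<mu>. ereal \<bar>\<rho> x - \<sigma> x\<bar> \<le> Linf_norm \<Omega> (\<lambda>x. \<rho> x - \<sigma> x)"
      unfolding Linf_norm_def by (rule esssup_AE)
    then have AE: "AE x in \<mu>. \<bar>\<rho> x - \<sigma> x\<bar> \<le> \<delta>"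
    proof eventually_elim
      case (elim x)
      then have "ereal \<bar>\<rho> x - \<sigma> x\<bar> < ereal \<delta>" using \<rho>(2) by (rule le_less_trans)
      then show ?case by simp
    qed
    let ?L = "\<lambda>\<sigma> i j. L1_norm \<Omega> (\<lambda>x. power_density \<Omega> g \<sigma> i j x - y i j x)"
    have "\<bar>neg_log_likelihood \<Omega> d g \<tau> y \<rho> - neg_log_likelihood \<Omega> d g \<tau> y \<sigma>\<bar>
        = \<bar>\<Sum>i=1..d. \<Sum>j=1..d. (?L \<rho> i j - ?L \<sigma> i j) / \<tau> i j\<bar>"
      by (simp add: neg_log_likelihood_def sum_subtractf diff_divide_distrib)
    also have "\<dots> \<le> (\<Sum>i=1..d. \<Sum>j=1..d. \<bar>(?L \<rho> i j - ?L \<sigma> i j) / \<tau> i j\<bar>)"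
      by (intro order_trans[OF sum_abs] sum_mono order_refl)
    also have "\<dots> \<le> T \<delta>"
      unfolding T_def
    proof (intro sum_mono)
      fix i j assume ij: "i \<in> {1..d}" "j \<in> {1..d}"
      have gij: "H_half \<Omega> (g i)" "H_half \<Omega> (g j)" and \<tau>ij: "0 < \<tau> i j" and yij: "integrable \<mu> (y i j)"
        using ij g \<tau> y by (auto simp: L1_data_def)
      note int = power_density_integrable[OF \<rho>(1) c gij] power_density_integrable[OF \<sigma> c gij]
      have "\<bar>?L \<rho> i j - ?L \<sigma> i j\<bar>
          \<le> L1_norm \<Omega> (\<lambda>x. power_density \<Omega> g \<rho> i j x - power_density \<Omega> g \<sigma> i j x)"
        using L1_norm_diff_le[OF Bochner_Integration.integrable_diff[OF int(1) yij] Bochner_Integration.integrable_diff[OF int(2) yij]]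
        by simp
      also note power_density_L1_stability[OF \<sigma> \<rho>(1) c gij AE less_imp_le[OF \<delta>(1)], folded a_def]
      finally show "\<bar>(?L \<rho> i j - ?L \<sigma> i j) / \<tau> i j\<bar> \<le> (\<delta> * (a i + \<delta> / c * a i) * (a j + \<delta> / c * a j)
          + C * (\<delta> / c * a i) * (a j + \<delta> / c * a j) + C * a i * (\<delta> / c * a j)) / \<tau> i j"
        using \<tau>ij by (simp add: divide_right_mono)
    qed
    finally show ?thesis using \<delta>(2) by linarith
  qed
  then show "\<exists>\<delta>>0. \<forall>\<rho>\<in>conductivities \<Omega> c C. Linf_norm \<Omega> (\<lambda>x. \<rho> x - \<sigma> x) < ereal \<delta> \<longrightarrow>
      \<bar>neg_log_likelihood \<Omega> d g \<tau> y \<rho> - neg_log_likelihood \<Omega> d g \<tau> y \<sigma>\<bar> < \<epsilon>"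
    using \<delta>(1) by blast
qed

text \<open>Each summand is estimated by the triangle inequality in \<open>L\<^sup>1\<close>, with \<open>1 / \<tau>\<^sub>i\<^sub>j\<close> bounded by the sum of all
  these weights. The power density has to be integrable, since otherwise its distances to \<open>y1\<close> and \<open>y2\<close>
  would be default values.\<close>
lemma neg_log_likelihood_lipschitz:
  assumes \<sigma>: "\<sigma> \<in> conductivities \<Omega> c C" and c: "0 < c" "0 \<le> C"
    and g: "\<forall>i\<in>{1..d}. H_half \<Omega> (g i)" and \<tau>: "\<forall>i\<in>{1..d}. \<forall>j\<in>{1..d}. 0 < \<tau> i j"
    and y: "L1_data \<Omega> d y1" "L1_data \<Omega> d y2"
  shows "\<bar>neg_log_likelihood \<Omega> d g \<tau> y1 \<sigma> - neg_log_likelihood \<Omega> d g \<tau> y2 \<sigma>\<bar>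
    \<le> (\<Sum>i=1..d. \<Sum>j=1..d. 1 / \<tau> i j) * (\<Sum>i=1..d. \<Sum>j=1..d. L1_norm \<Omega> (\<lambda>x. y1 i j x - y2 i j x))"
proof -
  let ?K = "\<Sum>i=1..d. \<Sum>j=1..d. 1 / \<tau> i j"
  let ?L = "\<lambda>y i j. L1_norm \<Omega> (\<lambda>x. power_density \<Omega> g \<sigma> i j x - y i j x)"
  have "\<bar>neg_log_likelihood \<Omega> d g \<tau> y1 \<sigma> - neg_log_likelihood \<Omega> d g \<tau> y2 \<sigma>\<bar>
      = \<bar>\<Sum>i=1..d. \<Sum>j=1..d. (?L y1 i j - ?L y2 i j) / \<tau> i j\<bar>"
    by (simp add: neg_log_likelihood_def sum_subtractf diff_divide_distrib)
  also have "\<dots> \<le> (\<Sum>i=1..d. \<Sum>j=1..d. \<bar>(?L y1 i j - ?L y2 i j) / \<tau> i j\<bar>)"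
    by (intro order_trans[OF sum_abs] sum_mono order_refl)
  also have "\<dots> \<le> (\<Sum>i=1..d. \<Sum>j=1..d. ?K * L1_norm \<Omega> (\<lambda>x. y1 i j x - y2 i j x))"
  proof (intro sum_mono)
    fix i j assume ij: "i \<in> {1..d}" "j \<in> {1..d}"
    have gij: "H_half \<Omega> (g i)" "H_half \<Omega> (g j)" and \<tau>ij: "0 < \<tau> i j"
      and yij: "integrable \<mu> (y1 i j)" "integrable \<mu> (y2 i j)"
      using ij g \<tau> y by (auto simp: L1_data_def)
    note int = power_density_integrable[OF \<sigma> c gij]
    have "\<bar>?L y1 i j - ?L y2 i j\<bar> \<le> L1_norm \<Omega> (\<lambda>x. y2 i j x - y1 i j x)"
      using L1_norm_diff_le[OF Bochner_Integration.integrable_diff[OF int yij(1)] Bochner_Integration.integrable_diff[OF int yij(2)]]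
      by simp
    also have "\<dots> = L1_norm \<Omega> (\<lambda>x. y1 i j x - y2 i j x)"
      by (simp add: L1_norm_def abs_minus_commute)
    finally have le: "\<bar>?L y1 i j - ?L y2 i j\<bar> \<le> L1_norm \<Omega> (\<lambda>x. y1 i j x - y2 i j x)" .
    have "1 / \<tau> i j \<le> (\<Sum>j=1..d. 1 / \<tau> i j)"
      using ij \<tau> by (intro member_le_sum) (auto simp: less_imp_le)
    also have "\<dots> \<le> ?K"
      using ij \<tau> by (intro member_le_sum[where f="\<lambda>i. \<Sum>j=1..d. 1 / \<tau> i j"]) (auto intro!: sum_nonneg simp: less_imp_le)
    finally have K: "1 / \<tau> i j \<le> ?K" .
    have K0: "0 \<le> ?K" using K divide_pos_pos[OF zero_less_one \<tau>ij] by linarith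
    have "\<bar>(?L y1 i j - ?L y2 i j) / \<tau> i j\<bar> = 1 / \<tau> i j * \<bar>?L y1 i j - ?L y2 i j\<bar>"
      using \<tau>ij by simp
    also have "\<dots> \<le> ?K * L1_norm \<Omega> (\<lambda>x. y1 i j x - y2 i j x)"
      by (intro mult_mono K le K0) simp
    finally show "\<bar>(?L y1 i j - ?L y2 i j) / \<tau> i j\<bar> \<le> ?K * L1_norm \<Omega> (\<lambda>x. y1 i j x - y2 i j x)" .
  qed
  also have "\<dots> = ?K * (\<Sum>i=1..d. \<Sum>j=1..d. L1_norm \<Omega> (\<lambda>x. y1 i j x - y2 i j x))"
    by (simp add: sum_distrib_left)
  finally show ?thesis .
qed

end

lemma space_Linf_borel: "space (Linf_borel \<Omega> S) = S"
  unfolding Linf_borel_def by (intro space_measure_of) (auto simp: Linf_open_in_def)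

lemma Linf_continuous_imp_measurable:
  assumes "\<And>\<sigma>. \<sigma> \<in> S \<Longrightarrow> Linf_continuous_at \<Omega> S G \<sigma>"
  shows "G \<in> borel_measurable (Linf_borel \<Omega> S)"
proof (rule borel_measurableI)
  fix V :: "real set" assume V: "open V"
  have "Linf_open_in \<Omega> S (G -` V \<inter> S)"
    unfolding Linf_open_in_def
  proof (intro conjI ballI)
    fix \<sigma> assume \<sigma>: "\<sigma> \<in> G -` V \<inter> S"
    then obtain e where e: "0 < e" "\<And>t. \<bar>t - G \<sigma>\<bar> < e \<Longrightarrow> t \<in> V"
      using V by (auto simp: open_dist dist_real_def)
    have "Linf_continuous_at \<Omega> S G \<sigma>" using assms \<sigma> by blast
    then obtain \<delta> where "0 < \<delta>" "\<And>\<rho>. \<rho> \<in> S \<Longrightarrow> Linf_norm \<Omega> (\<lambda>x. \<rho> x - \<sigma> x) < ereal \<delta> \<Longrightarrow> \<bar>G \<rho> - G \<sigma>\<bar> < e"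
      using e(1) unfolding Linf_continuous_at_def by blast
    then show "\<exists>\<delta>>0. \<forall>\<rho>\<in>S. Linf_norm \<Omega> (\<lambda>x. \<rho> x - \<sigma> x) < ereal \<delta> \<longrightarrow> \<rho> \<in> G -` V \<inter> S"
      using e(2) by blast
  qed simp
  then show "G -` V \<inter> space (Linf_borel \<Omega> S) \<in> sets (Linf_borel \<Omega> S)"
    unfolding space_Linf_borel unfolding Linf_borel_def
    by (subst sets_measure_of) (auto simp: Linf_open_in_def)
qed

lemma lipschitz_domain:
  assumes "open \<Omega>" "bounded \<Omega>" "lipschitz_boundary \<Omega>"
  obtains R where "finite_perimeter_domain \<Omega> R"
proof -
  obtain R where "0 < R" "\<Omega> \<subseteq> ball 0 R" using bounded_subset_ballD[OF assms(2)] by blast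
  then have "finite_perimeter_domain \<Omega> R"
    using assms lipschitz_boundary_finite_measure[OF assms] by unfold_locales auto
  then show thesis by (rule that)
qed

theorem theorem6p4:
  fixes \<Omega> :: "(real^2) set" and d p :: nat
    and g :: "nat \<Rightarrow> real^2 \<Rightarrow> real" and \<tau> :: "nat \<Rightarrow> nat \<Rightarrow> real"
    and \<sigma>min \<sigma>max s_minus s_plus a :: real
    and M :: "'w measure" and X :: "'w \<Rightarrow> 'h::{real_inner,banach}" and C :: "'h \<Rightarrow> 'h"
    and emb :: "'h \<Rightarrow> real^2 \<Rightarrow> real"
    and L :: "(nat \<Rightarrow> nat \<Rightarrow> real^2 \<Rightarrow> real) \<Rightarrow> (real^2 \<Rightarrow> real) \<Rightarrow> real"
  defines "\<Phi> \<equiv> neg_log_likelihood \<Omega> d g \<tau>"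
    and "S \<equiv> conductivities \<Omega> \<sigma>min \<sigma>max"
    and "\<Sigma> \<equiv> (\<lambda>\<omega> x. link s_minus s_plus a p (emb (X \<omega>) x))"
  assumes "open \<Omega>" and "bounded \<Omega>" and "lipschitz_boundary \<Omega>"
    and "d \<ge> 1" and "p \<in> {1, 2, 3}"
    and "s_minus > 0" and "s_plus > 0" and "a > 0"
    and "0 < \<sigma>min" and "\<sigma>min < \<sigma>max"
    and "\<forall>i\<in>{1..d}. \<forall>j\<in>{1..d}. \<tau> i j > 0"
    and "\<forall>i\<in>{1..d}. H_half \<Omega> (g i)"
    and "prob_space M" and "function_space_on \<Omega> emb"
    and "covariance_operator C" and "centred_gaussian M X C"
    and "\<forall>y. L1_data \<Omega> d y \<longrightarrow> (\<exists>c>0. \<forall>\<sigma>\<in>S. L y \<sigma> = c * exp (- \<Phi> y \<sigma>))"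
  shows "(\<forall>y. L1_data \<Omega> d y \<longrightarrow> L y \<in> borel_measurable (Linf_borel \<Omega> S)) \<and>
         (\<forall>y. L1_data \<Omega> d y \<longrightarrow>
            (AE \<omega> in M. \<Sigma> \<omega> \<in> S \<longrightarrow> Linf_continuous_at \<Omega> S (\<Phi> y) (\<Sigma> \<omega>)) \<and>
            (AE \<sigma> in prior_law \<Omega> S M \<Sigma>. Linf_continuous_at \<Omega> S (\<Phi> y) \<sigma>)) \<and>
         (\<exists>K :: real \<Rightarrow> real \<Rightarrow> real. \<forall>r>0. \<forall>s>0. \<forall>\<sigma>\<in>conductivities \<Omega> \<sigma>min s. \<forall>y1 y2.
            L1_data \<Omega> d y1 \<and> L1_data \<Omega> d y2 \<and>
            (\<forall>i\<in>{1..d}. \<forall>j\<in>{1..d}. max (L1_norm \<Omega> (y1 i j)) (L1_norm \<Omega> (y2 i j)) < r) \<longrightarrow>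
            \<bar>\<Phi> y1 \<sigma> - \<Phi> y2 \<sigma>\<bar>
              \<le> K r s * (\<Sum>i=1..d. \<Sum>j=1..d. L1_norm \<Omega> (\<lambda>x. y1 i j x - y2 i j x)))"
proof -
  obtain R where "finite_perimeter_domain \<Omega> R"
    using lipschitz_domain[OF assms(4-6)] .
  then interpret finite_perimeter_domain \<Omega> R .
  note c = \<open>0 < \<sigma>min\<close> and g = \<open>\<forall>i\<in>{1..d}. H_half \<Omega> (g i)\<close> and \<tau> = \<open>\<forall>i\<in>{1..d}. \<forall>j\<in>{1..d}. \<tau> i j > 0\<close>
  have cont: "Linf_continuous_at \<Omega> S (\<Phi> y) \<sigma>" if "L1_data \<Omega> d y" "\<sigma> \<in> S" for y \<sigma>
    unfolding \<Phi>_def S_def using that(2) c \<open>\<sigma>min < \<sigma>max\<close>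
    by (intro neg_log_likelihood_continuous[OF _ _ _ g \<tau> that(1)]) (auto simp: S_def)
  have 1: "L y \<in> borel_measurable (Linf_borel \<Omega> S)" if y: "L1_data \<Omega> d y" for y
  proof -
    obtain k where k: "\<And>\<sigma>. \<sigma> \<in> S \<Longrightarrow> L y \<sigma> = k * exp (- \<Phi> y \<sigma>)" using assms(20) y by blast
    have "\<Phi> y \<in> borel_measurable (Linf_borel \<Omega> S)"
      by (rule Linf_continuous_imp_measurable) (rule cont[OF y])
    then have "(\<lambda>\<sigma>. k * exp (- \<Phi> y \<sigma>)) \<in> borel_measurable (Linf_borel \<Omega> S)" by measurable
    then show ?thesis
      by (rule measurable_cong[THEN iffD1, rotated]) (simp add: k space_Linf_borel)
  qed
  \<comment> \<open>The prior law lives on the set \<open>S\<close>, on all of which continuity holds.\<close>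
  have 2: "AE \<sigma> in prior_law \<Omega> S M \<Sigma>. Linf_continuous_at \<Omega> S (\<Phi> y) \<sigma>" if y: "L1_data \<Omega> d y" for y
    by (rule AE_I2) (simp add: prior_law_def space_Linf_borel cont[OF y])
  have 3: "\<bar>\<Phi> y1 \<sigma> - \<Phi> y2 \<sigma>\<bar>
      \<le> (\<Sum>i=1..d. \<Sum>j=1..d. 1 / \<tau> i j) * (\<Sum>i=1..d. \<Sum>j=1..d. L1_norm \<Omega> (\<lambda>x. y1 i j x - y2 i j x))"
    if "0 < s" "\<sigma> \<in> conductivities \<Omega> \<sigma>min s" "L1_data \<Omega> d y1" "L1_data \<Omega> d y2" for s \<sigma> y1 y2
    unfolding \<Phi>_def
    by (rule neg_log_likelihood_lipschitz[OF that(2) c less_imp_le[OF that(1)] g \<tau> that(3,4)])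
  show ?thesis
    using 1 2 3 cont by (intro conjI allI impI exI[of _ "\<lambda>_ _. \<Sum>i=1..d. \<Sum>j=1..d. 1 / \<tau> i j"] ballI) auto
qed

end
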